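(* Let $n,m\geq 1$ and let $A,C\in\mathbb{R}^{n\times n}$, $B\in\mathbb{R}^{n\times m}$. Let $\mathcal{L}_{(-A,C)}:\mathbb{S}^n\to\mathbb{S}^n$ be the linear operator $\mathcal{L}_{(-A,C)}(M)=-MA-A^\top M+C^\top MC$. The following statements are equivalent: (i) The backward-structured stochastic system $dX(t)=[AX(t)+Bu(t)+Cz(t)]\,dt+z(t)\,dW(t)$, $X(0)=x$, is stabilizable. (ii) For every real $\lambda\leq 0$ and every $H\in\bar{\mathbb{S}}^n_+$: if $\mathcal{L}_{(-A,C)}(H)=\lambda H$ and $B^\top H=0$, then $H=0$.
   Context: $\mathbb{S}^n$ is the space of real symmetric $n\times n$ matrices and $\bar{\mathbb{S}}^n_+$ is the set of positive semidefinite matrices in $\mathbb{S}^n$. $W$ is a standard one-dimensional Brownian motion. In the system, the pair $(u,z)$ ($\mathbb{R}^m$- and $\mathbb{R}^n$-valued) is the control. The system is stabilizable if there exist matrices $F\in\mathbb{R}^{m\times n}$ and $K\in\mathbb{R}^{n\times n}$ such that the closed-loop system obtained from $u=FX$, $z=KX$, namely $dX(t)=(A+BF+CK)X(t)\,dt+KX(t)\,dW(t)$, $X(0)=x$, is $L^2$-stable, i.e. its solution $X(\cdot\,;x)$ satisfies $\mathbb{E}\int_0^\infty|X(t;x)|^2dt<\infty$ for all $x\in\mathbb{R}^n$. (For such linear uncontrolled systems, $L^2$-stability is equivalent to exponential mean-square stability, $\mathbb{E}|X(t;x)|^2\leq Me^{-\lambda t}|x|^2$ for all $t\ge0$, $x\in\mathbb{R}^n$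 with some constants $M\geq1,\lambda>0$, and to asymptotic mean-square stability, $\lim_{t\to\infty}\mathbb{E}|X(t;x)|^2=0$ for all $x\in\mathbb{R}^n$; so the three corresponding notions of stabilizability coincide.) *)

theory Defs
  imports "HOL-Probability.Probability"
begin

text \<open>
  Stochastic processes are functions \<open>real \<Rightarrow> 'w \<Rightarrow> 'a\<close> of which only the times \<open>t \<ge> 0\<close> matter.
  The filtration \<open>F\<close> is arbitrary; neither completeness nor right-continuity is required, so the
  augmented natural filtration of \<open>W\<close> is a special case.
\<close>

locale brownian_motion = prob_space M
  for M :: "'w measure" and F :: "real \<Rightarrow> 'w measure" and W :: "real \<Rightarrow> 'w \<Rightarrow> real" +
  assumes filtration_subalgebra: "0 \<le> t \<Longrightarrow> subalgebra M (F t)"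
    and filtration_mono: "0 \<le> s \<Longrightarrow> s \<le> t \<Longrightarrow> sets (F s) \<subseteq> sets (F t)"
    and adapted: "0 \<le> t \<Longrightarrow> W t \<in> borel_measurable (F t)"
    and initial: "AE \<omega> in M. W 0 \<omega> = 0"
    and increment_indep: "0 \<le> s \<Longrightarrow> s < t \<Longrightarrow>
      indep_set (sets (F s)) {(\<lambda>\<omega>. W t \<omega> - W s \<omega>) -` S \<inter> space M | S. S \<in> sets borel}"
    and increment_normal: "0 \<le> s \<Longrightarrow> s < t \<Longrightarrow>
      distributed M lborel (\<lambda>\<omega>. W t \<omega> - W s \<omega>) (normal_density 0 (sqrt (t - s)))"
    and continuous_paths: "AE \<omega> in M. continuous_on {0..} (\<lambda>t. W t \<omega>)"

definition progressively_measurable ::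
    "(real \<Rightarrow> 'w measure) \<Rightarrow> (real \<Rightarrow> 'w \<Rightarrow> 'a::euclidean_space) \<Rightarrow> bool" where
  "progressively_measurable F \<phi> \<longleftrightarrow>
     (\<forall>T\<ge>0. (\<lambda>(t, \<omega>). \<phi> t \<omega>) \<in> borel_measurable (restrict_space borel {0..T} \<Otimes>\<^sub>M F T))"

definition mean_square_on ::
    "'w measure \<Rightarrow> real set \<Rightarrow> (real \<Rightarrow> 'w \<Rightarrow> 'a::euclidean_space) \<Rightarrow> ennreal" where
  "mean_square_on M I \<phi> = (\<integral>\<^sup>+ \<omega>. (\<integral>\<^sup>+ t\<in>I. ennreal ((norm (\<phi> t \<omega>))\<^sup>2) \<partial>lborel) \<partial>M)"

definition admissible ::
    "'w measure \<Rightarrow> (real \<Rightarrow> 'w measure) \<Rightarrow> (real \<Rightarrow> 'w \<Rightarrow> 'a::euclidean_space) \<Rightarrow> bool" where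
  "admissible M F \<phi> \<longleftrightarrow>
     progressively_measurable F \<phi> \<and> (\<forall>T\<ge>0. mean_square_on M {0..T} \<phi> < \<infinity>)"

text \<open>
  \<open>\<phi>\<close> is a simple process on the partition \<open>0 = \<tau>\<^sub>0 \<le> \<dots> \<le> \<tau>\<^sub>k = T\<close> and \<open>I\<close> is its elementary
  stochastic integral over \<open>[0, T]\<close>.
\<close>

definition simple_ito_integral ::
    "'w measure \<Rightarrow> (real \<Rightarrow> 'w measure) \<Rightarrow> (real \<Rightarrow> 'w \<Rightarrow> real) \<Rightarrow>
     (real \<Rightarrow> 'w \<Rightarrow> 'a::euclidean_space) \<Rightarrow> real \<Rightarrow> ('w \<Rightarrow> 'a) \<Rightarrow> bool" where
  "simple_ito_integral M F W \<phi> T I \<longleftrightarrow>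
     (\<exists>(k::nat) (\<tau> :: nat \<Rightarrow> real) (\<xi> :: nat \<Rightarrow> 'w \<Rightarrow> 'a).
        \<tau> 0 = 0 \<and> \<tau> k = T \<and> (\<forall>i<k. \<tau> i \<le> \<tau> (Suc i)) \<and>
        (\<forall>i<k. \<xi> i \<in> borel_measurable (F (\<tau> i)) \<and> integrable M (\<lambda>\<omega>. (norm (\<xi> i \<omega>))\<^sup>2)) \<and>
        \<phi> = (\<lambda>t \<omega>. \<Sum>i<k. indicator {\<tau> i<..\<tau> (Suc i)} t *\<^sub>R \<xi> i \<omega>) \<and>
        I = (\<lambda>\<omega>. \<Sum>i<k. (W (\<tau> (Suc i)) \<omega> - W (\<tau> i) \<omega>) *\<^sub>R \<xi> i \<omega>))"

text \<open>
  The Ito integral over \<open>[0, T]\<close> is the mean-square limit of elementary integrals. It is determined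
  only up to null sets, hence the relational form.
\<close>

definition has_ito_integral ::
    "'w measure \<Rightarrow> (real \<Rightarrow> 'w measure) \<Rightarrow> (real \<Rightarrow> 'w \<Rightarrow> real) \<Rightarrow>
     (real \<Rightarrow> 'w \<Rightarrow> 'a::euclidean_space) \<Rightarrow> real \<Rightarrow> ('w \<Rightarrow> 'a) \<Rightarrow> bool" where
  "has_ito_integral M F W \<phi> T I \<longleftrightarrow>
     admissible M F \<phi> \<and> I \<in> borel_measurable M \<and>
     (\<exists>\<phi>s Is.
        (\<forall>j::nat. simple_ito_integral M F W (\<phi>s j) T (Is j)) \<and>
        (\<lambda>j. mean_square_on M {0..T} (\<lambda>t \<omega>. \<phi>s j t \<omega> - \<phi> t \<omega>)) \<longlonglongrightarrow> 0 \<and>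
        (\<lambda>j. \<integral>\<^sup>+ \<omega>. ennreal ((norm (Is j \<omega> - I \<omega>))\<^sup>2) \<partial>M) \<longlonglongrightarrow> 0)"

text \<open>\<open>dX(t) = b(t) dt + \<sigma>(t) dW(t)\<close> for \<open>t \<ge> 0\<close>, with \<open>X(0) = x\<close>.\<close>

definition ito_process ::
    "'w measure \<Rightarrow> (real \<Rightarrow> 'w measure) \<Rightarrow> (real \<Rightarrow> 'w \<Rightarrow> real) \<Rightarrow> 'a::euclidean_space \<Rightarrow>
     (real \<Rightarrow> 'w \<Rightarrow> 'a) \<Rightarrow> (real \<Rightarrow> 'w \<Rightarrow> 'a) \<Rightarrow> (real \<Rightarrow> 'w \<Rightarrow> 'a) \<Rightarrow> bool" where
  "ito_process M F W x b \<sigma> X \<longleftrightarrow>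
     admissible M F X \<and>
     (AE \<omega> in M. continuous_on {0..} (\<lambda>t. X t \<omega>)) \<and>
     (\<forall>t\<ge>0. \<exists>I. has_ito_integral M F W \<sigma> t I \<and>
        (AE \<omega> in M. X t \<omega> = x + (LINT s:{0..t}|lborel. b s \<omega>) + I \<omega>))"

text \<open>\<open>dX(t) = A X(t) dt + C X(t) dW(t)\<close>, \<open>X(0) = x\<close>.\<close>

definition linear_sde_solution ::
    "'w measure \<Rightarrow> (real \<Rightarrow> 'w measure) \<Rightarrow> (real \<Rightarrow> 'w \<Rightarrow> real) \<Rightarrow>
     real^'n^'n \<Rightarrow> real^'n^'n \<Rightarrow> real^'n \<Rightarrow> (real \<Rightarrow> 'w \<Rightarrow> real^'n) \<Rightarrow> bool" where
  "linear_sde_solution M F W A C x X \<longleftrightarrow>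
     ito_process M F W x (\<lambda>t \<omega>. A *v X t \<omega>) (\<lambda>t \<omega>. C *v X t \<omega>) X"

text \<open>\<open>dX(t) = [A X(t) + B u(t) + C z(t)] dt + z(t) dW(t)\<close>, \<open>X(0) = x\<close>, with control \<open>(u, z)\<close>.\<close>

definition backward_structured_solution ::
    "'w measure \<Rightarrow> (real \<Rightarrow> 'w measure) \<Rightarrow> (real \<Rightarrow> 'w \<Rightarrow> real) \<Rightarrow>
     real^'n^'n \<Rightarrow> real^'m^'n \<Rightarrow> real^'n^'n \<Rightarrow> real^'n \<Rightarrow>
     (real \<Rightarrow> 'w \<Rightarrow> real^'m) \<Rightarrow> (real \<Rightarrow> 'w \<Rightarrow> real^'n) \<Rightarrow> (real \<Rightarrow> 'w \<Rightarrow> real^'n) \<Rightarrow> bool" where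
  "backward_structured_solution M F W A B C x u z X \<longleftrightarrow>
     admissible M F u \<and> admissible M F z \<and>
     ito_process M F W x (\<lambda>t \<omega>. A *v X t \<omega> + B *v u t \<omega> + C *v z t \<omega>) z X"

text \<open>
  \<open>S x X\<close> means that \<open>X\<close> solves the uncontrolled system with initial state \<open>x\<close>. Solutions are unique
  only up to indistinguishability, so ``its solution'' is rendered as: a solution exists, and
  every solution is square integrable over \<open>[0, \<infinity>)\<close>.
\<close>

definition L2_stable ::
    "'w measure \<Rightarrow> ('a \<Rightarrow> (real \<Rightarrow> 'w \<Rightarrow> 'a::euclidean_space) \<Rightarrow> bool) \<Rightarrow> bool" where
  "L2_stable M S \<longleftrightarrow>
     (\<forall>x. (\<exists>X. S x X) \<and> (\<forall>X. S x X \<longrightarrow> mean_square_on M {0..} X < \<infinity>))"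

definition stabilizable ::
    "'w measure \<Rightarrow> (real \<Rightarrow> 'w measure) \<Rightarrow> (real \<Rightarrow> 'w \<Rightarrow> real) \<Rightarrow>
     real^'n^'n \<Rightarrow> real^'m^'n \<Rightarrow> real^'n^'n \<Rightarrow> bool" where
  "stabilizable M F W A B C \<longleftrightarrow>
     (\<exists>(\<Phi> :: real^'n^'m) (K :: real^'n^'n).
        L2_stable M (\<lambda>x X. backward_structured_solution M F W A B C x
                              (\<lambda>t \<omega>. \<Phi> *v X t \<omega>) (\<lambda>t \<omega>. K *v X t \<omega>) X))"

lemma admissible_matrix_mult:
  fixes X :: "real \<Rightarrow> 'w \<Rightarrow> real^'n" and K :: "real^'n^'m"
  assumes sub: "\<And>t. 0 \<le> t \<Longrightarrow> subalgebra M (F t)" and X: "admissible M F X"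
  shows "admissible M F (\<lambda>t \<omega>. K *v X t \<omega>)"
proof -
  have cont: "continuous_on UNIV (\<lambda>v. K *v v)"
    by (simp add: linear_continuous_on linear_linear)
  have meas: "(\<lambda>(t, \<omega>). K *v X t \<omega>) \<in> borel_measurable (restrict_space borel {0..T} \<Otimes>\<^sub>M F T)"
    if "0 \<le> T" for T
  proof -
    have "(\<lambda>(t, \<omega>). X t \<omega>) \<in> borel_measurable (restrict_space borel {0..T} \<Otimes>\<^sub>M F T)"
      using X that by (auto simp: admissible_def progressively_measurable_def)
    from measurable_compose[OF this borel_measurable_continuous_onI[OF cont]]
    show ?thesis by (simp add: case_prod_unfold)
  qed
  define c where "c = (onorm (\<lambda>v. K *v v))\<^sup>2"
  have bound: "(norm (K *v v))\<^sup>2 \<le> c * (norm v)\<^sup>2" for v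
    unfolding c_def power_mult_distrib[symmetric]
    by (intro power_mono onorm) (simp_all add: linear_linear)
  have c0: "c \<ge> 0" by (simp add: c_def)
  have fin: "mean_square_on M {0..T} (\<lambda>t \<omega>. K *v X t \<omega>) < \<infinity>" if T: "0 \<le> T" for T
  proof -
    define g where "g = (\<lambda>(\<omega>, t). ennreal ((norm (X (max 0 (min T t)) \<omega>))\<^sup>2) * indicator {0..T} t)"
    have XT: "(\<lambda>(t, \<omega>). X t \<omega>) \<in> borel_measurable (restrict_space borel {0..T} \<Otimes>\<^sub>M F T)"
      using X T by (auto simp: admissible_def progressively_measurable_def)
    have "(\<lambda>\<omega>. \<omega>) \<in> measurable M (F T)"
      by (rule measurable_from_subalg[OF sub[OF T]]) simp
    then have "(\<lambda>p. (max 0 (min T (snd p)), fst p)) \<in>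
        measurable (M \<Otimes>\<^sub>M lborel) (restrict_space borel {0..T} \<Otimes>\<^sub>M F T)"
      using T by (intro measurable_Pair measurable_restrict_space2
          measurable_compose[OF measurable_fst]) auto
    from measurable_compose[OF this XT]
    have "(\<lambda>(\<omega>, t). X (max 0 (min T t)) \<omega>) \<in> borel_measurable (M \<Otimes>\<^sub>M lborel)"
      by (simp add: case_prod_unfold)
    then have g [measurable]: "g \<in> borel_measurable (M \<Otimes>\<^sub>M lborel)"
      unfolding g_def case_prod_unfold by measurable
    have inner: "(\<lambda>t. g (\<omega>, t)) \<in> borel_measurable lborel" if "\<omega> \<in> space M" for \<omega>
      using that by measurable
    have outer: "(\<lambda>\<omega>. \<integral>\<^sup>+ t. g (\<omega>, t) \<partial>lborel) \<in> borel_measurable M"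
      by measurable
    have g_eq: "(\<integral>\<^sup>+ t\<in>{0..T}. ennreal ((norm (X t \<omega>))\<^sup>2) \<partial>lborel) = (\<integral>\<^sup>+ t. g (\<omega>, t) \<partial>lborel)" for \<omega>
      by (intro nn_integral_cong) (auto simp: g_def indicator_def)
    have "mean_square_on M {0..T} (\<lambda>t \<omega>. K *v X t \<omega>) \<le>
        (\<integral>\<^sup>+ \<omega>. (\<integral>\<^sup>+ t. ennreal c * g (\<omega>, t) \<partial>lborel) \<partial>M)"
      unfolding mean_square_on_def
    proof (intro nn_integral_mono)
      fix \<omega> t
      show "ennreal ((norm (K *v X t \<omega>))\<^sup>2) * indicator {0..T} t \<le> ennreal c * g (\<omega>, t)"
        using bound[of "X t \<omega>"] c0
        by (auto simp: g_def indicator_def ennreal_mult[symmetric] intro!: ennreal_leI)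
    qed
    also have "\<dots> = (\<integral>\<^sup>+ \<omega>. ennreal c * (\<integral>\<^sup>+ t. g (\<omega>, t) \<partial>lborel) \<partial>M)"
      by (intro nn_integral_cong nn_integral_cmult inner)
    also have "\<dots> = ennreal c * mean_square_on M {0..T} X"
      by (simp add: nn_integral_cmult[OF outer] mean_square_on_def g_eq)
    also have "\<dots> < \<infinity>"
      using X T by (simp add: admissible_def ennreal_mult_less_top)
    finally show ?thesis .
  qed
  show ?thesis using meas fin by (auto simp: admissible_def progressively_measurable_def)
qed

lemma backward_structured_solution_closed_loop:
  assumes "brownian_motion M F W"
  shows "backward_structured_solution M F W A B C x (\<lambda>t \<omega>. \<Phi> *v X t \<omega>) (\<lambda>t \<omega>. K *v X t \<omega>) X \<longleftrightarrow>
    linear_sde_solution M F W (A + B ** \<Phi> + C ** K) K x X"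
proof -
  interpret brownian_motion M F W by fact
  have "admissible M F (\<lambda>t \<omega>. \<Phi> *v X t \<omega>)" "admissible M F (\<lambda>t \<omega>. K *v X t \<omega>)"
    if "admissible M F X"
    using admissible_matrix_mult[OF filtration_subalgebra that] by auto
  then show ?thesis
    unfolding backward_structured_solution_def linear_sde_solution_def ito_process_def
    by (auto simp: matrix_vector_mult_add_rdistrib matrix_vector_mul_assoc)
qed

definition positive_semidefinite :: "real^'n^'n \<Rightarrow> bool" where
  "positive_semidefinite H \<longleftrightarrow> transpose H = H \<and> (\<forall>x. 0 \<le> x \<bullet> (H *v x))"

definition lyapunov_op :: "real^'n^'n \<Rightarrow> real^'n^'n \<Rightarrow> real^'n^'n \<Rightarrow> real^'n^'n" where
  "lyapunov_op A C H = H ** A + transpose A ** H + transpose C ** H ** C"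

lemma lyapunov_op_uminus:
  "lyapunov_op (- A) C H = - (H ** A) - transpose A ** H + transpose C ** H ** C"
  by (simp add: lyapunov_op_def matrix_matrix_mult_def transpose_def vec_eq_iff sum_negf)

end

theory Submission
  imports Defs
begin

text \<open>
  Write \<open>L(H) = - H A - A\<^sup>T H + C\<^sup>T H C\<close> for the operator of the criterion and, for gains \<open>\<Phi>\<close> and \<open>K\<close>,
  \<open>\<Lambda>(P) = P R + R\<^sup>T P + K\<^sup>T P K\<close> with \<open>R = A + B \<Phi> + C K\<close> for the Lyapunov operator of the closed loop. The link
  between probability and algebra is \<open>second_moment_identity\<close>: every solution of the closed loop and every
  symmetric \<open>P\<close> satisfy \<open>E[X\<^sub>t \<bullet> P X\<^sub>t] = x \<bullet> P x + E \<integral> X\<^sub>s \<bullet> \<Lambda>(P) X\<^sub>s ds\<close>, the integral running over \<open>[0, t]\<close>. It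
  makes stabilizability equivalent to the existence of gains and of a positive definite \<open>P\<close> with \<open>\<Lambda>(P) < 0\<close>.

  Stabilizability implies the criterion. If the closed loop is stable, \<open>E|X\<^sub>t|\<^sup>2\<close> becomes arbitrarily small, so the
  identity gives \<open>P \<ge> 0\<close> whenever \<open>\<Lambda>(P) \<le> 0\<close>. Hence \<open>\<Lambda>\<close> is injective on symmetric matrices, thus surjective,
  and there is \<open>P > 0\<close> with \<open>\<Lambda>(P) = - 1\<close> (\<open>lyapunov_solution_of_stable\<close>). In terms of \<open>Q = P\<^sup>-\<^sup>1\<close>, completing the
  square in \<open>K\<close> eliminates this gain: the quadratic form of \<open>N = C Q C\<^sup>T - 2 A Q - 2 B \<Phi> Q - Q\<^sup>2\<close> is nonnegative. For
  \<open>H \<ge> 0\<close> with \<open>L(H) = \<mu> H\<close>, \<open>\<mu> \<le> 0\<close> and \<open>B\<^sup>T H = 0\<close> this yields \<open>0 \<le> H \<bullet> N = \<mu> (H \<bullet> Q) - H \<bullet> Q\<^sup>2\<close>, where both terms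
  on the right are at most \<open>0\<close>; so \<open>H \<bullet> Q\<^sup>2 = 0\<close> and \<open>H = 0\<close> (\<open>eigenvector_zero_if_lyapunov\<close>).

  The criterion implies stabilizability. The inequality \<open>C Q C\<^sup>T - A Q - Q A\<^sup>T + k B B\<^sup>T > 0\<close> in \<open>Q > 0\<close> and a real
  number \<open>k\<close> produces stabilizing gains (\<open>feedback_of_feasible\<close>, \<open>stable_of_lyapunov\<close>). If it has no solution, a
  separating hyperplane is a nonzero \<open>H \<ge> 0\<close> with \<open>L(H) \<le> 0\<close> and \<open>B\<^sup>T H = 0\<close> (\<open>feasible_or_subharmonic\<close>). Such
  an \<open>H\<close> need not be an eigenmatrix, but its kernel is invariant under \<open>A\<close> and \<open>C\<close>. Therefore \<open>L\<close> maps the span of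
  the face of all \<open>M \<ge> 0\<close> that vanish on this kernel into itself, and by Brouwer's theorem this face contains an
  eigenmatrix \<open>M\<close> (\<open>psd_eigenvector_exists\<close>). Comparing \<open>M\<close> with \<open>H\<close> shows that its eigenvalue is at most \<open>0\<close>
  (\<open>psd_eigenvalue_nonpos\<close>), and \<open>B\<^sup>T M = 0\<close> because \<open>B\<^sup>T H = 0\<close>. This contradicts the criterion.

  Two pieces of stochastic analysis enter. For the second moment identity, the Ito integral is frozen at its value
  at the final time and the quadratic form is differentiated along the drift alone; the isometry and the
  orthogonality of stochastic increments to the past do the rest. Stability also
  includes the existence of a solution (\<open>linear_sde_solution_exists\<close>). It is the almost sure limit of Euler
  schemes on dyadic grids. Since the filtration may lack null sets and right limits, the limit is formed
  pointwise from values at grid times, which are adapted, rather than chosen in an \<open>L\<^sup>2\<close> class.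
\<close>

section \<open>Matrices and quadratic forms\<close>

lemma inner_matrix_transpose:
  fixes A B :: "real^'n^'m"
  shows "transpose A \<bullet> transpose B = A \<bullet> B"
proof -
  have "transpose A \<bullet> transpose B = (\<Sum>j\<in>UNIV. \<Sum>i\<in>UNIV. A$i$j * B$i$j)"
    by (simp add: inner_vec_def transpose_def)
  also have "\<dots> = A \<bullet> B" by (subst sum.swap) (simp add: inner_vec_def)
  finally show ?thesis .
qed

lemma inner_matrix_mult_left:
  fixes A :: "real^'n^'m" and B :: "real^'k^'n" and D :: "real^'k^'m"
  shows "(A ** B) \<bullet> D = B \<bullet> (transpose A ** D)"
proof -
  have "(A ** B) \<bullet> D = (\<Sum>i\<in>UNIV. \<Sum>j\<in>UNIV. \<Sum>k\<in>UNIV. A$i$k * B$k$j * D$i$j)"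
    by (simp add: inner_vec_def matrix_matrix_mult_def sum_distrib_right)
  also have "\<dots> = (\<Sum>k\<in>UNIV. \<Sum>j\<in>UNIV. \<Sum>i\<in>UNIV. A$i$k * B$k$j * D$i$j)"
    by (subst sum.swap, subst (2) sum.swap, subst sum.swap) (rule refl)
  also have "\<dots> = B \<bullet> (transpose A ** D)"
    by (simp add: inner_vec_def matrix_matrix_mult_def transpose_def sum_distrib_left mult_ac)
  finally show ?thesis .
qed

lemma inner_matrix_mult_right:
  fixes A :: "real^'n^'m" and B :: "real^'k^'n" and D :: "real^'k^'m"
  shows "(A ** B) \<bullet> D = A \<bullet> (D ** transpose B)"
proof -
  have "(A ** B) \<bullet> D = (transpose B ** transpose A) \<bullet> transpose D"
    by (simp add: inner_matrix_transpose flip: matrix_transpose_mul)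
  also have "\<dots> = transpose A \<bullet> transpose (D ** transpose B)"
    by (simp add: inner_matrix_mult_left matrix_transpose_mul)
  finally show ?thesis by (simp add: inner_matrix_transpose)
qed

lemma inner_vector_matrix: "x \<bullet> (y v* (A :: real^'n^'m)) = (A *v x) \<bullet> y"
  by (metis dot_lmul_matrix inner_commute)

lemma inner_matrix_vector:
  fixes A :: "real^'n^'m"
  shows "(A *v x) \<bullet> y = x \<bullet> (transpose A *v y)" "y \<bullet> (A *v x) = (transpose A *v y) \<bullet> x"
  by (metis dot_lmul_matrix inner_commute transpose_matrix_vector)+

definition outer :: "real^'m \<Rightarrow> real^'n \<Rightarrow> real^'n^'m" where
  "outer x y = (\<chi> i j. x $ i * y $ j)"

lemma outer_mult_vector: "outer x y *v z = (y \<bullet> z) *\<^sub>R x"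
  by (simp add: outer_def vec_eq_iff matrix_vector_mult_def inner_vec_def sum_distrib_left sum_distrib_right mult_ac)

lemma inner_outer: "M \<bullet> outer x y = x \<bullet> (M *v y)"
  by (simp add: outer_def matrix_vector_mult_def inner_vec_def sum_distrib_left mult_ac)

lemma matrix_eq_0_iff: "(M :: real^'n^'m) = 0 \<longleftrightarrow> (\<forall>x. M *v x = 0)"
  by (metis matrix_eq matrix_vector_mult_0)

lemmas matvec = matrix_vector_mult_add_rdistrib matrix_vector_mult_diff_rdistrib
  matrix_vector_mul_assoc[symmetric] scaleR_matrix_vector_assoc[symmetric]

lemma lyapunov_op_quadratic_form:
  fixes A C P :: "real^'n^'n"
  assumes "transpose P = P"
  shows "x \<bullet> (lyapunov_op A C P *v x) = 2 * ((P *v x) \<bullet> (A *v x)) + (C *v x) \<bullet> (P *v (C *v x))"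
proof -
  have "x \<bullet> (P *v (A *v x)) = (P *v x) \<bullet> (A *v x)"
    using assms inner_matrix_vector(2)[of x P "A *v x"] by simp
  moreover have "x \<bullet> (transpose A *v (P *v x)) = (P *v x) \<bullet> (A *v x)"
    using inner_matrix_vector(2)[of x "transpose A" "P *v x"] by (simp add: inner_commute)
  moreover have "x \<bullet> (transpose C *v (P *v (C *v x))) = (C *v x) \<bullet> (P *v (C *v x))"
    using inner_matrix_vector(2)[of x "transpose C" "P *v (C *v x)"] by simp
  ultimately show ?thesis by (simp add: lyapunov_op_def matvec inner_add_right)
qed

lemma transpose_zero: "transpose (0 :: real^'m^'n) = 0"
  by (simp add: transpose_def vec_eq_iff)

lemma transpose_add: "transpose (A + B) = transpose A + transpose (B :: real^'n^'m)"
  by (simp add: transpose_def vec_eq_iff)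

lemma transpose_lyapunov_op:
  fixes A C P :: "real^'n^'n"
  assumes "transpose P = P"
  shows "transpose (lyapunov_op A C P) = lyapunov_op A C P"
  by (simp add: lyapunov_op_def transpose_add matrix_transpose_mul matrix_mul_assoc assms)

lemma matrix_vector_mult_minus: "(- A) *v x = - ((A :: real^'n^'m) *v x)"
  by (simp add: matrix_vector_mult_def vec_eq_iff sum_negf)

text \<open>
  With \<open>y = H x\<close>, the form takes the value \<open>2 t |y|\<^sup>2 + O(t\<^sup>2)\<close> at \<open>x + t y\<close>; nonnegativity for small negative \<open>t\<close> forces \<open>y = 0\<close>.
\<close>
lemma symmetric_kernel:
  fixes H :: "real^'n^'n"
  assumes sym: "transpose H = H" and psd: "\<And>x. 0 \<le> x \<bullet> (H *v x)" and x: "x \<bullet> (H *v x) = 0"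
  shows "H *v x = 0"
proof -
  define y where "y = H *v x"
  have "(y \<bullet> y)\<^sup>2 = 0"
  proof (rule ccontr)
    assume ne: "(y \<bullet> y)\<^sup>2 \<noteq> 0"
    then have pos: "y \<bullet> y > 0" by auto
    define q where "q = y \<bullet> (H *v y)"
    have q: "q \<ge> 0" using psd by (simp add: q_def)
    \<comment> \<open>the minimum of \<open>2 t |y|\<^sup>2 + t\<^sup>2 q\<close> lies at \<open>- |y|\<^sup>2 / q\<close>; the added \<open>1\<close> covers \<open>q = 0\<close>\<close>
    define t where "t = - (y \<bullet> y) / (q + 1)"
    have xy: "x \<bullet> (H *v y) = y \<bullet> y"
      using inner_matrix_vector(2)[of x H y] by (simp add: sym y_def)
    have "(x + t *\<^sub>R y) \<bullet> (H *v (x + t *\<^sub>R y)) = 2 * t * (y \<bullet> y) + t\<^sup>2 * q"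
      using x xy by (simp add: y_def[symmetric] q_def matrix_vector_right_distrib matrix_vector_mult_scaleR
          inner_add_left inner_add_right power2_eq_square algebra_simps)
    also have "\<dots> = t * (y \<bullet> y) * (2 - q / (q+1))"
    proof -
      have "t * q = (y \<bullet> y) * (- (q / (q+1)))" by (simp add: t_def)
      then have "t * (t * q) = t * ((y \<bullet> y) * (- (q / (q+1))))" by simp
      then show ?thesis by (simp add: power2_eq_square algebra_simps)
    qed
    also have "\<dots> < 0"
    proof -
      have "q / (q+1) < 2" "t < 0" using q pos by (auto simp: t_def field_simps)
      then show ?thesis using pos by (simp add: mult_neg_pos mult_less_0_iff)
    qed
    finally show False using psd[of "x + t *\<^sub>R y"] by simp
  qed
  then show ?thesis by (simp add: y_def)
qed

lemma matrix_mult_bilinear: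
  fixes A B :: "real^'n^'m" and D E :: "real^'k^'n"
  shows "(A + B) ** D = A ** D + B ** D" "(A - B) ** D = A ** D - B ** D"
    "A ** (D + E) = A ** D + A ** E" "A ** (D - E) = A ** D - A ** E"
    "(r *\<^sub>R A) ** D = r *\<^sub>R (A ** D)" "A ** (r *\<^sub>R D) = r *\<^sub>R (A ** D)"
    "(- A) ** D = - (A ** D)" "A ** (- D) = - (A ** D)"
  by (simp_all add: matrix_matrix_mult_def vec_eq_iff algebra_simps sum.distrib sum_subtractf
      sum_distrib_left sum_negf)

lemma linear_lyapunov_op: "linear (lyapunov_op A (C :: real^'n^'n))"
  by (rule linearI) (simp_all add: lyapunov_op_def matrix_mult_bilinear scaleR_right_distrib)

lemma continuous_on_matrix_mult [continuous_intros]: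
  fixes f :: "'a::topological_space \<Rightarrow> real^'n^'m" and g :: "'a \<Rightarrow> real^'k^'n"
  assumes "continuous_on S f" "continuous_on S g"
  shows "continuous_on S (\<lambda>x. f x ** g x)"
  unfolding matrix_matrix_mult_def by (intro continuous_intros assms)

lemma continuous_on_trace [continuous_intros]:
  fixes f :: "'a::topological_space \<Rightarrow> real^'n^'n"
  assumes "continuous_on S f"
  shows "continuous_on S (\<lambda>x. trace (f x))"
  unfolding trace_def by (intro continuous_intros assms)

lemma continuous_on_lyapunov_op [continuous_intros]:
  fixes f :: "'a::topological_space \<Rightarrow> real^'n^'n"
  assumes "continuous_on S f"
  shows "continuous_on S (\<lambda>x. lyapunov_op A C (f x))"
  unfolding lyapunov_op_def by (intro continuous_intros assms)

lemma trace_scaleR: "trace (r *\<^sub>R (A :: real^'n^'n)) = r * trace A"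
  by (simp add: trace_def sum_distrib_left)

lemma psd_trace_nonneg:
  assumes "positive_semidefinite H" shows "0 \<le> trace H"
proof -
  have "H $ i $ i = axis i 1 \<bullet> (H *v axis i 1)" for i
    by (simp add: inner_axis' matrix_vector_mul_component inner_axis)
  then show ?thesis using assms by (auto simp: trace_def positive_semidefinite_def intro!: sum_nonneg)
qed

lemma psd_kernel: "positive_semidefinite H \<Longrightarrow> x \<bullet> (H *v x) = 0 \<Longrightarrow> H *v x = 0"
  by (rule symmetric_kernel) (auto simp: positive_semidefinite_def)

text \<open>
  Nonnegativity on \<open>e\<^sub>i \<plusminus> e\<^sub>j\<close> bounds an off-diagonal entry by the mean of two diagonal ones. Thus the trace controls the norm, and trace-one slices of the cone are bounded.
\<close>
lemma psd_entry_bound: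
  assumes "positive_semidefinite H" shows "\<bar>H $ i $ j\<bar> \<le> trace H"
proof (cases "i = j")
  have d: "H $ k $ l = axis k 1 \<bullet> (H *v axis l 1)" for k l
    by (simp add: inner_axis' matrix_vector_mul_component inner_axis)
  have nn: "0 \<le> H $ k $ k" for k using assms by (simp add: d positive_semidefinite_def)
  case True
  then show ?thesis using nn[of i] member_le_sum[of i UNIV "\<lambda>i. H $ i $ i"] nn by (simp add: trace_def)
next
  have d: "H $ k $ l = axis k 1 \<bullet> (H *v axis l 1)" for k l
    by (simp add: inner_axis' matrix_vector_mul_component inner_axis)
  have nn: "0 \<le> H $ k $ k" for k using assms by (simp add: d positive_semidefinite_def)
  case False
  have sym: "H $ j $ i = H $ i $ j"
    using assms by (auto simp: positive_semidefinite_def transpose_def vec_eq_iff)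
  have "0 \<le> (axis i 1 + s *\<^sub>R axis j 1) \<bullet> (H *v (axis i 1 + s *\<^sub>R axis j 1))" for s
    using assms by (simp add: positive_semidefinite_def)
  then have "0 \<le> H $ i $ i + 2 * s * H $ i $ j + s\<^sup>2 * H $ j $ j" for s
    by (simp add: matrix_vector_right_distrib matrix_vector_mult_scaleR inner_add_left inner_add_right
        d[symmetric] sym power2_eq_square algebra_simps)
  from this[of 1] this[of "-1"] have "2 * \<bar>H $ i $ j\<bar> \<le> H $ i $ i + H $ j $ j" by auto
  also have "\<dots> = (\<Sum>k\<in>{i,j}. H $ k $ k)" using False by simp
  also have "\<dots> \<le> trace H" unfolding trace_def by (rule sum_mono2) (auto simp: nn)
  finally show ?thesis by simp
qed

lemma psd_trace_0:
  assumes "positive_semidefinite H" "trace H = 0" shows "H = 0"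
  using psd_entry_bound[OF assms(1)] assms(2) by (simp add: vec_eq_iff)

lemma psd_norm_bound:
  assumes "positive_semidefinite (H :: real^'n^'n)" 
  shows "norm H \<le> real CARD('n) * (real CARD('n) * trace H)"
proof -
  have "norm H \<le> (\<Sum>i\<in>UNIV. norm (H $ i))" by (simp add: norm_vec_def L2_set_le_sum)
  also have "\<dots> \<le> (\<Sum>i\<in>(UNIV::'n set). \<Sum>j\<in>(UNIV::'n set). \<bar>H $ i $ j\<bar>)"
    by (intro sum_mono norm_le_l1_cart)
  also have "\<dots> \<le> (\<Sum>i\<in>(UNIV::'n set). \<Sum>j\<in>(UNIV::'n set). trace H)"
    by (intro sum_mono psd_entry_bound assms)
  finally show ?thesis by simp
qed

lemma trace_congruence:
  fixes H :: "real^'n^'n" and B :: "real^'m^'n"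
  shows "trace (transpose B ** H ** B) = H \<bullet> (B ** transpose B)"
proof -
  have "trace (transpose B ** H ** B) = (transpose B ** H ** B) \<bullet> mat 1"
    by (simp add: trace_def inner_vec_def mat_def if_distrib cong: if_cong)
  also have "\<dots> = H \<bullet> (B ** transpose B)"
    using inner_matrix_mult_left[of "transpose B" "H ** B" "mat 1"] inner_matrix_mult_right[of H B B]
    by (simp add: matrix_mul_assoc)
  finally show ?thesis .
qed

lemma psd_congruence:
  fixes C :: "real^'n^'m"
  assumes "positive_semidefinite H" shows "positive_semidefinite (transpose C ** H ** C)"
proof -
  have "0 \<le> x \<bullet> (transpose C ** H ** C *v x)" for x
  proof -
    have "x \<bullet> (transpose C ** H ** C *v x) = (C *v x) \<bullet> (H *v (C *v x))"
      by (simp add: matvec inner_vector_matrix)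
    then show ?thesis using assms by (simp add: positive_semidefinite_def)
  qed
  then show ?thesis
    using assms by (simp add: positive_semidefinite_def matrix_transpose_mul matrix_mul_assoc)
qed

lemma psd_add:
  "positive_semidefinite H \<Longrightarrow> positive_semidefinite G \<Longrightarrow> positive_semidefinite (H + G)"
  by (simp add: positive_semidefinite_def transpose_add matvec inner_add_right)

lemma transpose_scaleR: "transpose (r *\<^sub>R (A::real^'n^'m)) = r *\<^sub>R transpose A"
  by (simp add: transpose_def vec_eq_iff)

lemma psd_scaleR:
  "positive_semidefinite H \<Longrightarrow> 0 \<le> r \<Longrightarrow> positive_semidefinite (r *\<^sub>R H)"
  by (simp add: positive_semidefinite_def transpose_scaleR matvec)

text \<open>
  The trace-one slice of a face of the cone of positive semidefinite matrices, to which Brouwer's theorem is applied.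
\<close>
lemma compact_convex_psd_slice:
  fixes V :: "(real^'n) set"
  defines "D \<equiv> {M :: real^'n^'n. positive_semidefinite M \<and> trace M = 1 \<and> (\<forall>v\<in>V. M *v v = 0)}"
  shows "compact D" "convex D"
proof -
  have closed: "closed D"
  proof -
    have c1: "closed {M :: real^'n^'n. transpose M = M}"
      unfolding transpose_def by (intro closed_Collect_eq continuous_intros)
    have c2: "closed {M :: real^'n^'n. \<forall>x. 0 \<le> x \<bullet> (M *v x)}"
      unfolding matrix_vector_mult_def by (intro closed_Collect_all closed_Collect_le continuous_intros)
    have c3: "closed {M :: real^'n^'n. trace M = 1}"
      by (intro closed_Collect_eq continuous_intros)
    have c4: "closed {M :: real^'n^'n. \<forall>v. v \<in> V \<longrightarrow> M *v v = 0}"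
      unfolding matrix_vector_mult_def by (intro closed_Collect_all closed_Collect_imp open_Collect_const
          closed_Collect_eq continuous_intros)
    have "D = {M. transpose M = M} \<inter> {M. \<forall>x. 0 \<le> x \<bullet> (M *v x)} \<inter> {M. trace M = 1} \<inter> {M. \<forall>v. v \<in> V \<longrightarrow> M *v v = 0}"
      by (auto simp: D_def positive_semidefinite_def)
    then show ?thesis using c1 c2 c3 c4 by (simp add: closed_Int)
  qed
  moreover have "bounded D"
    using psd_norm_bound by (intro boundedI[where B="real CARD('n) * real CARD('n)"]) (force simp: D_def)
  ultimately show "compact D" by (simp add: compact_eq_bounded_closed)
  show "convex D"
    by (rule convexI) (auto simp: D_def psd_add psd_scaleR trace_add trace_scaleR matvec)
qed

section \<open>Positive semidefinite eigenmatrices\<close>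

text \<open>
  On a kernel vector \<open>v\<close> the form of \<open>L(H)\<close> reduces to \<open>(C v) \<bullet> H (C v) \<ge> 0\<close>, so it vanishes there. This gives
  \<open>H C v = 0\<close>, and \<open>L(H) v = 0\<close> because \<open>- L(H)\<close> is positive semidefinite; what remains of \<open>L(H) v = 0\<close> is
  \<open>H A v = 0\<close>.
\<close>
lemma lyapunov_op_kernel_invariant:
  fixes A C H :: "real^'n^'n"
  assumes H: "positive_semidefinite H"
    and sub: "\<And>x. x \<bullet> (lyapunov_op (- A) C H *v x) \<le> 0" and v: "H *v v = 0"
  shows "H *v (A *v v) = 0" "H *v (C *v v) = 0"
proof -
  let ?L = "lyapunov_op (- A) C H"
  have sym: "transpose H = H" and psd: "0 \<le> x \<bullet> (H *v x)" for x
    using H by (auto simp: positive_semidefinite_def)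
  have e: "v \<bullet> (?L *v v) = (C *v v) \<bullet> (H *v (C *v v))"
    using v by (simp add: lyapunov_op_quadratic_form[OF sym])
  then have "(C *v v) \<bullet> (H *v (C *v v)) = 0" using sub[of v] psd[of "C *v v"] by simp
  then show C: "H *v (C *v v) = 0" by (rule psd_kernel[OF H])
  have "(- ?L) *v v = 0"
  proof (rule symmetric_kernel)
    show "transpose (- ?L) = - ?L"
      using transpose_lyapunov_op[OF sym, of "- A" C] by (simp add: transpose_def vec_eq_iff)
    show "0 \<le> x \<bullet> (- ?L *v x)" for x
      using sub[of x] by (simp add: matrix_vector_mult_minus)
    show "v \<bullet> (- ?L *v v) = 0" using e C by (simp add: matrix_vector_mult_minus)
  qed
  then have "?L *v v = 0" by (simp add: matrix_vector_mult_minus)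
  then show "H *v (A *v v) = 0"
    using v C by (simp add: lyapunov_op_def matvec matrix_mult_bilinear matrix_vector_mult_minus)
qed

text \<open>
  A version of the Krein-Rutman theorem. The operator \<open>L\<close> need not preserve the cone. For small \<open>h > 0\<close>, however,
  \<open>T(M) = (1 - h A)\<^sup>T M (1 - h A) + h C\<^sup>T M C = M + h L(M) + h\<^sup>2 A\<^sup>T M A\<close> maps the cone into itself, and likewise the face of the
  invariant kernel. It can be normalized to trace one, and a fixed point \<open>X\<close> of the normalized map
  has eigenvector defect \<open>\<parallel>L(X) - tr(L(X)) X\<parallel> = O(h)\<close>. The minimum of this defect over the compact slice is
  therefore \<open>0\<close>, and a minimizer is an eigenmatrix.
\<close>
lemma psd_eigenvector_exists:
  fixes A C H :: "real^'n^'n"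
  assumes H: "positive_semidefinite H" "H \<noteq> 0"
    and inv: "\<And>v. H *v v = 0 \<Longrightarrow> H *v (A *v v) = 0" "\<And>v. H *v v = 0 \<Longrightarrow> H *v (C *v v) = 0"
  obtains M \<mu> where "positive_semidefinite M" "trace M = 1" "\<And>v. H *v v = 0 \<Longrightarrow> M *v v = 0"
    "lyapunov_op (- A) C M = \<mu> *\<^sub>R M"
proof -
  define V where "V = {v. H *v v = 0}"
  define D where "D = {M :: real^'n^'n. positive_semidefinite M \<and> trace M = 1 \<and> (\<forall>v\<in>V. M *v v = 0)}"
  let ?L = "lyapunov_op (- A) C"
  define R where "R = (\<lambda>M :: real^'n^'n. transpose A ** M ** A)"
  have D: "compact D" "convex D" unfolding D_def by (fact compact_convex_psd_slice)+
  have trH: "trace H > 0" using psd_trace_nonneg[OF H(1)] psd_trace_0[OF H(1)] H(2) by linarith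
  have "(1 / trace H) *\<^sub>R H \<in> D"
    using H trH by (simp add: D_def psd_scaleR trace_scaleR V_def matvec)
  then have ne: "D \<noteq> {}" by auto
  define \<Psi> where "\<Psi> = (\<lambda>M. norm (?L M - trace (?L M) *\<^sub>R M))"
  \<comment> \<open>\<open>\<Psi>\<close> is the defect to be minimized, \<open>\<Theta>\<close> the error caused by the term with \<open>h\<^sup>2\<close>\<close>
  define \<Theta> where "\<Theta> = (\<lambda>M. norm (R M - trace (R M) *\<^sub>R M))"
  have "continuous_on D \<Psi>" "continuous_on D \<Theta>"
    unfolding \<Psi>_def \<Theta>_def R_def by (intro continuous_intros)+
  then obtain M N where M: "M \<in> D" "\<And>X. X \<in> D \<Longrightarrow> \<Psi> M \<le> \<Psi> X"
    and N: "N \<in> D" "\<And>X. X \<in> D \<Longrightarrow> \<Theta> X \<le> \<Theta> N"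
    using continuous_attains_inf[OF D(1) ne] continuous_attains_sup[OF D(1) ne] by metis
  \<comment> \<open>the added \<open>1\<close> makes \<open>K\<close> positive and the next bound strict\<close>
  define K where "K = onorm ((*v) A) + 1"
  have K: "norm (A *v x) < K * norm x" if "x \<noteq> 0" for x
  proof -
    have "norm (A *v x) \<le> onorm ((*v) A) * norm x" by (simp add: onorm linear_linear)
    also have "\<dots> < K * norm x" using that by (simp add: K_def distrib_right)
    finally show ?thesis .
  qed
  have K1: "K \<ge> 1" by (simp add: K_def onorm_pos_le linear_linear)
  \<comment> \<open>\<open>h K \<le> 1\<close> makes \<open>1 - h A\<close> invertible, so that \<open>T\<close> does not annihilate the slice\<close>
  have key: "\<Psi> M \<le> h * \<Theta> N" if h: "0 < h" "h * K \<le> 1" for h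
  proof -
    define E where "E = mat 1 - h *\<^sub>R A"
    define T where "T = (\<lambda>M. transpose E ** M ** E + h *\<^sub>R (transpose C ** M ** C))"
    have tE: "transpose E = mat 1 - h *\<^sub>R transpose A"
      by (simp add: E_def transpose_def vec_eq_iff mat_def)
    have T_eq: "T M = M + h *\<^sub>R ?L M + h\<^sup>2 *\<^sub>R R M" for M
    proof -
      have 1: "(mat 1 - h *\<^sub>R transpose A) ** M ** (mat 1 - h *\<^sub>R A) =
          M - h *\<^sub>R (M ** A) - (h *\<^sub>R (transpose A ** M) - (h * h) *\<^sub>R (transpose A ** M ** A))"
        by (simp add: matrix_mult_bilinear scaleR_diff_right)
      show ?thesis
        unfolding T_def tE unfolding E_def 1 R_def lyapunov_op_uminus
        by (simp add: scaleR_diff_right scaleR_add_right power2_eq_square)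
    qed
    have pos: "trace (T X) > 0" if "X \<in> D" for X
    proof -
      have X: "positive_semidefinite X" "trace X = 1" using that by (auto simp: D_def)
      have p: "positive_semidefinite (transpose E ** X ** E)" "positive_semidefinite (transpose C ** X ** C)"
        using psd_congruence[OF X(1)] by auto
      have inj: "E *v x \<noteq> 0" if "x \<noteq> 0" for x
      proof
        assume "E *v x = 0"
        then have "x = h *\<^sub>R (A *v x)" by (simp add: E_def matvec)
        then have "norm x = h * norm (A *v x)" using h by (metis abs_of_pos norm_scaleR)
        also have "\<dots> < h * (K * norm x)" using K[OF that] h by simp
        also have "\<dots> \<le> 1 * norm x" using h by (simp only: mult.assoc[symmetric]) (intro mult_right_mono, auto)
        finally show False by simp
      qed
      have "trace (transpose E ** X ** E) \<noteq> 0"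
      proof
        assume "trace (transpose E ** X ** E) = 0"
        then have z: "transpose E ** X ** E = 0" using psd_trace_0 p by blast
        have "surj ((*v) E)"
          using inj linear_injective_0[of "(*v) E"] linear_injective_imp_surjective[of "(*v) E"] by auto
        have "X *v y = 0" for y
        proof -
          obtain x where y: "y = E *v x" using \<open>surj ((*v) E)\<close> by (auto simp: surj_def)
          have "y \<bullet> (X *v y) = x \<bullet> (transpose E ** X ** E *v x)"
            by (simp add: matvec inner_vector_matrix y)
          also have "\<dots> = 0" by (simp add: z)
          finally show ?thesis by (rule psd_kernel[OF X(1)])
        qed
        then have "X = 0" by (simp add: matrix_eq_0_iff)
        then show False using X(2) by (simp add: trace_def)
      qed
      then show ?thesis
        using psd_trace_nonneg[OF p(1)] psd_trace_nonneg[OF p(2)] h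
        by (simp add: T_def trace_add trace_scaleR add_pos_nonneg)
    qed
    have TV: "T X *v v = 0" if "X \<in> D" "v \<in> V" for X v
      using that inv by (simp add: T_def E_def D_def V_def matvec matrix_vector_mult_scaleR
          matrix_vector_mult_diff_distrib)
    define f where "f = (\<lambda>X. (1 / trace (T X)) *\<^sub>R T X)"
    have psdT: "positive_semidefinite (T X)" if "X \<in> D" for X
      using that h unfolding T_def D_def by (auto intro!: psd_add psd_scaleR psd_congruence)
    have "f \<in> D \<rightarrow> D"
    proof
      fix X assume X: "X \<in> D"
      then show "f X \<in> D" using pos[OF X] psdT[OF X] TV[OF X]
        by (simp add: D_def f_def psd_scaleR trace_scaleR matvec)
    qed
    moreover have "continuous_on D f"
      unfolding f_def T_def using pos unfolding T_def
      by (intro continuous_intros) (auto simp: less_imp_neq[symmetric])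
    ultimately obtain X where X: "X \<in> D" "f X = X"
      using brouwer[OF D ne] by metis
    define \<rho> where "\<rho> = trace (T X)"
    have fixp: "T X = \<rho> *\<^sub>R X"
    proof -
      have "\<rho> *\<^sub>R f X = T X" using pos[OF X(1)] by (simp add: f_def \<rho>_def)
      then show ?thesis using X(2) by simp
    qed
    have "\<rho> = 1 + h * trace (?L X) + h\<^sup>2 * trace (R X)"
      using X(1) by (simp add: \<rho>_def T_eq trace_add trace_scaleR D_def)
    then have \<rho>: "\<rho> - 1 - h * trace (?L X) = h * (h * trace (R X))" by (simp add: power2_eq_square)
    have a: "h *\<^sub>R ?L X = \<rho> *\<^sub>R X - X - (h * h) *\<^sub>R R X"
      unfolding fixp[symmetric] T_eq by (simp add: power2_eq_square)
    have "h *\<^sub>R (?L X - trace (?L X) *\<^sub>R X) = (\<rho> - 1 - h * trace (?L X)) *\<^sub>R X - (h * h) *\<^sub>R R X"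
      unfolding scaleR_diff_right a by (simp add: scaleR_diff_left)
    also have "\<dots> = h *\<^sub>R (- h *\<^sub>R (R X - trace (R X) *\<^sub>R X))"
      unfolding \<rho> by (simp add: scaleR_diff_right)
    finally have "?L X - trace (?L X) *\<^sub>R X = - h *\<^sub>R (R X - trace (R X) *\<^sub>R X)"
      using h by (simp only: scaleR_cancel_left) auto
    then have "\<Psi> X = h * \<Theta> X" using h by (simp add: \<Psi>_def \<Theta>_def)
    then show ?thesis using M(2)[OF X(1)] N(2)[OF X(1)] h by (smt (verit) mult_left_mono)
  qed
  have "\<Psi> M \<le> 0"
  proof (rule ccontr)
    assume "\<not> \<Psi> M \<le> 0"
    then have pM: "\<Psi> M > 0" by simp
    have t0: "\<Theta> N \<ge> 0" by (simp add: \<Theta>_def)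
    define h where "h = min (1 / K) (\<Psi> M / (2 * (\<Theta> N + 1)))"
    have "h > 0" using pM t0 K1 by (simp add: h_def)
    have "h * K \<le> 1 / K * K" using K1 by (intro mult_right_mono) (auto simp: h_def)
    then have "h * K \<le> 1" using K1 by simp
    from key[OF \<open>h > 0\<close> this] have "\<Psi> M \<le> h * \<Theta> N" .
    also have "\<dots> \<le> \<Psi> M / (2 * (\<Theta> N + 1)) * (\<Theta> N + 1)"
      using t0 \<open>h > 0\<close> by (intro mult_mono) (auto simp: h_def)
    also have "\<dots> = \<Psi> M / 2" using t0 by (simp add: field_simps)
    finally show False using pM by simp
  qed
  then have "?L M = trace (?L M) *\<^sub>R M" by (simp add: \<Psi>_def)
  with that M(1) show thesis by (auto simp: D_def V_def)
qed

text \<open>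
  Let \<open>c\<close> be the least number with \<open>M \<le> c H\<close>; it exists because \<open>M\<close> vanishes on the kernel of \<open>H\<close>. Then
  \<open>G = c H - M \<ge> 0\<close> annihilates some \<open>v\<close> with \<open>v \<bullet> H v > 0\<close>, and as in a maximum principle
  \<open>0 \<le> (C v) \<bullet> G (C v) = v \<bullet> L(G) v \<le> - \<mu> (v \<bullet> M v)\<close>, where \<open>v \<bullet> M v = c (v \<bullet> H v) > 0\<close>.
\<close>
lemma psd_eigenvalue_nonpos:
  fixes A C H M :: "real^'n^'n"
  assumes H: "positive_semidefinite H" "H \<noteq> 0"
    and sub: "\<And>x. x \<bullet> (lyapunov_op (- A) C H *v x) \<le> 0"
    and M: "positive_semidefinite M" "M \<noteq> 0" "\<And>v. H *v v = 0 \<Longrightarrow> M *v v = 0"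
    and eig: "lyapunov_op (- A) C M = \<mu> *\<^sub>R M"
  shows "\<mu> \<le> 0"
proof -
  have symH: "transpose H = H" and psdH: "0 \<le> x \<bullet> (H *v x)" for x
    using H by (auto simp: positive_semidefinite_def)
  have symM: "transpose M = M" and psdM: "0 \<le> x \<bullet> (M *v x)" for x
    using M by (auto simp: positive_semidefinite_def)
  define U where "U = range ((*v) H)"
  have subU: "subspace U"
    unfolding U_def by (intro linear_subspace_image subspace_UNIV) simp
  \<comment> \<open>on the range \<open>U\<close> of \<open>H\<close> the form of \<open>H\<close> is definite, and \<open>U\<close> complements the kernel\<close>
  have HU: "H *v w = 0" if "\<And>u. u \<in> U \<Longrightarrow> orthogonal w u" for w
  proof -
    have "(H *v w) \<bullet> y = 0" for y
    proof -
      have "(H *v w) \<bullet> y = w \<bullet> (H *v y)" using inner_matrix_vector(1)[of H w y] symH by simp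
      then show ?thesis using that[of "H *v y"] by (simp add: U_def orthogonal_def)
    qed
    then show ?thesis by (metis inner_eq_zero_iff)
  qed
  have posU: "v \<bullet> (H *v v) > 0" if v: "v \<in> U" "v \<noteq> 0" for v
  proof (rule ccontr)
    assume "\<not> ?thesis"
    then have Hv: "H *v v = 0" using psdH[of v] psd_kernel[OF H(1)] by force
    obtain u where u: "v = H *v u" using v by (auto simp: U_def)
    have "v \<bullet> v = (H *v v) \<bullet> u" using inner_matrix_vector(1)[of H v u] symH by (simp add: u)
    then show False using Hv v by simp
  qed
  define S where "S = U \<inter> sphere 0 1"
  obtain y where y: "H *v y \<noteq> 0" using H(2) matrix_eq_0_iff[of H] by auto
  have "(1 / norm (H *v y)) *\<^sub>R (H *v y) \<in> S"
    using y subspace_scale[OF subU, of "H *v y"] by (simp add: S_def U_def)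
  then have "S \<noteq> {}" by auto
  moreover have "compact S"
    unfolding S_def using closed_subspace[OF subU] by (simp add: closed_Int_compact)
  moreover have S_pos: "v \<bullet> (H *v v) > 0" if "v \<in> S" for v
    using that posU[of v] by (cases "v = 0") (auto simp: S_def)
  moreover have "continuous_on S (\<lambda>v. (v \<bullet> (M *v v)) / (v \<bullet> (H *v v)))"
    using S_pos by (intro continuous_intros) (auto simp: less_imp_neq[symmetric])
  ultimately obtain v where v: "v \<in> S"
    and max: "\<And>x. x \<in> S \<Longrightarrow> (x \<bullet> (M *v x)) / (x \<bullet> (H *v x)) \<le> (v \<bullet> (M *v v)) / (v \<bullet> (H *v v))"
    using continuous_attains_sup[of S "\<lambda>v. (v \<bullet> (M *v v)) / (v \<bullet> (H *v v))"] by metis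
  \<comment> \<open>the generalized Rayleigh quotient is maximal at \<open>v\<close>\<close>
  define c where "c = (v \<bullet> (M *v v)) / (v \<bullet> (H *v v))"
  have cv: "v \<bullet> (M *v v) = c * (v \<bullet> (H *v v))" using S_pos[OF v] by (simp add: c_def)
  have le: "x \<bullet> (M *v x) \<le> c * (x \<bullet> (H *v x))" for x
  proof -
    obtain u w where uw: "u \<in> span U" "\<And>z. z \<in> span U \<Longrightarrow> orthogonal w z" "x = u + w"
      using orthogonal_subspace_decomp_exists[of U x] by metis
    have spU: "span U = U" using subU span_eq_iff by blast
    have w: "H *v w = 0" "M *v w = 0" using HU uw(2) M(3) spU by auto
    have Hu: "x \<bullet> (H *v x) = u \<bullet> (H *v u)"
      using w inner_matrix_vector(2)[of w H u] symH
      by (simp add: uw(3) matrix_vector_right_distrib inner_add_left)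
    have Mu: "x \<bullet> (M *v x) = u \<bullet> (M *v u)"
      using w inner_matrix_vector(2)[of w M u] symM
      by (simp add: uw(3) matrix_vector_right_distrib inner_add_left)
    show ?thesis
    proof (cases "u = 0")
      case False
      define s where "s = (1 / norm u) *\<^sub>R u"
      have "s \<in> S" using False uw(1) subspace_scale[OF subU, of u] by (simp add: S_def s_def spU)
      have "s \<bullet> (M *v s) \<le> c * (s \<bullet> (H *v s))"
        using max[OF \<open>s \<in> S\<close>] S_pos[OF \<open>s \<in> S\<close>] by (simp add: c_def[symmetric] divide_le_eq)
      then have "(norm u)\<^sup>2 * (s \<bullet> (M *v s)) \<le> (norm u)\<^sup>2 * (c * (s \<bullet> (H *v s)))"
        by (intro mult_left_mono) auto
      then show ?thesis using False
        by (simp add: Hu Mu s_def matrix_vector_mult_scaleR power2_eq_square)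
    qed (simp add: Hu Mu)
  qed
  have "c > 0"
  proof -
    obtain y where "M *v y \<noteq> 0" using M(2) matrix_eq_0_iff[of M] by auto
    then have "y \<bullet> (M *v y) > 0" using psdM[of y] psd_kernel[OF M(1), of y] by fastforce
    then have "c * (y \<bullet> (H *v y)) > 0" using le[of y] by linarith
    then show ?thesis using psdH[of y] by (auto simp: zero_less_mult_iff)
  qed
  define G where "G = c *\<^sub>R H - M"
  have G: "positive_semidefinite G"
    using le symH symM by (simp add: positive_semidefinite_def G_def matvec inner_diff_right
        transpose_def vec_eq_iff)
  have Gv: "G *v v = 0"
    by (rule psd_kernel[OF G]) (simp add: G_def matvec inner_diff_right cv)
  have symG: "transpose G = G" using G by (simp add: positive_semidefinite_def)
  have "0 \<le> (C *v v) \<bullet> (G *v (C *v v))" using G by (simp add: positive_semidefinite_def)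
  also have "\<dots> = v \<bullet> (lyapunov_op (- A) C G *v v)"
    by (simp add: lyapunov_op_quadratic_form[OF symG] Gv)
  also have "\<dots> = c * (v \<bullet> (lyapunov_op (- A) C H *v v)) - \<mu> * (v \<bullet> (M *v v))"
    using linear_lyapunov_op[of "- A" C]
    by (simp add: G_def linear_diff linear_scale eig matvec inner_diff_right)
  also have "\<dots> \<le> - \<mu> * (v \<bullet> (M *v v))"
    using sub[of v] \<open>c > 0\<close> by (simp add: mult_nonneg_nonpos)
  finally have "\<mu> * (v \<bullet> (M *v v)) \<le> 0" by simp
  moreover have "v \<bullet> (M *v v) > 0" using cv \<open>c > 0\<close> S_pos[OF v] by simp
  ultimately show ?thesis by (simp add: mult_le_0_iff)
qed

section \<open>Duality, feedback gains and Lyapunov certificates\<close>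

text \<open>
  The adjoint of \<open>P \<mapsto> P A + A\<^sup>T P + C\<^sup>T P C\<close> for the trace inner product, written without symmetrizing \<open>A Q\<close>.
\<close>
lemma inner_lyapunov_op:
  fixes A C H Q :: "real^'n^'n"
  assumes "transpose H = H" "transpose Q = Q"
  shows "lyapunov_op A C H \<bullet> Q = 2 * (H \<bullet> (A ** Q)) + H \<bullet> (C ** Q ** transpose C)"
proof -
  have "(H ** A) \<bullet> Q = H \<bullet> transpose (A ** Q)"
    using assms(2) by (simp add: inner_matrix_mult_right matrix_transpose_mul)
  also have "\<dots> = H \<bullet> (A ** Q)"
    using inner_matrix_transpose[of H "A ** Q"] inner_matrix_transpose[of H "transpose (A ** Q)"] assms(1) by simp
  finally have 1: "(H ** A) \<bullet> Q = H \<bullet> (A ** Q)" .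
  have 2: "(transpose A ** H) \<bullet> Q = H \<bullet> (A ** Q)" by (simp add: inner_matrix_mult_left)
  have 3: "(transpose C ** H ** C) \<bullet> Q = H \<bullet> (C ** Q ** transpose C)"
    using inner_matrix_mult_left[of "transpose C" "H ** C" Q] inner_matrix_mult_right[of H C "C ** Q"]
    by (simp add: matrix_mul_assoc)
  show ?thesis by (simp add: lyapunov_op_def inner_add_left 1 2 3)
qed

text \<open>
  If the inequality has no solution, the cone of its left-hand sides is disjoint from the cone \<open>T\<close> of matrices
  with positive quadratic form, and a separating functional \<open>H\<close> is nonnegative on the latter and nonpositive on
  the former. Working with all square matrices, not only the symmetric ones, keeps \<open>T\<close> invariant under adding
  skew matrices, which makes \<open>H\<close> symmetric; testing on \<open>x x\<^sup>T\<close> gives \<open>H \<ge> 0\<close> and \<open>L(H) \<le> 0\<close>. Since \<open>k\<close> is an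
  arbitrary real number, its coefficient \<open>tr (B\<^sup>T H B)\<close> vanishes, that is \<open>B\<^sup>T H = 0\<close>.
\<close>
lemma feasible_or_subharmonic:
  fixes A C :: "real^'n^'n" and B :: "real^'m^'n"
  assumes nofeas: "\<And>Q k. transpose Q = Q \<Longrightarrow> (\<And>x. x \<noteq> 0 \<Longrightarrow> 0 < x \<bullet> (Q *v x)) \<Longrightarrow>
    (\<And>y. y \<noteq> 0 \<Longrightarrow> 0 < y \<bullet> ((C ** Q ** transpose C - A ** Q - Q ** transpose A + k *\<^sub>R (B ** transpose B)) *v y)) \<Longrightarrow> False"
  obtains H where "positive_semidefinite H" "H \<noteq> 0" "\<And>x. x \<bullet> (lyapunov_op (- A) C H *v x) \<le> 0"
    "transpose B ** H = 0"
proof -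
  define PD where "PD = {Q :: real^'n^'n. transpose Q = Q \<and> (\<forall>x. x \<noteq> 0 \<longrightarrow> 0 < x \<bullet> (Q *v x))}"
  define T where "T = {N :: real^'n^'n. \<forall>x. x \<noteq> 0 \<longrightarrow> 0 < x \<bullet> (N *v x)}"
  define g where "g = (\<lambda>Q k. C ** Q ** transpose C - A ** Q - Q ** transpose A + k *\<^sub>R (B ** transpose B))"
  define S where "S = {g Q k | Q k. Q \<in> PD}"
  have PDadd: "Q + R \<in> PD" if "Q \<in> PD" "R \<in> PD" for Q R
    using that by (auto simp: PD_def transpose_add matvec inner_add_right add_pos_pos)
  have PDscale: "r *\<^sub>R Q \<in> PD" if "Q \<in> PD" "r > 0" for Q r
    using that by (auto simp: PD_def transpose_scaleR matvec)
  have g_add: "g Q k + g R l = g (Q + R) (k + l)" for Q R k l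
    unfolding g_def matrix_mult_bilinear scaleR_add_left by simp
  have g_scale: "r *\<^sub>R g Q k = g (r *\<^sub>R Q) (r * k)" for Q k r
    unfolding g_def matrix_mult_bilinear scaleR_diff_right scaleR_add_right by simp
  have Sadd: "M + N \<in> S" if "M \<in> S" "N \<in> S" for M N
  proof -
    from that(1) obtain Q k where 1: "M = g Q k" "Q \<in> PD" by (auto simp: S_def)
    from that(2) obtain R l where 2: "N = g R l" "R \<in> PD" by (auto simp: S_def)
    show ?thesis using 1 2 PDadd[of Q R] g_add[of Q k R l] unfolding S_def by auto
  qed
  have Sscale: "r *\<^sub>R M \<in> S" if "M \<in> S" "r > 0" for M r
  proof -
    from that(1) obtain Q k where "M = g Q k" "Q \<in> PD" by (auto simp: S_def)
    then show ?thesis using PDscale[of Q r] g_scale[of r Q k] that(2) unfolding S_def by blast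
  qed
  have Tadd: "M + N \<in> T" if "M \<in> T" "N \<in> T" for M N
    using that by (auto simp: T_def matvec inner_add_right add_pos_pos)
  have Tscale: "r *\<^sub>R M \<in> T" if "M \<in> T" "r > 0" for M r
    using that by (auto simp: T_def matvec)
  have cone: "convex K" if "\<And>M N. M \<in> K \<Longrightarrow> N \<in> K \<Longrightarrow> M + N \<in> K" "\<And>r M. M \<in> K \<Longrightarrow> r > 0 \<Longrightarrow> r *\<^sub>R M \<in> K"
    for K :: "(real^'n^'n) set"
  proof (rule convexI)
    fix M N and u v :: real assume a: "M \<in> K" "N \<in> K" "0 \<le> u" "0 \<le> v" "u + v = 1"
    show "u *\<^sub>R M + v *\<^sub>R N \<in> K"
    proof (cases "u = 0 \<or> v = 0")
      case False
      then have "u > 0" "v > 0" using a by auto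
      then show ?thesis using that(1)[OF that(2)[OF a(1)] that(2)[OF a(2)]] by simp
    qed (use a in auto)
  qed
  have one: "mat 1 \<in> PD" "mat 1 \<in> T" by (auto simp: PD_def T_def)
  have "g Q k \<notin> T" if "Q \<in> PD" for Q k
  proof
    assume "g Q k \<in> T"
    with that show False by (intro nofeas[of Q k]) (simp_all add: PD_def T_def g_def)
  qed
  then have "S \<inter> T = {}" by (auto simp: S_def)
  moreover have "convex S" by (rule cone) (fact Sadd Sscale)+
  moreover have "convex T" by (rule cone) (fact Tadd Tscale)+
  moreover have "S \<noteq> {}" "T \<noteq> {}" using one by (auto simp: S_def)
  ultimately obtain H b where H: "H \<noteq> 0" "\<And>M. M \<in> S \<Longrightarrow> H \<bullet> M \<le> b" "\<And>M. M \<in> T \<Longrightarrow> b \<le> H \<bullet> M"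
    using separating_hyperplane_sets[of S T] by blast
  have b0: "b \<le> 0"
  proof (rule ccontr)
    assume b: "\<not> b \<le> 0"
    have i: "H \<bullet> mat 1 \<ge> b" using H(3) one by auto
    define r where "r = b / (2 * (H \<bullet> mat 1))"
    have "r > 0" using b i by (simp add: r_def)
    then have "b \<le> H \<bullet> (r *\<^sub>R mat 1)" using H(3) Tscale one by blast
    then show False using b i by (simp add: r_def)
  qed
  have nonneg: "0 \<le> u" if "\<And>r. r > 0 \<Longrightarrow> b \<le> r * u" for u
  proof (rule ccontr)
    assume u: "\<not> 0 \<le> u"
    have "b \<le> ((b - 1) / u) * u" using u b0 by (intro that) (simp add: divide_neg_neg)
    then show False using u by simp
  qed
  have HT: "0 \<le> H \<bullet> M" if "M \<in> T" for M
  proof (rule nonneg)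
    fix r :: real assume "r > 0"
    then show "b \<le> r * (H \<bullet> M)" using H(3)[OF Tscale[OF that]] by simp
  qed
  have HS: "H \<bullet> M \<le> 0" if "M \<in> S" for M
  proof -
    show ?thesis using H(2)[OF that] b0 by linarith
  qed
  have limit: "0 \<le> u" if "\<And>r. r > 0 \<Longrightarrow> 0 \<le> u + r * w" for u w :: real
  proof (rule ccontr)
    assume u: "\<not> 0 \<le> u"
    define r where "r = - u / (2 * (\<bar>w\<bar> + 1))"
    have r: "r > 0" using u unfolding r_def by (intro divide_pos_pos) auto
    have "r * w \<le> r * (\<bar>w\<bar> + 1)" using r by (intro mult_left_mono) auto
    also have "\<dots> = - u / 2" using abs_ge_zero[of w] by (simp add: r_def field_simps del: abs_ge_zero)
    finally show False using that[OF r] u by simp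
  qed
  have sym: "transpose H = H"
  proof -
    define K where "K = transpose H - H"
    have skew: "x \<bullet> (K *v x) = 0" for x
      using inner_vector_matrix[of x x H] by (simp add: K_def matvec inner_diff_right inner_commute[of x "H *v x"])
    \<comment> \<open>\<open>r\<close> may have either sign, hence \<open>H \<bullet> K = 0\<close>\<close>
    have "mat 1 + r *\<^sub>R K \<in> T" for r
      using skew by (auto simp: T_def matvec inner_add_right)
    then have "0 \<le> H \<bullet> mat 1 + r * (H \<bullet> K)" for r using HT[of "mat 1 + r *\<^sub>R K"] by (simp add: inner_add_right)
    from this[of "- (H \<bullet> mat 1 + 1) / (H \<bullet> K)"] have "H \<bullet> K = 0"
      by (cases "H \<bullet> K = 0") auto
    moreover have "K \<bullet> K = - 2 * (H \<bullet> K)"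
    proof -
      have "transpose K = - K" by (simp add: K_def transpose_def vec_eq_iff)
      then have "transpose H \<bullet> K = - (H \<bullet> K)"
        using inner_matrix_transpose[of "transpose H" K] by simp
      then have "(transpose H - H) \<bullet> K = - 2 * (H \<bullet> K)" by (simp add: inner_diff_left)
      then show ?thesis by (simp only: K_def[symmetric])
    qed
    ultimately show ?thesis by (simp add: K_def)
  qed
  \<comment> \<open>\<open>x x\<^sup>T\<close> is only semidefinite; a small multiple of the identity is added and removed in the limit\<close>
  have outer_pos: "0 < z \<bullet> ((outer x x + r *\<^sub>R mat 1) *v z)" if "r > 0" "z \<noteq> 0" for x z :: "real^'n" and r
  proof -
    have "z \<bullet> ((outer x x + r *\<^sub>R mat 1) *v z) = (x \<bullet> z)\<^sup>2 + r * (z \<bullet> z)"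
      by (simp add: matvec outer_mult_vector inner_add_right power2_eq_square inner_commute[of z x])
    then show ?thesis using that by (simp add: add_nonneg_pos)
  qed
  have Hpsd: "0 \<le> x \<bullet> (H *v x)" for x
  proof (rule limit)
    fix r :: real assume "r > 0"
    have "outer x x + r *\<^sub>R mat 1 \<in> T"
      using \<open>r > 0\<close> outer_pos by (simp add: T_def)
    from HT[OF this] show "0 \<le> x \<bullet> (H *v x) + r * (H \<bullet> mat 1)"
      by (simp add: inner_add_right inner_outer)
  qed
  have psd: "positive_semidefinite H" using sym Hpsd by (simp add: positive_semidefinite_def)
  have Hg: "H \<bullet> g Q k = lyapunov_op (- A) C H \<bullet> Q + k * (H \<bullet> (B ** transpose B))" if "transpose Q = Q" for Q k
  proof -
    have "H \<bullet> (Q ** transpose A) = H \<bullet> (A ** Q)"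
      using inner_matrix_transpose[of H "A ** Q"] by (simp add: matrix_transpose_mul that sym)
    then show ?thesis using that sym
      by (simp add: inner_lyapunov_op g_def inner_add_right inner_diff_right matrix_mult_bilinear)
  qed
  have "H \<bullet> g (mat 1) k \<le> 0" for k using HS one by (auto simp: S_def)
  then have lin: "lyapunov_op (- A) C H \<bullet> mat 1 + k * (H \<bullet> (B ** transpose B)) \<le> 0" for k
    by (simp add: Hg transpose_mat)
  have BHB: "H \<bullet> (B ** transpose B) = 0"
  proof (rule ccontr)
    assume ne: "H \<bullet> (B ** transpose B) \<noteq> 0"
    show False using lin[of "(1 - lyapunov_op (- A) C H \<bullet> mat 1) / (H \<bullet> (B ** transpose B))"] ne by simp
  qed
  have "trace (transpose B ** H ** B) = 0" by (simp add: trace_congruence BHB)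
  then have z: "transpose B ** H ** B = 0" by (rule psd_trace_0[OF psd_congruence[OF psd]])
  have "H *v (B *v y) = 0" for y
  proof (rule psd_kernel[OF psd])
    have "(B *v y) \<bullet> (H *v (B *v y)) = y \<bullet> (transpose B ** H ** B *v y)"
      by (simp add: matvec inner_vector_matrix)
    then show "(B *v y) \<bullet> (H *v (B *v y)) = 0" by (simp add: z)
  qed
  then have "H ** B = 0" by (simp add: matrix_eq_0_iff matvec)
  then have BH: "transpose B ** H = 0"
  proof -
    have "transpose B ** H = transpose (H ** B)" by (simp add: matrix_transpose_mul sym)
    then show ?thesis using \<open>H ** B = 0\<close> by (simp add: transpose_zero)
  qed
  have "0 \<le> - (x \<bullet> (lyapunov_op (- A) C H *v x))" for x
  proof (rule limit)
    fix r :: real assume "r > 0"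
    have "outer x x + r *\<^sub>R mat 1 \<in> PD"
      using \<open>r > 0\<close> outer_pos
      by (simp add: PD_def transpose_add transpose_scaleR transpose_mat)
        (simp add: outer_def transpose_def vec_eq_iff mult.commute)
    moreover from this have "H \<bullet> g (outer x x + r *\<^sub>R mat 1) 0 \<le> 0" using HS by (auto simp: S_def)
    ultimately show "0 \<le> - (x \<bullet> (lyapunov_op (- A) C H *v x)) + r * - (lyapunov_op (- A) C H \<bullet> mat 1)"
      using Hg[of "outer x x + r *\<^sub>R mat 1" 0] by (simp add: PD_def inner_add_right inner_outer)
  qed
  then have "x \<bullet> (lyapunov_op (- A) C H *v x) \<le> 0" for x by simp
  then show thesis by (rule that[OF psd H(1) _ BH])
qed

text \<open>
  A positive semidefinite \<open>H\<close> is a sum of matrices \<open>z z\<^sup>T\<close>. They are split off one at a time, with \<open>z\<close>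
  proportional to \<open>H x\<close> for some \<open>x\<close> outside the kernel; each step enlarges the kernel by \<open>x\<close>.
\<close>
lemma inner_psd_nonneg:
  fixes H N :: "real^'n^'n"
  assumes "positive_semidefinite H" and N: "\<And>x. 0 \<le> x \<bullet> (N *v x)"
  shows "0 \<le> H \<bullet> N"
  using assms(1)
proof (induction "CARD('n) - dim {v. H *v v = 0}" arbitrary: H rule: less_induct)
  case less
  have sym: "transpose H = H" and psd: "0 \<le> x \<bullet> (H *v x)" for x
    using less.prems by (auto simp: positive_semidefinite_def)
  show ?case
  proof (cases "H = 0")
    case False
    then obtain x where "H *v x \<noteq> 0" using matrix_eq_0_iff by auto
    then have x: "x \<bullet> (H *v x) > 0" using psd[of x] psd_kernel[OF less.prems, of x] by fastforce
    define c where "c = 1 / (x \<bullet> (H *v x))"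
    define G where "G = H - c *\<^sub>R outer (H *v x) (H *v x)"
    have adj: "(H *v x) \<bullet> y = x \<bullet> (H *v y)" for y
      using inner_matrix_vector(1)[of H x y] sym by simp
    have Gv: "G *v v = H *v v - (c * (x \<bullet> (H *v v))) *\<^sub>R (H *v x)" for v
      by (simp add: G_def matvec outer_mult_vector adj)
    have cx: "c * (x \<bullet> (H *v x)) = 1" using x by (simp add: c_def)
    have "positive_semidefinite G"
      unfolding positive_semidefinite_def
    proof (intro conjI allI)
      show "transpose G = G" using sym
        by (simp add: G_def outer_def transpose_def vec_eq_iff mult.commute)
      fix y
      define s where "s = c * (x \<bullet> (H *v y))"
      have yx: "y \<bullet> (H *v x) = x \<bullet> (H *v y)" using adj[of y] by (simp add: inner_commute)
      have "(y - s *\<^sub>R x) \<bullet> (H *v (y - s *\<^sub>R x)) =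
          y \<bullet> (H *v y) - 2 * s * (x \<bullet> (H *v y)) + s * (s * (x \<bullet> (H *v x)))"
        by (simp add: matrix_vector_mult_diff_distrib matrix_vector_mult_scaleR inner_diff_left inner_diff_right yx algebra_simps)
      also have "s * (s * (x \<bullet> (H *v x))) = s * (x \<bullet> (H *v y))"
      proof -
        have "s * (x \<bullet> (H *v x)) = (c * (x \<bullet> (H *v x))) * (x \<bullet> (H *v y))" by (simp add: s_def)
        then show ?thesis using cx by simp
      qed
      also have "y \<bullet> (H *v y) - 2 * s * (x \<bullet> (H *v y)) + s * (x \<bullet> (H *v y)) = y \<bullet> (G *v y)"
        by (simp add: Gv s_def inner_diff_right yx)
      finally show "0 \<le> y \<bullet> (G *v y)" using psd by metis
    qed
    moreover have "CARD('n) - dim {v. G *v v = 0} < CARD('n) - dim {v. H *v v = 0}"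
    proof -
      have sub: "{v. H *v v = 0} \<subseteq> {v. G *v v = 0}" by (auto simp: Gv)
      have subsp: "subspace {v. K *v v = 0}" for K :: "real^'n^'n"
        by (simp add: subspace_def matrix_vector_right_distrib matrix_vector_mult_scaleR)
      have "x \<in> {v. G *v v = 0}" "x \<notin> {v. H *v v = 0}" using cx x by (auto simp: Gv)
      then have "{v. H *v v = 0} \<subset> {v. G *v v = 0}" using sub by blast
      then have "dim {v. H *v v = 0} < dim {v. G *v v = 0}"
        using subsp by (intro dim_psubset) (simp add: span_eq_iff[THEN iffD2])
      moreover have "dim {v. G *v v = 0} \<le> CARD('n)"
        using dim_subset_UNIV[of "{v. G *v v = 0}"] by simp
      ultimately show ?thesis by linarith
    qed
    ultimately have "0 \<le> G \<bullet> N" by (rule less.hyps[rotated])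
    moreover have "H \<bullet> N = G \<bullet> N + c * ((H *v x) \<bullet> (N *v (H *v x)))"
      using inner_outer[of N "H *v x" "H *v x"]
      by (simp add: G_def inner_diff_left inner_commute[of "outer _ _"])
    moreover have "0 \<le> c * ((H *v x) \<bullet> (N *v (H *v x)))" using x N by (simp add: c_def)
    ultimately show ?thesis by simp
  qed simp
qed

lemma positive_definite_inverse:
  fixes Q :: "real^'n^'n"
  assumes "transpose Q = Q" "\<And>x. x \<noteq> 0 \<Longrightarrow> 0 < x \<bullet> (Q *v x)"
  obtains P where "transpose P = P" "\<And>x. P *v (Q *v x) = x" "\<And>x. Q *v (P *v x) = x"
    "\<And>x. x \<noteq> 0 \<Longrightarrow> 0 < x \<bullet> (P *v x)"
proof -
  have "Q *v x \<noteq> 0" if "x \<noteq> 0" for x using assms(2)[OF that] by auto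
  then have "inj ((*v) Q)" using linear_injective_0[of "(*v) Q"] by auto
  then obtain P where P: "P ** Q = mat 1" using matrix_left_invertible_injective by blast
  then have P': "Q ** P = mat 1" using matrix_left_right_inverse by blast
  have "transpose P ** Q = mat 1"
    using arg_cong[OF P', of transpose] assms(1) by (simp add: matrix_transpose_mul transpose_mat)
  then have sym: "transpose P = P"
    using P' by (metis matrix_mul_assoc matrix_mul_lid matrix_mul_rid)
  have PQ: "P *v (Q *v x) = x" "Q *v (P *v x) = x" for x
    using P P' by (metis matrix_vector_mul_assoc matrix_vector_mul_lid)+
  have "0 < x \<bullet> (P *v x)" if "x \<noteq> 0" for x
  proof -
    have "P *v x \<noteq> 0" using that PQ(2)[of x] by auto
    from assms(2)[OF this] show ?thesis by (simp add: PQ inner_commute)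
  qed
  with that sym PQ show thesis by blast
qed

text \<open>
  In the variable \<open>y = P x\<close> the gains \<open>K = - Q C\<^sup>T P\<close> and \<open>\<Phi> = - (k / 2) B\<^sup>T P\<close> turn the Lyapunov form of the closed
  loop into minus the given one: \<open>K\<close> minimizes \<open>2 y \<bullet> C K x + (K x) \<bullet> P (K x)\<close>, with value \<open>- y \<bullet> C Q C\<^sup>T y\<close>.
\<close>
lemma feedback_of_feasible:
  fixes A C Q :: "real^'n^'n" and B :: "real^'m^'n"
  assumes Q: "transpose Q = Q" "\<And>x. x \<noteq> 0 \<Longrightarrow> 0 < x \<bullet> (Q *v x)"
    and feas: "\<And>y. y \<noteq> 0 \<Longrightarrow> 0 < y \<bullet> ((C ** Q ** transpose C - A ** Q - Q ** transpose A + k *\<^sub>R (B ** transpose B)) *v y)"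
  obtains P :: "real^'n^'n" and \<Phi> :: "real^'n^'m" and K :: "real^'n^'n"
  where "transpose P = P" "\<And>x. x \<noteq> 0 \<Longrightarrow> 0 < x \<bullet> (P *v x)"
    "\<And>x. x \<noteq> 0 \<Longrightarrow> x \<bullet> (lyapunov_op (A + B ** \<Phi> + C ** K) K P *v x) < 0"
proof -
  obtain P where P: "transpose P = P" "\<And>x. P *v (Q *v x) = x" "\<And>x. Q *v (P *v x) = x"
    "\<And>x. x \<noteq> 0 \<Longrightarrow> 0 < x \<bullet> (P *v x)"
    using positive_definite_inverse[OF Q] by blast
  define \<Phi> where "\<Phi> = (- k / 2) *\<^sub>R (transpose B ** P)"
  define K where "K = - (Q ** transpose C ** P)"
  have "x \<bullet> (lyapunov_op (A + B ** \<Phi> + C ** K) K P *v x) < 0" if "x \<noteq> 0" for x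
  proof -
    define y where "y = P *v x"
    have y: "y \<noteq> 0" using that P(3)[of x] by (auto simp: y_def)
    have x: "x = Q *v y" by (simp add: y_def P)
    have Kx: "K *v x = - (Q *v (transpose C *v y))"
      by (simp add: K_def y_def matvec matrix_vector_mult_minus)
    have Fx: "\<Phi> *v x = (- k / 2) *\<^sub>R (transpose B *v y)"
      by (simp add: \<Phi>_def y_def matvec matrix_vector_mult_minus)
    have QC: "y \<bullet> (C *v (Q *v (y v* C))) = (y v* C) \<bullet> (Q *v (y v* C))"
      by (simp add: dot_lmul_matrix)
    have BB: "y \<bullet> (B *v (y v* B)) = (y v* B) \<bullet> (y v* B)"
      by (simp add: dot_lmul_matrix)
    have AQ: "y \<bullet> (Q *v (y v* A)) = y \<bullet> (A *v (Q *v y))"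
      using inner_matrix_vector(2)[of y Q "y v* A"] Q(1)
      by (simp add: inner_commute[of "Q *v y"] dot_lmul_matrix)
    have "x \<bullet> (lyapunov_op (A + B ** \<Phi> + C ** K) K P *v x) =
        2 * (y \<bullet> (A *v x)) + 2 * (y \<bullet> (B *v (\<Phi> *v x))) + 2 * (y \<bullet> (C *v (K *v x))) + (K *v x) \<bullet> (P *v (K *v x))"
      by (simp add: lyapunov_op_quadratic_form[OF P(1)] matvec y_def inner_add_right)
    also have "\<dots> = - (y \<bullet> ((C ** Q ** transpose C - A ** Q - Q ** transpose A + k *\<^sub>R (B ** transpose B)) *v y))"
      unfolding Kx Fx unfolding x
      by (simp add: matvec inner_add_right inner_diff_right matrix_vector_mult_scaleR linear_neg[OF matrix_vector_mul_linear] P QC BB AQ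
          inner_commute[of "Q *v _"])
    also have "\<dots> < 0" using feas[OF y] by simp
    finally show ?thesis .
  qed
  with that P show thesis by blast
qed

text \<open>
  Completing the square with \<open>w = K x + Q C\<^sup>T y\<close>, \<open>x = Q y\<close>, turns the Lyapunov equation into \<open>y \<bullet> N y = w \<bullet> P w \<ge> 0\<close>,
  where \<open>N\<close> does not contain \<open>K\<close>; pairing \<open>N\<close> with \<open>H\<close> removes \<open>\<Phi>\<close> too, because \<open>B\<^sup>T H = 0\<close>.
\<close>
lemma eigenvector_zero_if_lyapunov:
  fixes A C H P K :: "real^'n^'n" and B :: "real^'m^'n" and \<Phi> :: "real^'n^'m"
  assumes P: "transpose P = P" "\<And>x. x \<noteq> 0 \<Longrightarrow> 0 < x \<bullet> (P *v x)"
    and lyap: "\<And>x. x \<bullet> (lyapunov_op (A + B ** \<Phi> + C ** K) K P *v x) = - (x \<bullet> x)"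
    and H: "positive_semidefinite H" and eig: "lyapunov_op (- A) C H = \<mu> *\<^sub>R H" and \<mu>: "\<mu> \<le> 0"
    and BH: "transpose B ** H = 0"
  shows "H = 0"
proof -
  obtain Q where Q: "transpose Q = Q" "\<And>x. Q *v (P *v x) = x" "\<And>x. P *v (Q *v x) = x"
    "\<And>x. x \<noteq> 0 \<Longrightarrow> 0 < x \<bullet> (Q *v x)"
    using positive_definite_inverse[OF P] by blast
  have Qpsd: "0 \<le> x \<bullet> (Q *v x)" for x using Q(4)[of x] by (cases "x = 0") auto
  have Ppsd: "0 \<le> x \<bullet> (P *v x)" for x using P(2)[of x] by (cases "x = 0") auto
  have symH: "transpose H = H" using H by (simp add: positive_semidefinite_def)
  define N where "N = C ** Q ** transpose C - 2 *\<^sub>R (A ** Q) - 2 *\<^sub>R (B ** (\<Phi> ** Q)) - Q ** Q"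
  have "0 \<le> y \<bullet> (N *v y)" for y
  proof -
    define x where "x = Q *v y"
    define c where "c = transpose C *v y"
    have y: "y = P *v x" by (simp add: x_def Q)
    have "x \<bullet> (lyapunov_op (A + B ** \<Phi> + C ** K) K P *v x) =
        2 * (y \<bullet> (A *v x)) + 2 * (y \<bullet> (B *v (\<Phi> *v x))) + 2 * (c \<bullet> (K *v x)) + (K *v x) \<bullet> (P *v (K *v x))"
      by (simp add: lyapunov_op_quadratic_form[OF P(1)] matvec y inner_add_right c_def dot_lmul_matrix)
    moreover have "y \<bullet> (N *v y) = c \<bullet> (Q *v c) - 2 * (y \<bullet> (A *v x)) - 2 * (y \<bullet> (B *v (\<Phi> *v x))) - x \<bullet> x"
    proof -
      have "y \<bullet> (Q *v x) = x \<bullet> x" using inner_matrix_vector(2)[of y Q x] Q(1) by (simp add: x_def)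
      then show ?thesis by (simp add: N_def matvec inner_diff_right c_def dot_lmul_matrix x_def)
    qed
    ultimately have "y \<bullet> (N *v y) = c \<bullet> (Q *v c) + 2 * (c \<bullet> (K *v x)) + (K *v x) \<bullet> (P *v (K *v x))"
      using lyap[of x] by simp
    also have "\<dots> = (K *v x + Q *v c) \<bullet> (P *v (K *v x + Q *v c))"
    proof -
      have "(Q *v c) \<bullet> (P *v (K *v x)) = c \<bullet> (K *v x)"
        using inner_matrix_vector(2)[of "Q *v c" P "K *v x"] P(1) by (simp add: Q)
      then show ?thesis
        by (simp add: matrix_vector_right_distrib inner_add_left inner_add_right Q inner_commute)
    qed
    also have "\<dots> \<ge> 0" by (rule Ppsd)
    finally show ?thesis .
  qed
  then have "0 \<le> H \<bullet> N" by (rule inner_psd_nonneg[OF H])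
  moreover have "H \<bullet> (B ** (\<Phi> ** Q)) = 0"
    using inner_matrix_mult_left[of B "\<Phi> ** Q" H] BH by (simp add: inner_commute)
  moreover have "H \<bullet> (C ** Q ** transpose C) - 2 * (H \<bullet> (A ** Q)) = \<mu> * (H \<bullet> Q)"
    using inner_lyapunov_op[OF symH Q(1), of "- A" C] eig by (simp add: matrix_mult_bilinear)
  ultimately have "H \<bullet> (Q ** Q) \<le> \<mu> * (H \<bullet> Q)" by (simp add: N_def inner_diff_right)
  also have "\<dots> \<le> 0" using \<mu> inner_psd_nonneg[OF H Qpsd] by (simp add: mult_nonpos_nonneg)
  finally have "H \<bullet> (Q ** Q) \<le> 0" .
  moreover have "trace (transpose Q ** H ** Q) = H \<bullet> (Q ** Q)" using trace_congruence[of Q H] Q(1) by simp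
  ultimately have "transpose Q ** H ** Q = 0"
    using psd_trace_nonneg[OF psd_congruence[OF H, of Q]] psd_trace_0[OF psd_congruence[OF H, of Q]] by simp
  then have z: "Q *v (H *v (Q *v x)) = 0" for x
    using Q(1) by (metis matrix_vector_mul_assoc matrix_vector_mult_0)
  have "H *v x = 0" for x
    using arg_cong[OF z[of "P *v x"], of "(*v) P"] by (simp add: Q)
  then show ?thesis by (simp add: matrix_eq_0_iff)
qed

text \<open>
  Injectivity implies surjectivity for endomorphisms of a finite-dimensional space. Here the space is that of
  symmetric matrices; the operator is extended to all matrices by the identity on the skew part.
\<close>
lemma lyapunov_op_surjective_if_injective:
  fixes A K :: "real^'n^'n"
  assumes inj: "\<And>P. transpose P = P \<Longrightarrow> lyapunov_op A K P = 0 \<Longrightarrow> P = 0" and S: "transpose S = S"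
  obtains P where "transpose P = P" "lyapunov_op A K P = S"
proof -
  define s where "s = (\<lambda>P :: real^'n^'n. (1/2) *\<^sub>R (P + transpose P))"
  define f where "f = (\<lambda>P. lyapunov_op A K (s P) + (P - s P))"
  have s_sym: "transpose (s P) = s P" for P
    by (simp add: s_def transpose_def vec_eq_iff add.commute)
  have lin_s: "linear s"
    by (rule linearI) (simp_all add: s_def transpose_def vec_eq_iff algebra_simps add_divide_distrib)
  have "linear f"
    unfolding f_def using linear_compose[OF lin_s linear_lyapunov_op[of A K]] lin_s
    by (intro linear_compose_add linear_compose_sub) (simp_all add: o_def linear_id[unfolded id_def])
  have s_s: "s (s P) = s P" for P by (simp add: s_def transpose_def vec_eq_iff add.commute)
  have s_fix: "s P = P" if "transpose P = P" for P using that by (simp add: s_def)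
  have sf: "s (f P) = lyapunov_op A K (s P)" for P
    using s_fix[OF transpose_lyapunov_op[OF s_sym[of P], of A K]]
    by (simp add: f_def linear_add[OF lin_s] linear_diff[OF lin_s] s_s)
  have "P = 0" if "f P = 0" for P
  proof -
    have "lyapunov_op A K (s P) = 0" using sf[of P] that linear_0[OF lin_s] by simp
    then have "s P = 0" by (rule inj[OF s_sym])
    then show ?thesis using that by (simp add: f_def linear_0[OF linear_lyapunov_op])
  qed
  then have "inj f" using linear_injective_0[OF \<open>linear f\<close>] by blast
  then have "surj f" using linear_injective_imp_surjective[OF \<open>linear f\<close>] by blast
  then obtain P where "f P = S" by (metis surjD)
  then have "lyapunov_op A K (s P) = S" using sf[of P] s_fix[OF S] by simp
  with that s_sym show thesis by blast
qed

section \<open>Square-integrable functions\<close>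

definition L2 :: "'a measure \<Rightarrow> ('a \<Rightarrow> 'b::euclidean_space) \<Rightarrow> bool" where
  "L2 N f \<longleftrightarrow> f \<in> borel_measurable N \<and> integrable N (\<lambda>x. (norm (f x))\<^sup>2)"

lemma L2_measurable: "L2 N f \<Longrightarrow> f \<in> borel_measurable N"
  and L2_integrable_norm2: "L2 N f \<Longrightarrow> integrable N (\<lambda>x. (norm (f x))\<^sup>2)"
  by (auto simp: L2_def)

lemma L2_dominated:
  assumes "f \<in> borel_measurable N" "integrable N g" "\<And>x. x \<in> space N \<Longrightarrow> (norm (f x))\<^sup>2 \<le> g x"
  shows "L2 N f"
  unfolding L2_def
proof
  show "integrable N (\<lambda>x. (norm (f x))\<^sup>2)"
    by (rule Bochner_Integration.integrable_bound[OF assms(2)])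
      (use assms in \<open>auto intro!: AE_I2 order_trans[OF assms(3)]\<close>)
qed fact

lemma norm_add_square_le: "(norm (a + b))\<^sup>2 \<le> 2 * (norm a)\<^sup>2 + 2 * (norm b)\<^sup>2"
  for a b :: "'a::real_inner"
proof -
  have "(norm (a + b))\<^sup>2 + (norm (a - b))\<^sup>2 = 2 * (norm a)\<^sup>2 + 2 * (norm b)\<^sup>2"
    by (simp add: power2_norm_eq_inner algebra_simps)
  then show ?thesis by (smt (verit) zero_le_power2)
qed

lemma abs_inner_le_squares: "\<bar>a \<bullet> b\<bar> \<le> (norm a)\<^sup>2 + (norm b)\<^sup>2" for a b :: "'a::real_inner"
proof -
  have "\<bar>a \<bullet> b\<bar> \<le> norm a * norm b" by (rule Cauchy_Schwarz_ineq2)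
  also have "\<dots> \<le> (norm a)\<^sup>2 + (norm b)\<^sup>2"
    using sum_squares_bound[of "norm a" "norm b"] mult_nonneg_nonneg[OF norm_ge_zero[of a] norm_ge_zero[of b]]
    by linarith
  finally show ?thesis .
qed

lemma L2_add: "L2 N f \<Longrightarrow> L2 N g \<Longrightarrow> L2 N (\<lambda>x. f x + g x)"
  by (rule L2_dominated[where g="\<lambda>x. 2 * (norm (f x))\<^sup>2 + 2 * (norm (g x))\<^sup>2"])
    (auto simp: L2_def norm_add_square_le)

lemma L2_scaleR: "L2 N f \<Longrightarrow> L2 N (\<lambda>x. c *\<^sub>R f x)"
  by (auto simp: L2_def power_mult_distrib)

lemma L2_zero: "L2 N (\<lambda>x. 0)"
  by (simp add: L2_def)

lemma L2_minus: "L2 N f \<Longrightarrow> L2 N (\<lambda>x. - f x)"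
  by (auto simp: L2_def)

lemma L2_diff: "L2 N f \<Longrightarrow> L2 N g \<Longrightarrow> L2 N (\<lambda>x. f x - g x)"
  using L2_add[of N f "\<lambda>x. - g x"] L2_minus[of N g] by simp

lemma L2_bounded_linear:
  fixes f :: "'a \<Rightarrow> 'b::euclidean_space" and h :: "'b \<Rightarrow> 'c::euclidean_space"
  assumes h: "bounded_linear h" and f: "L2 N f"
  shows "L2 N (\<lambda>x. h (f x))"
proof (rule L2_dominated)
  show "(\<lambda>x. h (f x)) \<in> borel_measurable N"
    using f h by (auto simp: L2_def intro: borel_measurable_continuous_on linear_continuous_on)
  show "integrable N (\<lambda>x. (onorm h)\<^sup>2 * (norm (f x))\<^sup>2)" using f by (simp add: L2_def)
  show "(norm (h (f x)))\<^sup>2 \<le> (onorm h)\<^sup>2 * (norm (f x))\<^sup>2" for x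
    unfolding power_mult_distrib[symmetric] by (intro power_mono onorm h) simp
qed

lemma L2_const: "finite_measure N \<Longrightarrow> L2 N (\<lambda>x. c)"
  by (simp add: L2_def finite_measure.integrable_const)

lemma integrable_inner_L2:
  assumes "L2 N f" "L2 N g" shows "integrable N (\<lambda>x. f x \<bullet> g x)"
proof (rule Bochner_Integration.integrable_bound)
  show "integrable N (\<lambda>x. (norm (f x))\<^sup>2 + (norm (g x))\<^sup>2)" using assms by (simp add: L2_def)
  show "(\<lambda>x. f x \<bullet> g x) \<in> borel_measurable N" using assms by (auto simp: L2_def)
  show "AE x in N. norm (f x \<bullet> g x) \<le> norm ((norm (f x))\<^sup>2 + (norm (g x))\<^sup>2)"
    by (intro AE_I2) (auto intro: order_trans[OF abs_inner_le_squares])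
qed

lemma integral_norm2_add_le:
  assumes "L2 N f" "L2 N g"
  shows "(\<integral>x. (norm (f x + g x))\<^sup>2 \<partial>N) \<le> 2 * (\<integral>x. (norm (f x))\<^sup>2 \<partial>N) + 2 * (\<integral>x. (norm (g x))\<^sup>2 \<partial>N)"
proof -
  have "(\<integral>x. (norm (f x + g x))\<^sup>2 \<partial>N) \<le> (\<integral>x. 2 * (norm (f x))\<^sup>2 + 2 * (norm (g x))\<^sup>2 \<partial>N)"
    using assms L2_add[OF assms] by (intro integral_mono) (auto simp: L2_def norm_add_square_le)
  then show ?thesis using assms by (simp add: L2_def)
qed

lemma integral_norm2_bounded_linear_le:
  fixes f :: "'a \<Rightarrow> 'b::euclidean_space" and h :: "'b \<Rightarrow> 'c::euclidean_space"
  assumes h: "bounded_linear h" and f: "L2 N f"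
  shows "(\<integral>x. (norm (h (f x)))\<^sup>2 \<partial>N) \<le> (onorm h)\<^sup>2 * (\<integral>x. (norm (f x))\<^sup>2 \<partial>N)"
proof -
  have "(\<integral>x. (norm (h (f x)))\<^sup>2 \<partial>N) \<le> (\<integral>x. (onorm h)\<^sup>2 * (norm (f x))\<^sup>2 \<partial>N)"
  proof (rule integral_mono)
    show "(norm (h (f x)))\<^sup>2 \<le> (onorm h)\<^sup>2 * (norm (f x))\<^sup>2" for x
      unfolding power_mult_distrib[symmetric] by (intro power_mono onorm h) simp
  qed (use f L2_bounded_linear[OF h f] in \<open>auto simp: L2_def\<close>)
  then show ?thesis by simp
qed

lemma nn_integral_L2:
  "L2 N f \<Longrightarrow> (\<integral>\<^sup>+x. ennreal ((norm (f x))\<^sup>2) \<partial>N) = ennreal (\<integral>x. (norm (f x))\<^sup>2 \<partial>N)"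
  by (intro nn_integral_eq_integral) (auto simp: L2_def)

lemma L2_iff_nn_integral:
  "f \<in> borel_measurable N \<Longrightarrow> L2 N f \<longleftrightarrow> (\<integral>\<^sup>+x. ennreal ((norm (f x))\<^sup>2) \<partial>N) < \<infinity>"
  by (auto simp: L2_def integrable_iff_bounded)

text \<open>
  Cauchy-Schwarz in its weighted form, linear in the squared norms; a small \<open>\<epsilon>\<close> is paid for by the second term.
\<close>
lemma abs_integral_inner_le:
  assumes "L2 N f" "L2 N g" "\<epsilon> > 0"
  shows "\<bar>\<integral>x. f x \<bullet> g x \<partial>N\<bar> \<le> \<epsilon> * (\<integral>x. (norm (f x))\<^sup>2 \<partial>N) + (1/\<epsilon>) * (\<integral>x. (norm (g x))\<^sup>2 \<partial>N)"
proof -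
  have "\<bar>\<integral>x. f x \<bullet> g x \<partial>N\<bar> \<le> (\<integral>x. \<bar>f x \<bullet> g x\<bar> \<partial>N)"
    using integral_norm_bound[of N "\<lambda>x. f x \<bullet> g x"] by simp
  also have "\<dots> \<le> (\<integral>x. \<epsilon> * (norm (f x))\<^sup>2 + (1/\<epsilon>) * (norm (g x))\<^sup>2 \<partial>N)"
  proof (rule integral_mono)
    show "integrable N (\<lambda>x. \<bar>f x \<bullet> g x\<bar>)" using integrable_inner_L2[OF assms(1,2)] by simp
    show "integrable N (\<lambda>x. \<epsilon> * (norm (f x))\<^sup>2 + (1/\<epsilon>) * (norm (g x))\<^sup>2)" using assms by (simp add: L2_def)
    show "\<bar>f x \<bullet> g x\<bar> \<le> \<epsilon> * (norm (f x))\<^sup>2 + (1/\<epsilon>) * (norm (g x))\<^sup>2" for x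
      using abs_inner_le_squares[of "sqrt \<epsilon> *\<^sub>R f x" "(1/sqrt \<epsilon>) *\<^sub>R g x"] assms(3)
      by (simp add: power_mult_distrib power_divide)
  qed
  also have "\<dots> = \<epsilon> * (\<integral>x. (norm (f x))\<^sup>2 \<partial>N) + (1/\<epsilon>) * (\<integral>x. (norm (g x))\<^sup>2 \<partial>N)"
    using assms by (simp add: L2_def)
  finally show ?thesis .
qed

definition L2_tendsto :: "'a measure \<Rightarrow> (nat \<Rightarrow> 'a \<Rightarrow> 'b::euclidean_space) \<Rightarrow> ('a \<Rightarrow> 'b) \<Rightarrow> bool" where
  "L2_tendsto N fs f \<longleftrightarrow> (\<forall>j. L2 N (fs j)) \<and> L2 N f \<and>
     (\<lambda>j. \<integral>x. (norm (fs j x - f x))\<^sup>2 \<partial>N) \<longlonglongrightarrow> 0"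

lemma L2_tendsto_const: "L2 N f \<Longrightarrow> L2_tendsto N (\<lambda>_. f) f"
  by (simp add: L2_tendsto_def)

lemma tendsto_0_squeeze:
  fixes f g :: "nat \<Rightarrow> real"
  assumes "g \<longlonglongrightarrow> 0" "\<And>j. 0 \<le> f j" "\<And>j. f j \<le> g j"
  shows "f \<longlonglongrightarrow> 0"
  by (rule tendsto_sandwich[OF _ _ tendsto_const assms(1)]) (auto simp: assms)

lemma L2_tendsto_diff:
  assumes "L2_tendsto N fs f" "L2_tendsto N gs g"
  shows "L2_tendsto N (\<lambda>j x. fs j x - gs j x) (\<lambda>x. f x - g x)"
  unfolding L2_tendsto_def
proof (intro conjI allI)
  have L: "L2 N (\<lambda>x. fs j x - f x)" "L2 N (\<lambda>x. g x - gs j x)" for j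
    using assms by (auto simp: L2_tendsto_def intro: L2_diff)
  have "(\<lambda>j. 2 * (\<integral>x. (norm (fs j x - f x))\<^sup>2 \<partial>N) + 2 * (\<integral>x. (norm (g x - gs j x))\<^sup>2 \<partial>N)) \<longlonglongrightarrow> 2 * 0 + 2 * 0"
    using assms by (intro tendsto_intros) (auto simp: L2_tendsto_def norm_minus_commute)
  then have lim: "(\<lambda>j. 2 * (\<integral>x. (norm (fs j x - f x))\<^sup>2 \<partial>N) + 2 * (\<integral>x. (norm (g x - gs j x))\<^sup>2 \<partial>N)) \<longlonglongrightarrow> 0"
    by simp
  show "(\<lambda>j. \<integral>x. (norm (fs j x - gs j x - (f x - g x)))\<^sup>2 \<partial>N) \<longlonglongrightarrow> 0"
  proof (rule tendsto_0_squeeze[OF lim])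
    show "(\<integral>x. (norm (fs j x - gs j x - (f x - g x)))\<^sup>2 \<partial>N)
        \<le> 2 * (\<integral>x. (norm (fs j x - f x))\<^sup>2 \<partial>N) + 2 * (\<integral>x. (norm (g x - gs j x))\<^sup>2 \<partial>N)" for j
      using integral_norm2_add_le[OF L, of j j] by (simp add: algebra_simps)
  qed simp
qed (use assms in \<open>auto simp: L2_tendsto_def intro: L2_diff\<close>)

lemma L2_tendsto_bounded_linear:
  fixes h :: "'b::euclidean_space \<Rightarrow> 'c::euclidean_space"
  assumes h: "bounded_linear h" and f: "L2_tendsto N fs f"
  shows "L2_tendsto N (\<lambda>j x. h (fs j x)) (\<lambda>x. h (f x))"
  unfolding L2_tendsto_def
proof (intro conjI allI)
  have L: "L2 N (\<lambda>x. fs j x - f x)" for j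
    using f by (auto simp: L2_tendsto_def intro: L2_diff)
  have "(\<lambda>j. (onorm h)\<^sup>2 * (\<integral>x. (norm (fs j x - f x))\<^sup>2 \<partial>N)) \<longlonglongrightarrow> (onorm h)\<^sup>2 * 0"
    using f by (intro tendsto_intros) (auto simp: L2_tendsto_def)
  then have lim: "(\<lambda>j. (onorm h)\<^sup>2 * (\<integral>x. (norm (fs j x - f x))\<^sup>2 \<partial>N)) \<longlonglongrightarrow> 0" by simp
  show "(\<lambda>j. \<integral>x. (norm (h (fs j x) - h (f x)))\<^sup>2 \<partial>N) \<longlonglongrightarrow> 0"
    by (rule tendsto_0_squeeze[OF lim])
      (use integral_norm2_bounded_linear_le[OF h L] in
        \<open>auto simp: linear_diff[OF bounded_linear.linear[OF h]]\<close>)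
qed (use assms in \<open>auto simp: L2_tendsto_def intro: L2_bounded_linear\<close>)

lemma L2_tendsto_inner:
  assumes "L2_tendsto N fs f" "L2_tendsto N gs g"
  shows "(\<lambda>j. \<integral>x. fs j x \<bullet> gs j x \<partial>N) \<longlonglongrightarrow> (\<integral>x. f x \<bullet> g x \<partial>N)"
proof (rule LIMSEQ_I)
  fix r :: real assume r: "0 < r"
  have L: "L2 N (fs j)" "L2 N f" "L2 N (gs j)" "L2 N g" "L2 N (\<lambda>x. fs j x - f x)" "L2 N (\<lambda>x. gs j x - g x)" for j
    using assms by (auto simp: L2_tendsto_def intro: L2_diff)
  define c where "c = (\<integral>x. (norm (f x))\<^sup>2 \<partial>N) + (\<integral>x. (norm (g x))\<^sup>2 \<partial>N) + 1"
  have c: "c > 0" by (auto simp: c_def intro!: add_nonneg_pos)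
  define e where "e = r / (4 * c)"
  have e: "e > 0" using r c by (simp add: e_def)
  let ?F = "\<lambda>j. \<integral>x. (norm (fs j x - f x))\<^sup>2 \<partial>N" and ?G = "\<lambda>j. \<integral>x. (norm (gs j x - g x))\<^sup>2 \<partial>N"
  have "(\<lambda>j. (1/e) * (?F j) + (1/e) * ?G j + (?F j + ?G j)) \<longlonglongrightarrow> (1/e) * 0 + (1/e) * 0 + (0 + 0)"
    using assms by (intro tendsto_intros) (auto simp: L2_tendsto_def)
  then have lim0: "(\<lambda>j. (1/e) * (?F j) + (1/e) * ?G j + (?F j + ?G j)) \<longlonglongrightarrow> 0" by simp
  obtain n where n: "\<And>j. j \<ge> n \<Longrightarrow> (1/e) * (?F j) + (1/e) * ?G j + (?F j + ?G j) < r / 2"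
  proof -
    from LIMSEQ_D[OF lim0, of "r/2"] r obtain n
      where n: "\<And>j. j \<ge> n \<Longrightarrow> norm ((1/e) * (?F j) + (1/e) * ?G j + (?F j + ?G j) - 0) < r / 2" by auto
    have "(1/e) * (?F j) + (1/e) * ?G j + (?F j + ?G j) < r / 2" if "j \<ge> n" for j
      using n[OF that] unfolding real_norm_def diff_0_right by linarith
    then show thesis by (rule that)
  qed
  have "norm ((\<integral>x. fs j x \<bullet> gs j x \<partial>N) - (\<integral>x. f x \<bullet> g x \<partial>N)) < r" if j: "j \<ge> n" for j
  proof -
    have eq: "fs j x \<bullet> gs j x - f x \<bullet> g x = f x \<bullet> (gs j x - g x) + g x \<bullet> (fs j x - f x)
        + (fs j x - f x) \<bullet> (gs j x - g x)" for x
      by (simp add: algebra_simps inner_commute)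
    have "(\<integral>x. fs j x \<bullet> gs j x \<partial>N) - (\<integral>x. f x \<bullet> g x \<partial>N) = (\<integral>x. fs j x \<bullet> gs j x - f x \<bullet> g x \<partial>N)"
      using L by (intro Bochner_Integration.integral_diff[symmetric] integrable_inner_L2)
    also have "\<dots> = (\<integral>x. f x \<bullet> (gs j x - g x) \<partial>N) + (\<integral>x. g x \<bullet> (fs j x - f x) \<partial>N)
        + (\<integral>x. (fs j x - f x) \<bullet> (gs j x - g x) \<partial>N)"
      unfolding eq using L by (simp add: integrable_inner_L2)
    finally have *: "(\<integral>x. fs j x \<bullet> gs j x \<partial>N) - (\<integral>x. f x \<bullet> g x \<partial>N) = \<dots>" .
    have "\<bar>\<integral>x. f x \<bullet> (gs j x - g x) \<partial>N\<bar> \<le> e * (\<integral>x. (norm (f x))\<^sup>2 \<partial>N) + (1/e) * ?G j"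
      "\<bar>\<integral>x. g x \<bullet> (fs j x - f x) \<partial>N\<bar> \<le> e * (\<integral>x. (norm (g x))\<^sup>2 \<partial>N) + (1/e) * ?F j"
      "\<bar>\<integral>x. (fs j x - f x) \<bullet> (gs j x - g x) \<partial>N\<bar> \<le> 1 * ?F j + (1/1) * ?G j"
      by (intro abs_integral_inner_le L e zero_less_one)+
    moreover have "e * (\<integral>x. (norm (f x))\<^sup>2 \<partial>N) + e * (\<integral>x. (norm (g x))\<^sup>2 \<partial>N) \<le> r / 4"
    proof -
      have "e * (\<integral>x. (norm (f x))\<^sup>2 \<partial>N) + e * (\<integral>x. (norm (g x))\<^sup>2 \<partial>N) \<le> e * c"
        using e by (simp add: c_def algebra_simps)
      also have "\<dots> = r / 4" using c by (simp add: e_def)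
      finally show ?thesis .
    qed
    ultimately have "\<bar>(\<integral>x. fs j x \<bullet> gs j x \<partial>N) - (\<integral>x. f x \<bullet> g x \<partial>N)\<bar> < r"
      using n[OF j] r unfolding * by linarith
    then show ?thesis by simp
  qed
  then show "\<exists>no. \<forall>j\<ge>no. norm ((\<integral>x. fs j x \<bullet> gs j x \<partial>N) - (\<integral>x. f x \<bullet> g x \<partial>N)) < r" by blast
qed

lemma L2_dominated_AE:
  assumes "f \<in> borel_measurable N" "integrable N g" "AE x in N. (norm (f x))\<^sup>2 \<le> g x"
  shows "L2 N f"
  unfolding L2_def
proof
  show "integrable N (\<lambda>x. (norm (f x))\<^sup>2)"
    by (rule Bochner_Integration.integrable_bound[OF assms(2)]) (use assms in auto)
qed fact

lemma L2_tendsto_nn_integral: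
  assumes fs: "\<And>j. L2 N (fs j)" and f: "f \<in> borel_measurable N"
    and lim: "(\<lambda>j. \<integral>\<^sup>+x. ennreal ((norm (fs j x - f x))\<^sup>2) \<partial>N) \<longlonglongrightarrow> 0"
  shows "L2_tendsto N fs f"
proof -
  have m: "(\<lambda>x. fs j x - f x) \<in> borel_measurable N" for j using L2_measurable[OF fs] f by simp
  from order_tendstoD(2)[OF lim, of 1] obtain j where
    "(\<integral>\<^sup>+x. ennreal ((norm (fs j x - f x))\<^sup>2) \<partial>N) < 1" by (auto simp: eventually_sequentially)
  then have "(\<integral>\<^sup>+x. ennreal ((norm (fs j x - f x))\<^sup>2) \<partial>N) < \<infinity>"
    using less_trans[OF _ ennreal_one_less_top] by simp
  then have "L2 N (\<lambda>x. fs j x - f x)" using L2_iff_nn_integral[OF m] by simp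
  from L2_diff[OF fs[of j] this] have L: "L2 N f" by simp
  have "(\<lambda>j. ennreal (\<integral>x. (norm (fs j x - f x))\<^sup>2 \<partial>N)) \<longlonglongrightarrow> ennreal 0"
    using lim nn_integral_L2[OF L2_diff[OF fs L]] by simp
  then have "(\<lambda>j. \<integral>x. (norm (fs j x - f x))\<^sup>2 \<partial>N) \<longlonglongrightarrow> 0"
    by (subst (asm) tendsto_ennreal_iff) (auto intro!: always_eventually)
  then show ?thesis using fs L by (simp add: L2_tendsto_def)
qed

text \<open>
  Cauchy-Schwarz for the uniform distribution on \<open>[0, s]\<close>: the integral of \<open>|f - c|\<^sup>2\<close> over the interval, with \<open>c\<close> the mean of \<open>f\<close>, is nonnegative.
\<close>
lemma norm_integral_interval_square_le:
  fixes f :: "real \<Rightarrow> 'b::euclidean_space"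
  assumes f: "L2 lborel f" and s: "0 \<le> s"
  shows "(norm (\<integral>r. indicator {0..s} r *\<^sub>R f r \<partial>lborel))\<^sup>2 \<le> s * (\<integral>r. (norm (f r))\<^sup>2 \<partial>lborel)"
proof (cases "s = 0")
  case True
  have "AE r in lborel. indicator {0..s} r *\<^sub>R f r = 0"
    using AE_lborel_singleton[of 0] by eventually_elim (auto simp: True indicator_def)
  then have "(\<integral>r. indicator {0..s} r *\<^sub>R f r \<partial>lborel) = 0" by (rule integral_eq_zero_AE)
  then show ?thesis using True by simp
next
  case False
  then have s: "s > 0" using s by simp
  define g where "g = (\<lambda>r. indicator {0..s} r *\<^sub>R f r)"
  define u where "u = (\<integral>r. g r \<partial>lborel)"
  define c where "c = (1/s) *\<^sub>R u"
  define h where "h = (\<lambda>r. indicat_real {0..s} r *\<^sub>R c)"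
  have [measurable]: "f \<in> borel_measurable lborel" using f by (simp add: L2_def)
  have ind: "integrable lborel (indicat_real {0..s})"
    using s by (intro integrable_real_indicator) auto
  have g: "L2 lborel g"
    by (rule L2_dominated[where g="\<lambda>r. (norm (f r))\<^sup>2"]) (use f in \<open>auto simp: g_def L2_def indicator_def\<close>)
  have h: "L2 lborel h"
  proof (rule L2_dominated)
    show "integrable lborel (\<lambda>r. indicat_real {0..s} r * (norm c)\<^sup>2)" using ind by (intro integrable_mult_left)
    show "h \<in> borel_measurable lborel" unfolding h_def by measurable
    show "(norm (h r))\<^sup>2 \<le> indicat_real {0..s} r * (norm c)\<^sup>2" for r by (simp add: h_def indicator_def)
  qed
  have hint: "integrable lborel h" unfolding h_def using ind by (intro integrable_scaleR_left)
  have gint: "integrable lborel g"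
  proof (rule Bochner_Integration.integrable_bound)
    show "integrable lborel (\<lambda>r. indicat_real {0..s} r + (norm (g r))\<^sup>2)" using ind g by (simp add: L2_def)
    show "g \<in> borel_measurable lborel" using g by (simp add: L2_def)
    have "norm v \<le> 1 + (norm v)\<^sup>2" for v :: 'b
      using sum_squares_bound[of 1 "norm v"] norm_ge_zero[of v] unfolding power_one mult_1_right by linarith
    then show "AE r in lborel. norm (g r) \<le> norm (indicat_real {0..s} r + (norm (g r))\<^sup>2)"
      by (intro AE_I2) (auto simp: g_def indicator_def)
  qed
  have gh: "(\<integral>r. g r \<bullet> h r \<partial>lborel) = u \<bullet> c"
  proof -
    have "(\<integral>r. g r \<bullet> h r \<partial>lborel) = (\<integral>r. g r \<bullet> c \<partial>lborel)"
      by (rule Bochner_Integration.integral_cong) (auto simp: g_def h_def indicator_def)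
    then show ?thesis using gint by (simp add: u_def)
  qed
  have hh: "(\<integral>r. (norm (h r))\<^sup>2 \<partial>lborel) = s * (norm c)\<^sup>2"
  proof -
    have "(\<integral>r. (norm (h r))\<^sup>2 \<partial>lborel) = (\<integral>r. indicat_real {0..s} r * (norm c)\<^sup>2 \<partial>lborel)"
      by (rule Bochner_Integration.integral_cong) (auto simp: h_def indicator_def)
    then show ?thesis using s by simp
  qed
  have "0 \<le> (\<integral>r. (norm (g r - h r))\<^sup>2 \<partial>lborel)" by simp
  also have "\<dots> = (\<integral>r. (norm (g r))\<^sup>2 + (norm (h r))\<^sup>2 - 2 * (g r \<bullet> h r) \<partial>lborel)"
    by (intro Bochner_Integration.integral_cong refl)
      (simp add: power2_norm_eq_inner inner_diff_left inner_diff_right inner_commute)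
  also have "\<dots> = (\<integral>r. (norm (g r))\<^sup>2 \<partial>lborel) + (\<integral>r. (norm (h r))\<^sup>2 \<partial>lborel) - 2 * (\<integral>r. g r \<bullet> h r \<partial>lborel)"
    using g h integrable_inner_L2[OF g h] by (simp add: L2_def)
  also have "\<dots> = (\<integral>r. (norm (g r))\<^sup>2 \<partial>lborel) - (norm u)\<^sup>2 / s"
    using s unfolding gh hh by (simp add: c_def power2_norm_eq_inner[symmetric] power_mult_distrib power2_eq_square)
  finally have "(norm u)\<^sup>2 \<le> s * (\<integral>r. (norm (g r))\<^sup>2 \<partial>lborel)" using s by (simp add: field_simps)
  also have "\<dots> \<le> s * (\<integral>r. (norm (f r))\<^sup>2 \<partial>lborel)"
    using s f g by (intro mult_left_mono integral_mono) (auto simp: L2_def g_def indicator_def)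
  finally show ?thesis by (simp add: u_def g_def)
qed

lemma bounded_linear_matrix: "bounded_linear ((*v) (A :: real^'n^'m))"
  by (simp add: linear_conv_bounded_linear[symmetric])

section \<open>Estimates for real sequences and paths\<close>

text \<open>
  The fundamental theorem of calculus for \<open>s \<mapsto> Z s \<bullet> P (Z s)\<close>, where \<open>Z' = b\<close>.
\<close>
lemma quadratic_form_along_primitive:
  fixes b :: "real \<Rightarrow> real^'n" and z :: "real^'n" and P :: "real^'n^'n"
  assumes b: "continuous_on {0..t} b" and t: "0 \<le> t" and P: "transpose P = P"
  defines "Z \<equiv> \<lambda>s. z + (LINT r:{0..s}|lborel. b r)"
  shows "Z t \<bullet> (P *v Z t) = z \<bullet> (P *v z) + (\<integral>s. indicator {0..t} s *\<^sub>R (2 * (b s \<bullet> (P *v Z s))) \<partial>lborel)"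
proof -
  have eq: "Z s = z + integral {0..s} b" if "s \<in> {0..t}" for s
  proof -
    have "continuous_on {0..s} b" using b that by (auto elim: continuous_on_subset)
    then show ?thesis
      using set_borel_integral_eq_integral(2)[OF borel_integrable_atLeastAtMost'] by (simp add: Z_def)
  qed
  have "((\<lambda>s. z + integral {0..s} b) has_vector_derivative b s) (at s within {0..t})" if "s \<in> {0..t}" for s
    using integral_has_vector_derivative[OF b that] by (auto intro!: derivative_eq_intros)
  then have D: "(Z has_vector_derivative b s) (at s within {0..t})" if "s \<in> {0..t}" for s
    using that by (intro has_vector_derivative_transform[OF that eq]) auto
  have contZ: "continuous_on {0..t} Z"
    using D by (intro continuous_on_vector_derivative) auto
  have D2: "((\<lambda>s. Z s \<bullet> (P *v Z s)) has_vector_derivative 2 * (b s \<bullet> (P *v Z s))) (at s within {0..t})"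
    if "0 \<le> s" "s \<le> t" for s
  proof -
    have d: "(Z has_derivative (\<lambda>h. h *\<^sub>R b s)) (at s within {0..t})"
      using D[of s] that by (simp add: has_vector_derivative_def)
    have "((\<lambda>s. Z s \<bullet> (P *v Z s)) has_derivative (\<lambda>h. Z s \<bullet> (P *v (h *\<^sub>R b s)) + (h *\<^sub>R b s) \<bullet> (P *v Z s))) (at s within {0..t})"
      by (intro has_derivative_inner d bounded_linear.has_derivative[OF bounded_linear_matrix d])
    moreover have "Z s \<bullet> (P *v (h *\<^sub>R b s)) + (h *\<^sub>R b s) \<bullet> (P *v Z s) = h *\<^sub>R (2 * (b s \<bullet> (P *v Z s)))" for h
      using inner_matrix_vector(2)[of "Z s" P "b s"] P
      by (simp add: matrix_vector_mult_scaleR inner_commute)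
    ultimately show ?thesis by (simp add: has_vector_derivative_def mult_ac)
  qed
  have "continuous_on {0..t} (\<lambda>s. 2 * (b s \<bullet> (P *v Z s)))"
    by (intro continuous_intros b contZ linear_continuous_on_compose[OF contZ] bounded_linear.linear[OF bounded_linear_matrix])
  from integral_FTC_atLeastAtMost[OF t D2 this]
  have "(\<integral>s. indicator {0..t} s *\<^sub>R (2 * (b s \<bullet> (P *v Z s))) \<partial>lborel) = Z t \<bullet> (P *v Z t) - Z 0 \<bullet> (P *v Z 0)" by simp
  moreover have "Z 0 = z" using eq[of 0] t by simp
  ultimately show ?thesis by simp
qed

text \<open>
  The lag \<open>p\<close> serves the comparison of two grids, where the difference at a fine grid point is controlled by the
  difference at the preceding coarse one; \<open>p i = i\<close> is the usual case.
\<close>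
lemma discrete_gronwall:
  fixes a b :: "nat \<Rightarrow> real"
  assumes le: "\<And>n. n \<le> N \<Longrightarrow> a n \<le> c * (\<Sum>i<n. b i)" and c: "0 \<le> c" and \<kappa>: "0 \<le> \<kappa>"
    and b: "\<And>i. i < N \<Longrightarrow> b i \<le> 2 * a (p i) + \<kappa>" and p: "\<And>i. p i \<le> i"
    and n: "n \<le> N"
  shows "a n \<le> \<kappa> / 2 * ((1 + 2 * c) ^ n - 1)"
  using n
proof (induction n rule: less_induct)
  case (less n)
  define q where "q = 1 + 2 * c"
  have q: "q \<ge> 1" using c by (simp add: q_def)
  have "b i \<le> \<kappa> * q ^ i" if "i < n" for i
  proof -
    have "a (p i) \<le> \<kappa> / 2 * (q ^ p i - 1)"
      unfolding q_def using p[of i] that less.prems by (intro less.IH) auto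
    also have "\<dots> \<le> \<kappa> / 2 * (q ^ i - 1)"
      using p[of i] q \<kappa> by (intro mult_left_mono diff_right_mono power_increasing) auto
    finally show ?thesis using b[of i] that less.prems by (simp add: algebra_simps)
  qed
  then have "c * (\<Sum>i<n. b i) \<le> c * (\<Sum>i<n. \<kappa> * q ^ i)"
    using c by (intro mult_left_mono sum_mono) auto
  also have "\<dots> = \<kappa> / 2 * ((q - 1) * (\<Sum>i<n. q ^ i))" by (simp add: q_def sum_distrib_left[symmetric])
  also have "(q - 1) * (\<Sum>i<n. q ^ i) = q ^ n - 1"
    by (simp add: power_diff_1_eq)
  finally show ?case using le[OF less.prems] by (simp add: q_def)
qed

text \<open>
  The limit of functions with jumps is continuous if the oscillation of the \<open>n\<close>-th one at the scale \<open>1 / 2 ^ n\<close>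
  tends to zero along with its distance to the limit. Both are required to decay geometrically.
\<close>
lemma continuous_on_lim_of_geometric:
  fixes f :: "nat \<Rightarrow> real \<Rightarrow> 'b::banach"
  assumes p: "0 < p" "p < 1" and d: "0 \<le> d"
    and step: "\<And>n t. n \<ge> n0 \<Longrightarrow> t \<in> S \<Longrightarrow> norm (f (Suc n) t - f n t) \<le> d * p ^ n"
    and osc: "\<And>n s t. n \<ge> n0 \<Longrightarrow> s \<in> S \<Longrightarrow> t \<in> S \<Longrightarrow> \<bar>t - s\<bar> < 1 / 2 ^ n \<Longrightarrow> norm (f n t - f n s) \<le> d * p ^ n"
  shows "\<And>t. t \<in> S \<Longrightarrow> convergent (\<lambda>n. f n t)" "continuous_on S (\<lambda>t. lim (\<lambda>n. f n t))"
proof -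
  define D where "D = d / (1 - p)"
  have D: "0 \<le> D" using p d by (simp add: D_def)
  have tail: "norm (f m t - f n t) \<le> D * p ^ n" if n: "n \<ge> n0" "n \<le> m" and t: "t \<in> S" for n m t
  proof -
    have "norm (f m t - f n t) \<le> D * (p ^ n - p ^ m)"
      using n(2)
    proof (induction m rule: dec_induct)
      case (step m)
      have "norm (f (Suc m) t - f n t) \<le> norm (f (Suc m) t - f m t) + norm (f m t - f n t)"
        using norm_triangle_ineq[of "f (Suc m) t - f m t" "f m t - f n t"] by simp
      also have "\<dots> \<le> d * p ^ m + D * (p ^ n - p ^ m)"
        using assms(4)[of m t] step n t by (intro add_mono) auto
      also have "d * p ^ m = D * (p ^ m - p ^ Suc m)" using p by (simp add: D_def field_simps)
      finally show ?case by (simp add: algebra_simps)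
    qed simp
    also have "\<dots> \<le> D * p ^ n" using D p by (intro mult_left_mono) auto
    finally show ?thesis .
  qed
  have pn: "(\<lambda>n. D * p ^ n) \<longlonglongrightarrow> 0"
    using tendsto_mult_right_zero[OF LIMSEQ_realpow_zero[of p]] p by simp
  show conv: "convergent (\<lambda>n. f n t)" if t: "t \<in> S" for t
  proof (rule Cauchy_convergent, rule metric_CauchyI)
    fix e :: real assume "0 < e"
    then obtain N where N: "\<And>n. n \<ge> N \<Longrightarrow> norm (D * p ^ n) < e / 2"
      using LIMSEQ_D[OF pn, of "e/2"] by auto
    let ?N = "max N n0"
    have "dist (f m t) (f n t) < e" if "m \<ge> ?N" "n \<ge> ?N" for m n
    proof -
      have "norm (f m t - f ?N t) < e / 2" "norm (f n t - f ?N t) < e / 2"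
        using tail[of ?N m t] tail[of ?N n t] N[of ?N] that t D p by auto
      then show ?thesis unfolding dist_norm using norm_triangle_ineq4[of "f m t - f ?N t" "f n t - f ?N t"] by simp
    qed
    then show "\<exists>M. \<forall>m\<ge>M. \<forall>n\<ge>M. dist (f m t) (f n t) < e" by blast
  qed
  have limit: "norm (lim (\<lambda>n. f n t) - f n t) \<le> D * p ^ n" if n: "n \<ge> n0" and t: "t \<in> S" for n t
  proof (rule LIMSEQ_le_const2)
    show "(\<lambda>m. norm (f m t - f n t)) \<longlonglongrightarrow> norm (lim (\<lambda>n. f n t) - f n t)"
      using conv[OF t] by (intro tendsto_intros) (simp add: convergent_LIMSEQ_iff)
    show "\<exists>N. \<forall>m\<ge>N. norm (f m t - f n t) \<le> D * p ^ n" using tail n t by blast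
  qed
  show "continuous_on S (\<lambda>t. lim (\<lambda>n. f n t))"
  proof (rule continuous_onI)
    fix t and e :: real assume t: "t \<in> S" and e: "0 < e"
    have "(\<lambda>n. 2 * (D * p ^ n) + d * p ^ n) \<longlonglongrightarrow> 2 * 0 + 0"
      using pn tendsto_mult_right_zero[OF LIMSEQ_realpow_zero[of p], of d] p by (intro tendsto_intros) simp_all
    then obtain N where N: "\<And>n. n \<ge> N \<Longrightarrow> norm (2 * (D * p ^ n) + d * p ^ n) < e"
      using LIMSEQ_D[of "\<lambda>n. 2 * (D * p ^ n) + d * p ^ n" 0 e] e by auto
    let ?N = "max N n0"
    have small: "2 * (D * p ^ ?N) + d * p ^ ?N < e" using N[of ?N] by simp
    show "\<exists>r>0. \<forall>s\<in>S. dist s t < r \<longrightarrow> dist (lim (\<lambda>n. f n s)) (lim (\<lambda>n. f n t)) \<le> e"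
    proof (intro exI conjI ballI impI)
      show "0 < (1 / 2 ^ ?N :: real)" by simp
      fix s assume s: "s \<in> S" "dist s t < 1 / 2 ^ ?N"
      have "norm (f ?N s - f ?N t) \<le> d * p ^ ?N" using s t by (intro osc) (auto simp: dist_real_def)
      moreover have "norm (lim (\<lambda>n. f n s) - f ?N s) \<le> D * p ^ ?N" "norm (lim (\<lambda>n. f n t) - f ?N t) \<le> D * p ^ ?N"
        using limit s t by auto
      moreover have "lim (\<lambda>n. f n s) - lim (\<lambda>n. f n t) =
          (lim (\<lambda>n. f n s) - f ?N s) + (f ?N s - f ?N t) - (lim (\<lambda>n. f n t) - f ?N t)" by simp
      ultimately have "norm (lim (\<lambda>n. f n s) - lim (\<lambda>n. f n t)) \<le> D * p ^ ?N + d * p ^ ?N + D * p ^ ?N"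
        by (metis (no_types, lifting) add_mono norm_triangle_le norm_triangle_le_diff)
      then show "dist (lim (\<lambda>n. f n s)) (lim (\<lambda>n. f n t)) \<le> e" using small by (simp add: dist_norm)
    qed
  qed
qed

lemma nat_floor_dyadic:
  fixes t :: real
  assumes "0 \<le> t" "n \<le> m"
  shows "nat \<lfloor>t * 2 ^ m\<rfloor> div 2 ^ (m - n) = nat \<lfloor>t * 2 ^ n\<rfloor>"
proof -
  have "t * 2 ^ n = (t * 2 ^ m) / real_of_int (2 ^ (m - n))"
  proof -
    have "(2::real) ^ (m - n) * 2 ^ n = 2 ^ m" using assms(2) by (simp add: power_add[symmetric])
    then show ?thesis by (simp only: of_int_power of_int_numeral) (simp add: field_simps)
  qed
  then have "\<lfloor>t * 2 ^ n\<rfloor> = \<lfloor>t * 2 ^ m\<rfloor> div 2 ^ (m - n)"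
    by (simp only: floor_divide_real_eq_div zero_le_power zero_le_numeral)
  then show ?thesis using assms(1) by (simp add: nat_div_distrib nat_power_eq)
qed

context brownian_motion
begin

section \<open>Elementary stochastic integrals\<close>

lemma measurable_F_imp_M: "0 \<le> t \<Longrightarrow> f \<in> borel_measurable (F t) \<Longrightarrow> f \<in> borel_measurable M"
  using filtration_subalgebra[of t] measurable_from_subalg by blast

lemma space_F: "0 \<le> t \<Longrightarrow> space (F t) = space M"
  using filtration_subalgebra[of t] by (simp add: subalgebra_def)

lemma measurable_F_mono:
  assumes "0 \<le> s" "s \<le> t" "f \<in> borel_measurable (F s)"
  shows "f \<in> borel_measurable (F t)"
proof -
  have "subalgebra (F t) (F s)"
    using assms filtration_mono[of s t] space_F[of s] space_F[of t] by (simp add: subalgebra_def)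
  then show ?thesis using assms(3) measurable_from_subalg by blast
qed

definition dW :: "real \<Rightarrow> real \<Rightarrow> 'w \<Rightarrow> real" where
  "dW a b = (\<lambda>\<omega>. W b \<omega> - W a \<omega>)"

lemma dW_measurable_F: "0 \<le> a \<Longrightarrow> a \<le> b \<Longrightarrow> dW a b \<in> borel_measurable (F b)"
  unfolding dW_def using adapted measurable_F_mono[of a b "W a"] by (intro borel_measurable_diff) auto

lemma dW_measurable [measurable]: "0 \<le> a \<Longrightarrow> a \<le> b \<Longrightarrow> dW a b \<in> borel_measurable M"
  using dW_measurable_F[of a b] measurable_F_imp_M[of b] by auto

lemma dW_moments:
  assumes "0 \<le> a" "a \<le> b"
  shows "integrable M (\<lambda>\<omega>. dW a b \<omega> ^ k)" "(\<integral>\<omega>. dW a b \<omega> \<partial>M) = 0"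
    "(\<integral>\<omega>. (dW a b \<omega>)\<^sup>2 \<partial>M) = b - a" "(\<integral>\<omega>. (dW a b \<omega>) ^ 4 \<partial>M) = 3 * (b - a)\<^sup>2"
proof -
  have *: "integrable M (\<lambda>\<omega>. dW a b \<omega> ^ k) \<and> (\<integral>\<omega>. dW a b \<omega> \<partial>M) = 0 \<and>
    (\<integral>\<omega>. (dW a b \<omega>)\<^sup>2 \<partial>M) = b - a \<and> (\<integral>\<omega>. (dW a b \<omega>) ^ 4 \<partial>M) = 3 * (b - a)\<^sup>2"
  proof (cases "a = b")
    case True
    then have "dW a b = (\<lambda>\<omega>. 0)" by (simp add: dW_def)
    then show ?thesis using True by simp
  next
    case False
    then have ab: "a < b" using assms by simp
    define s where "s = sqrt (b - a)"
    have s: "s > 0" "s\<^sup>2 = b - a" using ab by (auto simp: s_def)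
    have d: "distributed M lborel (dW a b) (normal_density 0 s)"
      using increment_normal[OF assms(1) ab] by (simp add: dW_def s_def)
    have int: "integrable M (\<lambda>\<omega>. dW a b \<omega> ^ k)" for k
      using distributed_integrable[OF d, of "\<lambda>x. x ^ k"] integrable_normal_moment[OF s(1), of 0 k] by simp
    have mom: "(\<integral>\<omega>. dW a b \<omega> ^ k \<partial>M) = (\<integral>x. normal_density 0 s x * (x - 0) ^ k \<partial>lborel)" for k
      using distributed_integral[OF d, of "\<lambda>x. x ^ k"] by simp
    have "(\<integral>\<omega>. dW a b \<omega> ^ (2 * 0 + 1) \<partial>M) = 0"
      unfolding mom by (rule integral_normal_moment_odd[OF s(1)])
    moreover have "(\<integral>\<omega>. dW a b \<omega> ^ (2 * 1) \<partial>M) = s\<^sup>2"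
      unfolding mom integral_normal_moment_even[OF s(1)] by simp
    moreover have "(\<integral>\<omega>. dW a b \<omega> ^ (2 * 2) \<partial>M) = 3 * (s\<^sup>2)\<^sup>2"
      unfolding mom integral_normal_moment_even[OF s(1)] using s by (simp add: fact_numeral power_divide field_simps)
    ultimately show ?thesis using int s by simp
  qed
  from * show "integrable M (\<lambda>\<omega>. dW a b \<omega> ^ k)" "(\<integral>\<omega>. dW a b \<omega> \<partial>M) = 0"
    "(\<integral>\<omega>. (dW a b \<omega>)\<^sup>2 \<partial>M) = b - a" "(\<integral>\<omega>. (dW a b \<omega>) ^ 4 \<partial>M) = 3 * (b - a)\<^sup>2" by auto
qed

text \<open>
  All stochastic estimates rest on this consequence of independent increments.
\<close>
lemma dW_independent_product:
  fixes f :: "'w \<Rightarrow> real"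
  assumes ab: "0 \<le> a" "a \<le> b" and f: "f \<in> borel_measurable (F a)" "integrable M f"
  shows "integrable M (\<lambda>\<omega>. f \<omega> * dW a b \<omega> ^ k)"
    "(\<integral>\<omega>. f \<omega> * dW a b \<omega> ^ k \<partial>M) = (\<integral>\<omega>. f \<omega> \<partial>M) * (\<integral>\<omega>. dW a b \<omega> ^ k \<partial>M)"
proof -
  have *: "integrable M (\<lambda>\<omega>. f \<omega> * dW a b \<omega> ^ k) \<and>
    (\<integral>\<omega>. f \<omega> * dW a b \<omega> ^ k \<partial>M) = (\<integral>\<omega>. f \<omega> \<partial>M) * (\<integral>\<omega>. dW a b \<omega> ^ k \<partial>M)"
  proof (cases "a = b")
    case True
    then have "dW a b = (\<lambda>\<omega>. 0)" by (simp add: dW_def)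
    then show ?thesis using f by (simp add: power_0_left prob_space)
  next
    case False
    then have ab': "a < b" using ab by simp
    let ?I = "{(\<lambda>\<omega>. W b \<omega> - W a \<omega>) -` S \<inter> space M | S. S \<in> sets borel}"
    have "indep_var borel f borel (dW a b)"
      unfolding indep_var_eq
    proof (intro conjI)
      show "random_variable borel f" "random_variable borel (dW a b)"
        using f ab by (auto intro: measurable_F_imp_M)
      have s1: "sigma_sets (space M) {f -` A \<inter> space M |A. A \<in> sets borel} \<subseteq> sets (F a)"
      proof -
        have "{f -` A \<inter> space M |A. A \<in> sets borel} \<subseteq> sets (F a)"
          using measurable_sets[OF f(1)] space_F[OF ab(1)] by auto
        then show ?thesis using sets.sigma_sets_subset[of _ "F a"] space_F[OF ab(1)] by simp
      qed
      have s2: "sigma_sets (space M) {dW a b -` A \<inter> space M |A. A \<in> sets borel} = ?I"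
        using sets_vimage_algebra[of "space M" "dW a b" borel] sets_vimage_algebra2[of "dW a b" "space M" borel]
        by (simp add: dW_def)
      show "indep_set (sigma_sets (space M) {f -` A \<inter> space M |A. A \<in> sets borel})
          (sigma_sets (space M) {dW a b -` A \<inter> space M |A. A \<in> sets borel})"
        unfolding s2 indep_set_def
        by (rule indep_sets_mono_sets[OF increment_indep[OF ab(1) ab', unfolded indep_set_def]])
          (use s1 in \<open>auto split: bool.split\<close>)
    qed
    then have "indep_var borel (id \<circ> f) borel ((\<lambda>x. x ^ k) \<circ> dW a b)"
      by (rule indep_var_compose) auto
    then have iv: "indep_var borel f borel (\<lambda>\<omega>. dW a b \<omega> ^ k)" by (simp add: o_def)
    show ?thesis
      using indep_var_integrable[OF iv f(2) dW_moments(1)[OF ab]]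
        indep_var_lebesgue_integral[OF iv f(2) dW_moments(1)[OF ab]] by blast
  qed
  then show "integrable M (\<lambda>\<omega>. f \<omega> * dW a b \<omega> ^ k)"
    "(\<integral>\<omega>. f \<omega> * dW a b \<omega> ^ k \<partial>M) = (\<integral>\<omega>. f \<omega> \<partial>M) * (\<integral>\<omega>. dW a b \<omega> ^ k \<partial>M)" by auto
qed

text \<open>
  The admissible coefficients of a stochastic increment that starts at time \<open>t\<close>.
\<close>
definition L2F :: "real \<Rightarrow> ('w \<Rightarrow> 'b::euclidean_space) \<Rightarrow> bool" where
  "L2F t \<xi> \<longleftrightarrow> \<xi> \<in> borel_measurable (F t) \<and> L2 M \<xi>"

lemma L2F_I: "0 \<le> t \<Longrightarrow> \<xi> \<in> borel_measurable (F t) \<Longrightarrow> integrable M (\<lambda>\<omega>. (norm (\<xi> \<omega>))\<^sup>2) \<Longrightarrow> L2F t \<xi>"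
  by (auto simp: L2F_def L2_def intro: measurable_F_imp_M)

lemma L2F_D: "L2F t \<xi> \<Longrightarrow> L2 M \<xi>" "L2F t \<xi> \<Longrightarrow> \<xi> \<in> borel_measurable (F t)"
  by (auto simp: L2F_def)

lemma L2F_mono: "L2F s \<xi> \<Longrightarrow> 0 \<le> s \<Longrightarrow> s \<le> t \<Longrightarrow> L2F t \<xi>"
  by (auto simp: L2F_def intro: measurable_F_mono)

lemma L2F_add: "L2F t f \<Longrightarrow> L2F t g \<Longrightarrow> L2F t (\<lambda>\<omega>. f \<omega> + g \<omega>)"
  by (auto simp: L2F_def intro: L2_add)

lemma L2F_diff: "L2F t f \<Longrightarrow> L2F t g \<Longrightarrow> L2F t (\<lambda>\<omega>. f \<omega> - g \<omega>)"
  by (auto simp: L2F_def intro: L2_diff)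

lemma L2F_scaleR: "L2F t f \<Longrightarrow> L2F t (\<lambda>\<omega>. c *\<^sub>R f \<omega>)"
  by (auto simp: L2F_def intro: L2_scaleR)

lemma L2F_const: "L2F t (\<lambda>\<omega>. c)"
  by (auto simp: L2F_def intro: L2_const finite_measure_axioms)

lemma L2F_bounded_linear:
  fixes f :: "'w \<Rightarrow> 'b::euclidean_space" and h :: "'b \<Rightarrow> 'c::euclidean_space"
  shows "bounded_linear h \<Longrightarrow> L2F t f \<Longrightarrow> L2F t (\<lambda>\<omega>. h (f \<omega>))"
  by (auto simp: L2F_def intro: L2_bounded_linear borel_measurable_continuous_on linear_continuous_on)

lemma dW_scaleR:
  assumes ab: "0 \<le> a" "a \<le> b" and \<xi>: "L2F a \<xi>"
  shows "L2F b (\<lambda>\<omega>. dW a b \<omega> *\<^sub>R \<xi> \<omega>)"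
proof (rule L2F_I)
  show "(\<lambda>\<omega>. dW a b \<omega> *\<^sub>R \<xi> \<omega>) \<in> borel_measurable (F b)"
    using dW_measurable_F[OF ab] measurable_F_mono[OF ab L2F_D(2)[OF \<xi>]] by (rule borel_measurable_scaleR)
  have "integrable M (\<lambda>\<omega>. (norm (\<xi> \<omega>))\<^sup>2 * dW a b \<omega> ^ 2)"
    using \<xi> by (intro dW_independent_product ab) (auto simp: L2F_def L2_def)
  then show "integrable M (\<lambda>\<omega>. (norm (dW a b \<omega> *\<^sub>R \<xi> \<omega>))\<^sup>2)"
    by (simp add: power_mult_distrib mult.commute)
qed (use ab in auto)

lemma dW_orthogonal:
  assumes ab: "0 \<le> a" "a \<le> b" and "L2F a \<xi>" "L2F a \<eta>"
  shows "(\<integral>\<omega>. \<eta> \<omega> \<bullet> (dW a b \<omega> *\<^sub>R \<xi> \<omega>) \<partial>M) = 0"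
proof -
  have "(\<lambda>\<omega>. \<eta> \<omega> \<bullet> \<xi> \<omega>) \<in> borel_measurable (F a)" "integrable M (\<lambda>\<omega>. \<eta> \<omega> \<bullet> \<xi> \<omega>)"
    using assms(3,4) by (auto simp: L2F_def intro: integrable_inner_L2)
  from dW_independent_product(2)[OF ab this, of 1] show ?thesis
    using dW_moments(2)[OF ab] by (simp add: mult.commute)
qed

lemma dW_isometry:
  assumes ab: "0 \<le> a" "a \<le> b" and "L2F a \<xi>" "L2F a \<eta>"
  shows "(\<integral>\<omega>. (dW a b \<omega> *\<^sub>R \<xi> \<omega>) \<bullet> (dW a b \<omega> *\<^sub>R \<eta> \<omega>) \<partial>M) = (b - a) * (\<integral>\<omega>. \<xi> \<omega> \<bullet> \<eta> \<omega> \<partial>M)"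
proof -
  have "(\<lambda>\<omega>. \<xi> \<omega> \<bullet> \<eta> \<omega>) \<in> borel_measurable (F a)" "integrable M (\<lambda>\<omega>. \<xi> \<omega> \<bullet> \<eta> \<omega>)"
    using assms(3,4) by (auto simp: L2F_def intro: integrable_inner_L2)
  from dW_independent_product(2)[OF ab this, of 2] show ?thesis
    using dW_moments(3)[OF ab] by (simp add: mult_ac power2_eq_square)
qed

lemma dW_split: "dW a c \<omega> *\<^sub>R (v :: 'b::real_vector) = dW a b \<omega> *\<^sub>R v + dW b c \<omega> *\<^sub>R v"
  by (simp add: dW_def algebra_simps)

lemma dW_inner_same_start:
  assumes c: "0 \<le> c" "c \<le> b" "b \<le> d" and L: "L2F c \<xi>" "L2F c \<eta>"
  shows "(\<integral>\<omega>. (dW c b \<omega> *\<^sub>R \<xi> \<omega>) \<bullet> (dW c d \<omega> *\<^sub>R \<eta> \<omega>) \<partial>M) = (b - c) * (\<integral>\<omega>. \<xi> \<omega> \<bullet> \<eta> \<omega> \<partial>M)"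
proof -
  have 1: "L2F b (\<lambda>\<omega>. dW c b \<omega> *\<^sub>R \<xi> \<omega>)" "L2F b (\<lambda>\<omega>. dW c b \<omega> *\<^sub>R \<eta> \<omega>)" "L2F b \<eta>"
    using dW_scaleR[OF c(1,2) L(1)] dW_scaleR[OF c(1,2) L(2)] L2F_mono[OF L(2) c(1,2)] by auto
  have 2: "L2F d (\<lambda>\<omega>. dW b d \<omega> *\<^sub>R \<eta> \<omega>)" using c by (intro dW_scaleR 1) auto
  have "(\<integral>\<omega>. (dW c b \<omega> *\<^sub>R \<xi> \<omega>) \<bullet> (dW c d \<omega> *\<^sub>R \<eta> \<omega>) \<partial>M) =
     (\<integral>\<omega>. (dW c b \<omega> *\<^sub>R \<xi> \<omega>) \<bullet> (dW c b \<omega> *\<^sub>R \<eta> \<omega>) + (dW c b \<omega> *\<^sub>R \<xi> \<omega>) \<bullet> (dW b d \<omega> *\<^sub>R \<eta> \<omega>) \<partial>M)"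
    by (subst dW_split[of c d _ _ b]) (simp only: inner_add_right)
  also have "\<dots> = (\<integral>\<omega>. (dW c b \<omega> *\<^sub>R \<xi> \<omega>) \<bullet> (dW c b \<omega> *\<^sub>R \<eta> \<omega>) \<partial>M)
      + (\<integral>\<omega>. (dW c b \<omega> *\<^sub>R \<xi> \<omega>) \<bullet> (dW b d \<omega> *\<^sub>R \<eta> \<omega>) \<partial>M)"
    by (intro Bochner_Integration.integral_add integrable_inner_L2 L2F_D(1)[OF 1(1)] L2F_D(1)[OF 1(2)] L2F_D(1)[OF 2])
  finally show ?thesis
    using dW_isometry[OF c(1,2) L] dW_orthogonal[of b d \<eta>, OF _ c(3) 1(3) 1(1)] c by simp
qed

lemma dW_inner_ordered:
  assumes a: "0 \<le> a" "a \<le> b" and c: "c \<le> d" "a \<le> c" and L: "L2F a \<xi>" "L2F c \<eta>"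
  shows "(\<integral>\<omega>. (dW a b \<omega> *\<^sub>R \<xi> \<omega>) \<bullet> (dW c d \<omega> *\<^sub>R \<eta> \<omega>) \<partial>M) =
    max 0 (min b d - max a c) * (\<integral>\<omega>. \<xi> \<omega> \<bullet> \<eta> \<omega> \<partial>M)"
proof (cases "b \<le> c")
  case True
  have "L2F c (\<lambda>\<omega>. dW a b \<omega> *\<^sub>R \<xi> \<omega>)"
    using a c True by (intro L2F_mono[OF dW_scaleR[OF a L(1)]]) auto
  from dW_orthogonal[OF _ c(1) L(2) this] show ?thesis using a c True by simp
next
  case False
  then have cb: "0 \<le> c" "c \<le> b" using a c by auto
  have 1: "L2F c (\<lambda>\<omega>. dW a c \<omega> *\<^sub>R \<xi> \<omega>)" "L2F c \<xi>"
    using dW_scaleR[OF a(1) c(2) L(1)] L2F_mono[OF L(1) a(1) c(2)] by auto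
  have 2: "L2F b (\<lambda>\<omega>. dW c b \<omega> *\<^sub>R \<xi> \<omega>)" "L2F d (\<lambda>\<omega>. dW c d \<omega> *\<^sub>R \<eta> \<omega>)"
    using dW_scaleR[OF cb 1(2)] dW_scaleR[OF cb(1) c(1) L(2)] by auto
  have "(\<integral>\<omega>. (dW a b \<omega> *\<^sub>R \<xi> \<omega>) \<bullet> (dW c d \<omega> *\<^sub>R \<eta> \<omega>) \<partial>M) =
     (\<integral>\<omega>. (dW a c \<omega> *\<^sub>R \<xi> \<omega>) \<bullet> (dW c d \<omega> *\<^sub>R \<eta> \<omega>) + (dW c b \<omega> *\<^sub>R \<xi> \<omega>) \<bullet> (dW c d \<omega> *\<^sub>R \<eta> \<omega>) \<partial>M)"
    by (subst dW_split[of a b _ _ c]) (simp only: inner_add_left)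
  also have "\<dots> = (\<integral>\<omega>. (dW a c \<omega> *\<^sub>R \<xi> \<omega>) \<bullet> (dW c d \<omega> *\<^sub>R \<eta> \<omega>) \<partial>M)
      + (\<integral>\<omega>. (dW c b \<omega> *\<^sub>R \<xi> \<omega>) \<bullet> (dW c d \<omega> *\<^sub>R \<eta> \<omega>) \<partial>M)"
    by (intro Bochner_Integration.integral_add integrable_inner_L2 L2F_D(1)[OF 1(1)] L2F_D(1)[OF 2(1)] L2F_D(1)[OF 2(2)])
  also have "(\<integral>\<omega>. (dW a c \<omega> *\<^sub>R \<xi> \<omega>) \<bullet> (dW c d \<omega> *\<^sub>R \<eta> \<omega>) \<partial>M) = 0"
    by (rule dW_orthogonal[OF cb(1) c(1) L(2) 1(1)])
  also have "(\<integral>\<omega>. (dW c b \<omega> *\<^sub>R \<xi> \<omega>) \<bullet> (dW c d \<omega> *\<^sub>R \<eta> \<omega>) \<partial>M) = (min b d - c) * (\<integral>\<omega>. \<xi> \<omega> \<bullet> \<eta> \<omega> \<partial>M)"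
  proof (cases "b \<le> d")
    case True
    then show ?thesis using dW_inner_same_start[OF cb _ 1(2) L(2)] by simp
  next
    case False
    then show ?thesis using dW_inner_same_start[OF cb(1) c(1) _ L(2) 1(2), of b]
      by (simp add: inner_commute)
  qed
  finally show ?thesis using a c cb by simp
qed

text \<open>
  Two increments with coefficients from their pasts are paired through the length of the overlap of their
  intervals. The overlap is isolated by splitting the intervals; the other parts are orthogonal by
  \<open>dW_orthogonal\<close>.
\<close>
lemma dW_inner:
  assumes "0 \<le> a" "a \<le> b" "0 \<le> c" "c \<le> d" and L: "L2F a \<xi>" "L2F c \<eta>"
  shows "(\<integral>\<omega>. (dW a b \<omega> *\<^sub>R \<xi> \<omega>) \<bullet> (dW c d \<omega> *\<^sub>R \<eta> \<omega>) \<partial>M) =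
    max 0 (min b d - max a c) * (\<integral>\<omega>. \<xi> \<omega> \<bullet> \<eta> \<omega> \<partial>M)"
proof (cases "a \<le> c")
  case True
  then show ?thesis using dW_inner_ordered assms by blast
next
  case False
  then show ?thesis using dW_inner_ordered[of c d a b \<eta> \<xi>] assms
    by (simp add: inner_commute min.commute max.commute)
qed

abbreviation LM :: "(real \<times> 'w) measure" where "LM \<equiv> lborel \<Otimes>\<^sub>M M"

lemma pair_sigma_finite_LM: "pair_sigma_finite lborel M" ..

lemma integral_LM_product:
  fixes f :: "'w \<Rightarrow> real" and g :: "real \<Rightarrow> real"
  assumes f: "integrable M f" and g: "integrable lborel g"
  shows "integrable LM (\<lambda>(t, \<omega>). g t * f \<omega>)"
    "(\<integral>(t, \<omega>). g t * f \<omega> \<partial>LM) = (\<integral>t. g t \<partial>lborel) * (\<integral>\<omega>. f \<omega> \<partial>M)"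
proof -
  interpret P: pair_sigma_finite lborel M by (rule pair_sigma_finite_LM)
  show int: "integrable LM (\<lambda>(t, \<omega>). g t * f \<omega>)"
  proof (rule P.Fubini_integrable)
    show "(\<lambda>(t, \<omega>). g t * f \<omega>) \<in> borel_measurable LM"
      using f g by measurable
    show "integrable lborel (\<lambda>x. \<integral>y. norm (case (x, y) of (t, \<omega>) \<Rightarrow> g t * f \<omega>) \<partial>M)"
      using f g by (simp add: abs_mult)
    show "AE x in lborel. integrable M (\<lambda>y. case (x, y) of (t, \<omega>) \<Rightarrow> g t * f \<omega>)"
      using f by simp
  qed
  show "(\<integral>(t, \<omega>). g t * f \<omega> \<partial>LM) = (\<integral>t. g t \<partial>lborel) * (\<integral>\<omega>. f \<omega> \<partial>M)"
    using P.integral_fst[OF int] by simp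
qed

text \<open>
  Sums of pieces \<open>1\<^bsub>(a,b]\<^esub> \<xi>\<close> over intervals that may overlap, together with their stochastic integrals. They are
  closed under addition, whereas two simple processes would first have to be refined to a common partition, and
  statements about them follow by induction on the number of pieces.
\<close>
inductive elementary :: "(real \<Rightarrow> 'w \<Rightarrow> 'b::euclidean_space) \<Rightarrow> ('w \<Rightarrow> 'b) \<Rightarrow> bool" where
  zero: "elementary (\<lambda>t \<omega>. 0) (\<lambda>\<omega>. 0)"
| add: "elementary \<phi> J \<Longrightarrow> 0 \<le> a \<Longrightarrow> a \<le> b \<Longrightarrow> L2F a \<xi> \<Longrightarrow>
    elementary (\<lambda>t \<omega>. \<phi> t \<omega> + indicator {a<..b} t *\<^sub>R \<xi> \<omega>) (\<lambda>\<omega>. J \<omega> + dW a b \<omega> *\<^sub>R \<xi> \<omega>)"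

lemma integrable_indicator_Ioc: "integrable lborel (indicat_real {a<..b::real})"
proof (rule integrable_real_indicator)
  show "{a<..b} \<in> sets lborel" by (simp add: greaterThanAtMost_borel)
  show "emeasure lborel {a<..b} < \<infinity>" by (cases "a \<le> b") auto
qed

lemma piece_L2:
  assumes "0 \<le> a" "a \<le> b" "L2F a \<xi>"
  shows "L2 LM (\<lambda>(t, \<omega>). indicator {a<..b} t *\<^sub>R \<xi> \<omega>)"
proof -
  have \<xi>: "L2 M \<xi>" using assms L2F_D by blast
  have [measurable]: "\<xi> \<in> borel_measurable M" using L2_measurable[OF \<xi>] .
  show ?thesis
  proof (rule L2_dominated)
    show "(\<lambda>(t, \<omega>). indicator {a<..b} t *\<^sub>R \<xi> \<omega>) \<in> borel_measurable LM" by measurable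
    show "integrable LM (\<lambda>(t, \<omega>). indicator {a<..b} t * (norm (\<xi> \<omega>))\<^sup>2)"
      using \<xi> by (intro integral_LM_product integrable_indicator_Ioc) (auto simp: L2_def)
  qed (auto simp: indicator_def)
qed

lemma elementary_L2:
  assumes "elementary \<phi> J"
  shows "L2 LM (\<lambda>(t, \<omega>). \<phi> t \<omega>)" "L2 M J"
proof -
  have "L2 LM (\<lambda>(t, \<omega>). \<phi> t \<omega>) \<and> L2 M J"
    using assms
  proof induction
    case (add \<phi> J a b \<xi>)
    then show ?case
      using L2_add[OF conjunct1[OF add.IH] piece_L2[OF add.hyps(2-4)]]
        L2_add[OF conjunct2[OF add.IH] L2F_D(1)[OF dW_scaleR[OF add.hyps(2-4)]]]
      by (simp add: case_prod_unfold)
  qed (auto simp: L2_zero case_prod_unfold)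
  then show "L2 LM (\<lambda>(t, \<omega>). \<phi> t \<omega>)" "L2 M J" by auto
qed

lemma piece_piece_isometry:
  assumes a: "0 \<le> a" "a \<le> b" and c: "0 \<le> c" "c \<le> d" and L: "L2F a \<xi>" "L2F c \<eta>"
  shows "(\<integral>\<omega>. (dW a b \<omega> *\<^sub>R \<xi> \<omega>) \<bullet> (dW c d \<omega> *\<^sub>R \<eta> \<omega>) \<partial>M) =
    (\<integral>(t, \<omega>). (indicator {a<..b} t *\<^sub>R \<xi> \<omega>) \<bullet> (indicator {c<..d} t *\<^sub>R \<eta> \<omega>) \<partial>LM)"
proof -
  have i: "integrable M (\<lambda>\<omega>. \<xi> \<omega> \<bullet> \<eta> \<omega>)" using L by (auto simp: L2F_def intro: integrable_inner_L2)
  have ind: "(indicator {a<..b} t *\<^sub>R \<xi> \<omega>) \<bullet> (indicator {c<..d} t *\<^sub>R \<eta> \<omega>) =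
      indicator {max a c<..min b d} t * (\<xi> \<omega> \<bullet> \<eta> \<omega>)" for t \<omega>
    by (auto simp: indicator_def)
  have "(\<integral>(t, \<omega>). (indicator {a<..b} t *\<^sub>R \<xi> \<omega>) \<bullet> (indicator {c<..d} t *\<^sub>R \<eta> \<omega>) \<partial>LM) =
    (\<integral>(t, \<omega>). indicator {max a c<..min b d} t * (\<xi> \<omega> \<bullet> \<eta> \<omega>) \<partial>LM)"
    by (simp only: ind)
  also have "\<dots> = (\<integral>t. indicator {max a c<..min b d} t \<partial>lborel) * (\<integral>\<omega>. \<xi> \<omega> \<bullet> \<eta> \<omega> \<partial>M)"
    by (rule integral_LM_product(2)[OF i integrable_indicator_Ioc])
  also have "(\<integral>t. indicator {max a c<..min b d} t \<partial>lborel) = max 0 (min b d - max a c)"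
    by (cases "max a c \<le> min b d") (auto simp: measure_def)
  finally show ?thesis using dW_inner[OF a c L] by simp
qed

lemma elementary_piece_isometry:
  assumes "elementary \<phi> J" and c: "0 \<le> c" "c \<le> d" and L: "L2F c \<eta>"
  shows "(\<integral>\<omega>. J \<omega> \<bullet> (dW c d \<omega> *\<^sub>R \<eta> \<omega>) \<partial>M) =
    (\<integral>(t, \<omega>). \<phi> t \<omega> \<bullet> (indicator {c<..d} t *\<^sub>R \<eta> \<omega>) \<partial>LM)"
  using assms(1)
proof induction
  case (add \<phi> J a b \<xi>)
  have p: "L2 LM (\<lambda>p. case p of (t, \<omega>) \<Rightarrow> indicator {c<..d} t *\<^sub>R \<eta> \<omega>)" "L2 M (\<lambda>\<omega>. dW c d \<omega> *\<^sub>R \<eta> \<omega>)"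
    using piece_L2[OF c L] dW_scaleR[OF c L] L2F_D by auto
  have q: "L2 LM (\<lambda>p. case p of (t, \<omega>) \<Rightarrow> indicator {a<..b} t *\<^sub>R \<xi> \<omega>)" "L2 M (\<lambda>\<omega>. dW a b \<omega> *\<^sub>R \<xi> \<omega>)"
    using piece_L2[OF add.hyps(2-4)] dW_scaleR[OF add.hyps(2-4)] L2F_D by auto
  note e = elementary_L2[OF add.hyps(1)]
  show ?case
    unfolding inner_add_left
      Bochner_Integration.integral_add[OF integrable_inner_L2[OF e(2) p(2)] integrable_inner_L2[OF q(2) p(2)]]
      add.IH piece_piece_isometry[OF add.hyps(2,3) c add.hyps(4) L]
    using Bochner_Integration.integral_add[OF integrable_inner_L2[OF e(1) p(1)] integrable_inner_L2[OF q(1) p(1)]]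
    by (simp only: case_prod_unfold)
qed (simp add: case_prod_unfold)

text \<open>
  Both sides are bilinear, so two inductions reduce the claim to a pair of pieces (\<open>piece_piece_isometry\<close>).
\<close>
lemma elementary_isometry:
  assumes "elementary \<psi> J'" "elementary \<phi> J"
  shows "(\<integral>\<omega>. J \<omega> \<bullet> J' \<omega> \<partial>M) = (\<integral>(t, \<omega>). \<phi> t \<omega> \<bullet> \<psi> t \<omega> \<partial>LM)"
  using assms(1)
proof induction
  case (add \<psi> J' a b \<xi>)
  have q: "L2 LM (\<lambda>p. case p of (t, \<omega>) \<Rightarrow> indicator {a<..b} t *\<^sub>R \<xi> \<omega>)" "L2 M (\<lambda>\<omega>. dW a b \<omega> *\<^sub>R \<xi> \<omega>)"
    using piece_L2[OF add.hyps(2-4)] dW_scaleR[OF add.hyps(2-4)] L2F_D by auto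
  note e = elementary_L2[OF add.hyps(1)] and f = elementary_L2[OF assms(2)]
  show ?case
    unfolding inner_add_right
      Bochner_Integration.integral_add[OF integrable_inner_L2[OF f(2) e(2)] integrable_inner_L2[OF f(2) q(2)]]
      add.IH elementary_piece_isometry[OF assms(2) add.hyps(2-4)]
    using Bochner_Integration.integral_add[OF integrable_inner_L2[OF f(1) e(1)] integrable_inner_L2[OF f(1) q(1)]]
    by (simp only: case_prod_unfold)
qed (simp add: case_prod_unfold)

lemma elementary_bounded_linear:
  fixes h :: "'b::euclidean_space \<Rightarrow> 'c::euclidean_space"
  assumes h: "bounded_linear h" and "elementary \<phi> J"
  shows "elementary (\<lambda>t \<omega>. h (\<phi> t \<omega>)) (\<lambda>\<omega>. h (J \<omega>))"
  using assms(2)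
proof induction
  interpret h: bounded_linear h by fact
  case (add \<phi> J a b \<xi>)
  then show ?case
    using elementary.add[OF add.IH add.hyps(2,3) L2F_bounded_linear[OF h add.hyps(4)]]
    by (simp add: h.add h.scaleR)
qed (simp add: elementary.zero linear_0[OF bounded_linear.linear[OF h]])

lemma elementary_diff:
  assumes "elementary \<psi> J'" "elementary \<phi> J"
  shows "elementary (\<lambda>t \<omega>. \<phi> t \<omega> - \<psi> t \<omega>) (\<lambda>\<omega>. J \<omega> - J' \<omega>)"
  using assms(1)
proof induction
  case (add \<psi> J' a b \<xi>)
  show ?case
    using elementary.add[OF add.IH add.hyps(2,3) L2F_scaleR[OF add.hyps(4), of "-1"]]
    by (simp add: algebra_simps)
qed (simp add: assms(2))

text \<open>
  Cutting a process at time \<open>s\<close> changes its integral by a random variable orthogonal to the past of \<open>s\<close>: the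
  increments that are removed start at time \<open>s\<close> or later.
\<close>
lemma elementary_truncate:
  assumes "elementary \<phi> J" and s: "0 \<le> s"
  obtains J' where "elementary (\<lambda>t \<omega>. indicator {..s} t *\<^sub>R \<phi> t \<omega>) J'"
    "\<And>\<eta>. L2F s \<eta> \<Longrightarrow> (\<integral>\<omega>. \<eta> \<omega> \<bullet> (J \<omega> - J' \<omega>) \<partial>M) = 0"
proof -
  have "\<exists>J'. elementary (\<lambda>t \<omega>. indicator {..s} t *\<^sub>R \<phi> t \<omega>) J' \<and>
    (\<forall>\<eta>. L2F s \<eta> \<longrightarrow> (\<integral>\<omega>. \<eta> \<omega> \<bullet> (J \<omega> - J' \<omega>) \<partial>M) = 0)"
    using assms(1)
  proof induction
    case zero
    show ?case by (intro exI[of _ "\<lambda>_. 0"]) (simp add: elementary.zero)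
  next
    case (add \<phi> J a b \<xi>)
    from add.IH obtain J' where J': "elementary (\<lambda>t \<omega>. indicator {..s} t *\<^sub>R \<phi> t \<omega>) J'"
      "\<And>\<eta>. L2F s \<eta> \<Longrightarrow> (\<integral>\<omega>. \<eta> \<omega> \<bullet> (J \<omega> - J' \<omega>) \<partial>M) = 0" by blast
    note L = elementary_L2(2)[OF add.hyps(1)] elementary_L2(2)[OF J'(1)]
    have split: "(\<integral>\<omega>. \<eta> \<omega> \<bullet> (J \<omega> - J' \<omega> + f \<omega>) \<partial>M) = (\<integral>\<omega>. \<eta> \<omega> \<bullet> f \<omega> \<partial>M)" if "L2F s \<eta>" "L2 M f" for \<eta> f
      using J'(2)[OF that(1)] integrable_inner_L2[OF L2F_D(1)[OF that(1)] L2_diff[OF L]]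
        integrable_inner_L2[OF L2F_D(1)[OF that(1)] that(2)]
      by (simp add: inner_add_right)
    show ?case
    proof (cases "s \<le> a")
      case True
      have "L2F s \<eta> \<Longrightarrow> (\<integral>\<omega>. \<eta> \<omega> \<bullet> (J \<omega> + dW a b \<omega> *\<^sub>R \<xi> \<omega> - J' \<omega>) \<partial>M) = 0" for \<eta>
        using split[of \<eta> "\<lambda>\<omega>. dW a b \<omega> *\<^sub>R \<xi> \<omega>"] dW_orthogonal[OF add.hyps(2-4) L2F_mono[of s \<eta> a]] s True
          L2F_D(1)[OF dW_scaleR[OF add.hyps(2-4)]] by (simp add: algebra_simps)
      moreover have "(\<lambda>t \<omega>. indicator {..s} t *\<^sub>R (\<phi> t \<omega> + indicator {a<..b} t *\<^sub>R \<xi> \<omega>)) =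
          (\<lambda>t \<omega>. indicator {..s} t *\<^sub>R \<phi> t \<omega>)"
        using True by (auto simp: fun_eq_iff indicator_def)
      ultimately show ?thesis using J'(1) by auto
    next
      case False
      define m where "m = min b s"
      have m: "a \<le> m" "m \<le> b" "0 \<le> m" using False add.hyps by (auto simp: m_def)
      have "elementary (\<lambda>t \<omega>. indicator {..s} t *\<^sub>R \<phi> t \<omega> + indicator {a<..m} t *\<^sub>R \<xi> \<omega>) (\<lambda>\<omega>. J' \<omega> + dW a m \<omega> *\<^sub>R \<xi> \<omega>)"
        by (rule elementary.add) (use J' add.hyps m in auto)
      moreover have "(\<lambda>t \<omega>. indicator {..s} t *\<^sub>R \<phi> t \<omega> + indicator {a<..m} t *\<^sub>R \<xi> \<omega>) =
         (\<lambda>t \<omega>. indicator {..s} t *\<^sub>R (\<phi> t \<omega> + indicator {a<..b} t *\<^sub>R \<xi> \<omega>))"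
        by (auto simp: fun_eq_iff indicator_def m_def)
      moreover have "(\<integral>\<omega>. \<eta> \<omega> \<bullet> (J \<omega> + dW a b \<omega> *\<^sub>R \<xi> \<omega> - (J' \<omega> + dW a m \<omega> *\<^sub>R \<xi> \<omega>)) \<partial>M) = 0" if \<eta>: "L2F s \<eta>" for \<eta>
      proof -
        have \<xi>m: "L2F m \<xi>" using L2F_mono[OF add.hyps(4)] add.hyps m by auto
        have "(\<integral>\<omega>. \<eta> \<omega> \<bullet> (J \<omega> + dW a b \<omega> *\<^sub>R \<xi> \<omega> - (J' \<omega> + dW a m \<omega> *\<^sub>R \<xi> \<omega>)) \<partial>M) =
          (\<integral>\<omega>. \<eta> \<omega> \<bullet> (J \<omega> - J' \<omega> + dW m b \<omega> *\<^sub>R \<xi> \<omega>) \<partial>M)"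
          by (simp add: dW_def algebra_simps)
        also have "\<dots> = (\<integral>\<omega>. \<eta> \<omega> \<bullet> (dW m b \<omega> *\<^sub>R \<xi> \<omega>) \<partial>M)"
          using m L2F_D(1)[OF dW_scaleR[OF m(3,2) \<xi>m]] by (intro split \<eta>)
        also have "\<dots> = 0"
        proof (cases "b \<le> s")
          case True
          then show ?thesis by (simp add: m_def dW_def)
        next
          case False
          then have "m = s" by (simp add: m_def)
          then show ?thesis using dW_orthogonal[OF m(3,2) \<xi>m] \<eta> by simp
        qed
        finally show ?thesis .
      qed
      ultimately show ?thesis by auto
    qed
  qed
  with that show thesis by blast
qed

lemma simple_ito_integral_elementary:
  assumes "simple_ito_integral M F W \<phi> T I"
  shows "elementary \<phi> I" "\<And>t \<omega>. t \<notin> {0..T} \<Longrightarrow> \<phi> t \<omega> = 0"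
proof -
  from assms obtain k :: nat and \<tau> \<xi> where \<tau>: "\<tau> 0 = 0" "\<tau> k = T" "\<And>i. i < k \<Longrightarrow> \<tau> i \<le> \<tau> (Suc i)"
    and \<xi>: "\<And>i. i < k \<Longrightarrow> \<xi> i \<in> borel_measurable (F (\<tau> i))" "\<And>i. i < k \<Longrightarrow> integrable M (\<lambda>\<omega>. (norm (\<xi> i \<omega>))\<^sup>2)"
    and eq: "\<phi> = (\<lambda>t \<omega>. \<Sum>i<k. indicator {\<tau> i<..\<tau> (Suc i)} t *\<^sub>R \<xi> i \<omega>)"
      "I = (\<lambda>\<omega>. \<Sum>i<k. (W (\<tau> (Suc i)) \<omega> - W (\<tau> i) \<omega>) *\<^sub>R \<xi> i \<omega>)"
    unfolding simple_ito_integral_def by blast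
  have mono: "i \<le> j \<Longrightarrow> j \<le> k \<Longrightarrow> \<tau> i \<le> \<tau> j" for i j
  proof (induction j rule: nat_induct)
    case (Suc j)
    then show ?case using \<tau>(3)[of j] by (cases "i = Suc j") auto
  qed simp
  have pos: "0 \<le> \<tau> i" if "i \<le> k" for i using mono[of 0 i] that \<tau>(1) by simp
  have "elementary (\<lambda>t \<omega>. \<Sum>i<n. indicator {\<tau> i<..\<tau> (Suc i)} t *\<^sub>R \<xi> i \<omega>)
      (\<lambda>\<omega>. \<Sum>i<n. dW (\<tau> i) (\<tau> (Suc i)) \<omega> *\<^sub>R \<xi> i \<omega>)" if "n \<le> k" for n
    using that
  proof (induction n)
    case (Suc n)
    then show ?case
      using elementary.add[of _ _ "\<tau> n" "\<tau> (Suc n)" "\<xi> n"] pos[of n] \<tau>(3)[of n] L2F_I[of "\<tau> n" "\<xi> n"] \<xi>[of n]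
      by simp
  qed (simp add: elementary.zero)
  from this[of k] show "elementary \<phi> I" by (simp add: eq dW_def)
  fix t \<omega> assume t: "t \<notin> {0..T}"
  have "t \<notin> {\<tau> i<..\<tau> (Suc i)}" if "i < k" for i
    using that pos[of i] mono[of "Suc i" k] \<tau>(2) t by auto
  then show "\<phi> t \<omega> = 0" unfolding eq by (intro sum.neutral) auto
qed

section \<open>The Ito integral\<close>

text \<open>
  Processes on \<open>[0, T]\<close> as functions on the product of time and probability space, so that the \<open>L\<^sup>2\<close> calculus applies to them.
\<close>
definition truncate :: "real \<Rightarrow> (real \<Rightarrow> 'w \<Rightarrow> 'b::real_vector) \<Rightarrow> real \<times> 'w \<Rightarrow> 'b" where
  "truncate T \<phi> = (\<lambda>(t, \<omega>). indicator {0..T} t *\<^sub>R \<phi> t \<omega>)"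

text \<open>
  Clamping time to \<open>[0, T]\<close> maps the whole time axis into the interval on which progressive measurability speaks.
\<close>
lemma progressive_truncate_measurable:
  fixes \<phi> :: "real \<Rightarrow> 'w \<Rightarrow> 'b::euclidean_space"
  assumes \<phi>: "progressively_measurable F \<phi>" and T: "0 \<le> T"
  shows "truncate T \<phi> \<in> borel_measurable LM"
proof -
  have \<phi>T: "(\<lambda>(t, \<omega>). \<phi> t \<omega>) \<in> borel_measurable (restrict_space borel {0..T} \<Otimes>\<^sub>M F T)"
    using \<phi> T by (auto simp: progressively_measurable_def)
  have "(\<lambda>\<omega>. \<omega>) \<in> measurable M (F T)"
    by (rule measurable_from_subalg[OF filtration_subalgebra[OF T]]) simp
  then have "(\<lambda>p. (max 0 (min T (fst p)), snd p)) \<in>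
      measurable LM (restrict_space borel {0..T} \<Otimes>\<^sub>M F T)"
    using T by (intro measurable_Pair measurable_restrict_space2
        measurable_compose[OF measurable_snd]) auto
  from measurable_compose[OF this \<phi>T]
  have [measurable]: "(\<lambda>p. \<phi> (max 0 (min T (fst p))) (snd p)) \<in> borel_measurable LM" by simp
  have "truncate T \<phi> = (\<lambda>p. indicator {0..T} (fst p) *\<^sub>R \<phi> (max 0 (min T (fst p))) (snd p))"
    by (auto simp: truncate_def fun_eq_iff indicator_def)
  also have "\<dots> \<in> borel_measurable LM" by measurable
  finally show ?thesis .
qed

lemma mean_square_on_LM:
  fixes \<phi> :: "real \<Rightarrow> 'w \<Rightarrow> 'b::euclidean_space"
  assumes "truncate T \<phi> \<in> borel_measurable LM"
  shows "mean_square_on M {0..T} \<phi> = (\<integral>\<^sup>+p. ennreal ((norm (truncate T \<phi> p))\<^sup>2) \<partial>LM)"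
proof -
  interpret P: pair_sigma_finite lborel M by (rule pair_sigma_finite_LM)
  have "mean_square_on M {0..T} \<phi> = (\<integral>\<^sup>+\<omega>. \<integral>\<^sup>+t. ennreal ((norm (truncate T \<phi> (t, \<omega>)))\<^sup>2) \<partial>lborel \<partial>M)"
    unfolding mean_square_on_def by (intro nn_integral_cong) (auto simp: truncate_def indicator_def)
  also have "\<dots> = (\<integral>\<^sup>+p. ennreal ((norm (truncate T \<phi> p))\<^sup>2) \<partial>LM)"
  proof (rule P.nn_integral_snd[of "\<lambda>p. ennreal ((norm (truncate T \<phi> p))\<^sup>2)"])
    note [measurable] = assms
    show "(\<lambda>p. ennreal ((norm (truncate T \<phi> p))\<^sup>2)) \<in> borel_measurable LM" by measurable
  qed
  finally show ?thesis .
qed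

lemma admissible_L2:
  assumes "admissible M F \<phi>" "0 \<le> T" shows "L2 LM (truncate T \<phi>)"
  using assms progressive_truncate_measurable[of \<phi> T] mean_square_on_LM[of T \<phi>]
  by (auto simp: admissible_def L2_iff_nn_integral)

lemma admissible_measurable_F:
  fixes X :: "real \<Rightarrow> 'w \<Rightarrow> 'b::euclidean_space"
  assumes "admissible M F X" "0 \<le> s" shows "X s \<in> borel_measurable (F s)"
proof -
  have "(\<lambda>(t, \<omega>). X t \<omega>) \<in> borel_measurable (restrict_space borel {0..s} \<Otimes>\<^sub>M F s)"
    using assms by (auto simp: admissible_def progressively_measurable_def)
  moreover have "(\<lambda>\<omega>. (s, \<omega>)) \<in> measurable (F s) (restrict_space borel {0..s} \<Otimes>\<^sub>M F s)"
    using assms(2) by (intro measurable_Pair1') (simp add: space_restrict_space)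
  ultimately have "(\<lambda>\<omega>. (\<lambda>(t, \<omega>). X t \<omega>) (s, \<omega>)) \<in> borel_measurable (F s)"
    by (rule measurable_compose[rotated])
  then show ?thesis by simp
qed

lemma ito_integral_approx:
  fixes \<sigma> :: "real \<Rightarrow> 'w \<Rightarrow> 'b::euclidean_space"
  assumes "has_ito_integral M F W \<sigma> T I" "0 \<le> T"
  obtains \<phi>s Is where "\<And>j. elementary (\<phi>s j) (Is j)"
    "L2_tendsto LM (\<lambda>j (t, \<omega>). \<phi>s j t \<omega>) (truncate T \<sigma>)" "L2_tendsto M Is I"
proof -
  from assms obtain \<phi>s Is where s: "\<And>j. simple_ito_integral M F W (\<phi>s j) T (Is j)"
    and c1: "(\<lambda>j. mean_square_on M {0..T} (\<lambda>t \<omega>. \<phi>s j t \<omega> - \<sigma> t \<omega>)) \<longlonglongrightarrow> 0"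
    and c2: "(\<lambda>j. \<integral>\<^sup>+ \<omega>. ennreal ((norm (Is j \<omega> - I \<omega>))\<^sup>2) \<partial>M) \<longlonglongrightarrow> 0"
    and adm: "admissible M F \<sigma>" and I: "I \<in> borel_measurable M"
    unfolding has_ito_integral_def by blast
  have e: "elementary (\<phi>s j) (Is j)" for j using simple_ito_integral_elementary[OF s] by blast
  have z: "\<phi>s j t \<omega> = 0" if "t \<notin> {0..T}" for j t \<omega>
    using simple_ito_integral_elementary(2)[OF s that] .
  note L = elementary_L2[OF e]
  have \<sigma>: "truncate T \<sigma> \<in> borel_measurable LM"
    using adm assms(2) by (intro progressive_truncate_measurable) (auto simp: admissible_def)
  have eq: "truncate T (\<lambda>t \<omega>. \<phi>s j t \<omega> - \<sigma> t \<omega>) p = (case p of (t, \<omega>) \<Rightarrow> \<phi>s j t \<omega>) - truncate T \<sigma> p" for j p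
    using z by (auto simp: truncate_def indicator_def split: prod.split)
  have "mean_square_on M {0..T} (\<lambda>t \<omega>. \<phi>s j t \<omega> - \<sigma> t \<omega>) =
      (\<integral>\<^sup>+p. ennreal ((norm ((case p of (t, \<omega>) \<Rightarrow> \<phi>s j t \<omega>) - truncate T \<sigma> p))\<^sup>2) \<partial>LM)" for j
  proof (subst mean_square_on_LM)
    show "truncate T (\<lambda>t \<omega>. \<phi>s j t \<omega> - \<sigma> t \<omega>) \<in> borel_measurable LM"
      unfolding eq using L2_measurable[OF L(1)] \<sigma> by (rule borel_measurable_diff)
  qed (simp only: eq)
  then have "L2_tendsto LM (\<lambda>j (t, \<omega>). \<phi>s j t \<omega>) (truncate T \<sigma>)"
    using c1 by (intro L2_tendsto_nn_integral L \<sigma>) simp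
  moreover have "L2_tendsto M Is I" using c2 by (intro L2_tendsto_nn_integral L I)
  ultimately show thesis using that e by blast
qed

lemma ito_integral_L2:
  assumes "has_ito_integral M F W \<sigma> T I" "0 \<le> T" shows "L2 M I"
proof -
  obtain Is where "L2_tendsto M Is I" using ito_integral_approx[OF assms] by blast
  then show ?thesis by (simp add: L2_tendsto_def)
qed

text \<open>
  The polarized isometry: the map \<open>h\<close> will be a matrix \<open>P\<close>, giving the quadratic term of the second moment identity.
\<close>
lemma ito_isometry:
  fixes h :: "'b::euclidean_space \<Rightarrow> 'b"
  assumes I: "has_ito_integral M F W \<sigma> T I" "0 \<le> T" and h: "bounded_linear h"
  shows "(\<integral>\<omega>. I \<omega> \<bullet> h (I \<omega>) \<partial>M) = (\<integral>p. truncate T \<sigma> p \<bullet> h (truncate T \<sigma> p) \<partial>LM)"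
proof -
  obtain \<phi>s Is where a: "\<And>j. elementary (\<phi>s j) (Is j)"
    "L2_tendsto LM (\<lambda>j (t, \<omega>). \<phi>s j t \<omega>) (truncate T \<sigma>)" "L2_tendsto M Is I"
    using ito_integral_approx[OF I] by blast
  have "(\<integral>\<omega>. Is j \<omega> \<bullet> h (Is j \<omega>) \<partial>M) =
      (\<integral>p. (case p of (t, \<omega>) \<Rightarrow> \<phi>s j t \<omega>) \<bullet> h (case p of (t, \<omega>) \<Rightarrow> \<phi>s j t \<omega>) \<partial>LM)" for j
    using elementary_isometry[OF elementary_bounded_linear[OF h a(1)] a(1), of j j]
    by (simp add: case_prod_unfold)
  moreover have "(\<lambda>j. \<integral>\<omega>. Is j \<omega> \<bullet> h (Is j \<omega>) \<partial>M) \<longlonglongrightarrow> (\<integral>\<omega>. I \<omega> \<bullet> h (I \<omega>) \<partial>M)"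
    by (rule L2_tendsto_inner[OF a(3) L2_tendsto_bounded_linear[OF h a(3)]])
  moreover have "(\<lambda>j. \<integral>p. (case p of (t, \<omega>) \<Rightarrow> \<phi>s j t \<omega>) \<bullet> h (case p of (t, \<omega>) \<Rightarrow> \<phi>s j t \<omega>) \<partial>LM)
      \<longlonglongrightarrow> (\<integral>p. truncate T \<sigma> p \<bullet> h (truncate T \<sigma> p) \<partial>LM)"
    by (rule L2_tendsto_inner[OF a(2) L2_tendsto_bounded_linear[OF h a(2)]])
  ultimately show ?thesis using LIMSEQ_unique by simp
qed

lemma elementary_mean_zero:
  assumes "elementary \<phi> J" shows "(\<integral>\<omega>. c \<bullet> J \<omega> \<partial>M) = 0"
  using assms
proof induction
  case (add \<phi> J a b \<xi>)
  then show ?case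
    using dW_orthogonal[OF add.hyps(2-4) L2F_const[of a c]]
      integrable_inner_L2[OF L2F_D(1)[OF L2F_const[of 0 c]] elementary_L2(2)[OF add.hyps(1)]]
      integrable_inner_L2[OF L2F_D(1)[OF L2F_const[of 0 c]] L2F_D(1)[OF dW_scaleR[OF add.hyps(2-4)]]]
    by (simp only: inner_add_right Bochner_Integration.integral_add)
qed simp

lemma ito_integral_mean_zero:
  assumes I: "has_ito_integral M F W \<sigma> T I" "0 \<le> T"
  shows "(\<integral>\<omega>. c \<bullet> I \<omega> \<partial>M) = 0"
proof -
  obtain \<phi>s Is where a: "\<And>j. elementary (\<phi>s j) (Is j)" "L2_tendsto M Is I"
    using ito_integral_approx[OF I] by blast
  have "(\<lambda>j. \<integral>\<omega>. c \<bullet> Is j \<omega> \<partial>M) \<longlonglongrightarrow> (\<integral>\<omega>. c \<bullet> I \<omega> \<partial>M)"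
    by (rule L2_tendsto_inner[OF L2_tendsto_const a(2)]) (rule L2F_D(1)[OF L2F_const[of 0]])
  then show ?thesis using LIMSEQ_unique[OF _ tendsto_const] elementary_mean_zero[OF a(1)] by auto
qed

text \<open>
  The martingale property. The integrals up to \<open>s\<close> and up to \<open>t\<close> come with unrelated approximations. Those for
  \<open>t\<close>, cut at \<open>s\<close>, also approximate the process on \<open>[0, s]\<close>, so by the isometry their integrals have the same
  limit as the approximations for \<open>s\<close>; and cutting is invisible to the past by \<open>elementary_truncate\<close>.
\<close>
lemma ito_integral_orthogonal_past:
  fixes \<sigma> :: "real \<Rightarrow> 'w \<Rightarrow> 'b::euclidean_space"
  assumes I: "has_ito_integral M F W \<sigma> t It" "has_ito_integral M F W \<sigma> s Is" and s: "0 \<le> s" "s \<le> t"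
    and \<eta>: "L2F s \<eta>"
  shows "(\<integral>\<omega>. \<eta> \<omega> \<bullet> It \<omega> \<partial>M) = (\<integral>\<omega>. \<eta> \<omega> \<bullet> Is \<omega> \<partial>M)"
proof -
  have t: "0 \<le> t" using s by simp
  obtain \<phi> J where a: "\<And>j. elementary (\<phi> j) (J j)"
    "L2_tendsto LM (\<lambda>j (t, \<omega>). \<phi> j t \<omega>) (truncate t \<sigma>)" "L2_tendsto M J It"
    using ito_integral_approx[OF I(1) t] by blast
  obtain \<psi> K where b: "\<And>j. elementary (\<psi> j) (K j)"
    "L2_tendsto LM (\<lambda>j (t, \<omega>). \<psi> j t \<omega>) (truncate s \<sigma>)" "L2_tendsto M K Is"
    using ito_integral_approx[OF I(2) s(1)] by blast
  have "\<forall>j. \<exists>J'. elementary (\<lambda>t \<omega>. indicator {..s} t *\<^sub>R \<phi> j t \<omega>) J' \<and>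
      (\<forall>\<eta>. L2F s \<eta> \<longrightarrow> (\<integral>\<omega>. \<eta> \<omega> \<bullet> (J j \<omega> - J' \<omega>) \<partial>M) = 0)"
  proof
    fix j
    obtain J' where "elementary (\<lambda>t \<omega>. indicator {..s} t *\<^sub>R \<phi> j t \<omega>) J'"
      "\<And>\<eta>. L2F s \<eta> \<Longrightarrow> (\<integral>\<omega>. \<eta> \<omega> \<bullet> (J j \<omega> - J' \<omega>) \<partial>M) = 0"
      by (rule elementary_truncate[OF a(1)[of j] s(1)]) blast
    then show "\<exists>J'. elementary (\<lambda>t \<omega>. indicator {..s} t *\<^sub>R \<phi> j t \<omega>) J' \<and>
      (\<forall>\<eta>. L2F s \<eta> \<longrightarrow> (\<integral>\<omega>. \<eta> \<omega> \<bullet> (J j \<omega> - J' \<omega>) \<partial>M) = 0)" by blast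
  qed
  then obtain J' where J': "\<And>j. elementary (\<lambda>t \<omega>. indicator {..s} t *\<^sub>R \<phi> j t \<omega>) (J' j)"
    "\<And>j \<eta>. L2F s \<eta> \<Longrightarrow> (\<integral>\<omega>. \<eta> \<omega> \<bullet> (J j \<omega> - J' j \<omega>) \<partial>M) = 0" by metis
  note L\<eta> = L2F_D(1)[OF \<eta>]
  have LI: "L2 M It" "L2 M Is" using ito_integral_L2 I s t by blast+
  note La = elementary_L2[OF a(1)] and Lb = elementary_L2[OF b(1)] and LJ' = elementary_L2[OF J'(1)]
  define D where "D = (\<lambda>j. (\<integral>p. (norm ((case p of (t, \<omega>) \<Rightarrow> \<phi> j t \<omega>) - truncate t \<sigma> p))\<^sup>2 \<partial>LM))"
  define E where "E = (\<lambda>j. (\<integral>p. (norm ((case p of (t, \<omega>) \<Rightarrow> \<psi> j t \<omega>) - truncate s \<sigma> p))\<^sup>2 \<partial>LM))"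
  have lim: "(\<lambda>j. 2 * D j + 2 * E j) \<longlonglongrightarrow> 0"
  proof -
    have "D \<longlonglongrightarrow> 0" "E \<longlonglongrightarrow> 0" using a(2) b(2) by (simp_all add: L2_tendsto_def D_def E_def)
    then have "(\<lambda>j. 2 * D j + 2 * E j) \<longlonglongrightarrow> 2 * 0 + 2 * 0" by (intro tendsto_intros)
    then show ?thesis by simp
  qed
  have "(\<lambda>j. \<integral>\<omega>. (norm (J' j \<omega> - K j \<omega>))\<^sup>2 \<partial>M) \<longlonglongrightarrow> 0"
  proof (rule tendsto_0_squeeze[OF lim])
    fix j
    define d where "d = (\<lambda>p. (case p of (t, \<omega>) \<Rightarrow> \<phi> j t \<omega>) - truncate t \<sigma> p)"
    define e where "e = (\<lambda>p. truncate s \<sigma> p - (case p of (t, \<omega>) \<Rightarrow> \<psi> j t \<omega>))"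
    define d' where "d' = (\<lambda>p. indicat_real {..s} (fst p) *\<^sub>R d p)"
    have Ld: "L2 LM d" "L2 LM e" using a(2) b(2) by (auto simp: d_def e_def L2_tendsto_def intro: L2_diff)
    have [measurable]: "d \<in> borel_measurable LM" using Ld by (simp add: L2_def)
    have Ld': "L2 LM d'"
      by (rule L2_dominated[where g="\<lambda>p. (norm (d p))\<^sup>2"]) (use Ld in \<open>auto simp: d'_def L2_def indicator_def\<close>)
    have dd: "(\<integral>p. (norm (d' p))\<^sup>2 \<partial>LM) \<le> (\<integral>p. (norm (d p))\<^sup>2 \<partial>LM)"
      using Ld Ld' by (intro integral_mono) (auto simp: L2_def d'_def indicator_def)
    have "(\<integral>\<omega>. (norm (J' j \<omega> - K j \<omega>))\<^sup>2 \<partial>M) =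
      (\<integral>p. (norm (case p of (t, \<omega>) \<Rightarrow> indicator {..s} t *\<^sub>R \<phi> j t \<omega> - \<psi> j t \<omega>))\<^sup>2 \<partial>LM)"
      using elementary_isometry[OF elementary_diff[OF b(1) J'(1)] elementary_diff[OF b(1) J'(1)], of j j j j]
      by (simp add: power2_norm_eq_inner case_prod_unfold)
    also have "\<dots> = (\<integral>p. (norm (d' p + e p))\<^sup>2 \<partial>LM)"
    proof -
      have "(case p of (t, \<omega>) \<Rightarrow> indicator {..s} t *\<^sub>R \<phi> j t \<omega> - \<psi> j t \<omega>) = d' p + e p" for p
        using s by (auto simp: d'_def d_def e_def truncate_def indicator_def split: prod.split)
      then show ?thesis by simp
    qed
    also have "\<dots> \<le> 2 * (\<integral>p. (norm (d' p))\<^sup>2 \<partial>LM) + 2 * (\<integral>p. (norm (e p))\<^sup>2 \<partial>LM)"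
      by (rule integral_norm2_add_le[OF Ld' Ld(2)])
    also have "\<dots> \<le> 2 * D j + 2 * E j"
      using dd by (simp add: D_def E_def d_def e_def norm_minus_commute)
    finally show "(\<integral>\<omega>. (norm (J' j \<omega> - K j \<omega>))\<^sup>2 \<partial>M) \<le> 2 * D j + 2 * E j" .
  qed simp
  then have "L2_tendsto M (\<lambda>j \<omega>. J' j \<omega> - K j \<omega>) (\<lambda>_. 0)"
    using LJ' Lb by (simp add: L2_tendsto_def L2_diff L2_zero)
  from L2_tendsto_inner[OF L2_tendsto_const[OF L\<eta>] this]
  have 1: "(\<lambda>j. \<integral>\<omega>. \<eta> \<omega> \<bullet> (J' j \<omega> - K j \<omega>) \<partial>M) \<longlonglongrightarrow> 0" by simp
  have 2: "(\<integral>\<omega>. \<eta> \<omega> \<bullet> (J j \<omega> - K j \<omega>) \<partial>M) = (\<integral>\<omega>. \<eta> \<omega> \<bullet> (J' j \<omega> - K j \<omega>) \<partial>M)" for j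
    using J'(2)[OF \<eta>, of j] integrable_inner_L2[OF L\<eta> La(2)[of j]] integrable_inner_L2[OF L\<eta> LJ'(2)[of j]]
      integrable_inner_L2[OF L\<eta> Lb(2)[of j]] by (simp add: inner_diff_right)
  have "(\<lambda>j. \<integral>\<omega>. \<eta> \<omega> \<bullet> (J j \<omega> - K j \<omega>) \<partial>M) \<longlonglongrightarrow> (\<integral>\<omega>. \<eta> \<omega> \<bullet> (It \<omega> - Is \<omega>) \<partial>M)"
    by (rule L2_tendsto_inner[OF L2_tendsto_const[OF L\<eta>] L2_tendsto_diff[OF a(3) b(3)]])
  then have "(\<integral>\<omega>. \<eta> \<omega> \<bullet> (It \<omega> - Is \<omega>) \<partial>M) = 0" using 1 unfolding 2 by (rule LIMSEQ_unique)
  then show ?thesis using integrable_inner_L2[OF L\<eta> LI(1)] integrable_inner_L2[OF L\<eta> LI(2)]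
    by (simp add: inner_diff_right)
qed

section \<open>Second moments of solutions\<close>

text \<open>
  Let \<open>I\<close> be the Ito integral over the whole interval \<open>[0, t]\<close> and \<open>Y\<^sub>s = x + \<integral> b\<close> the drift part up to time
  \<open>s\<close>. The path \<open>Z\<^sub>s = Y\<^sub>s + I\<close> is differentiable, starts at \<open>x + I\<close> and ends at \<open>X\<^sub>t\<close>, so
  \<open>X\<^sub>t \<bullet> P X\<^sub>t = (x + I) \<bullet> P (x + I) + \<integral> 2 b\<^sub>s \<bullet> P Z\<^sub>s ds\<close>. The expectation of the first term is given by the isometry
  and the vanishing mean of \<open>I\<close>. In the second term \<open>b\<^sub>s\<close> belongs to the past of \<open>s\<close>, so \<open>I\<close> may be replaced by
  the integral up to \<open>s\<close>, that is \<open>Z\<^sub>s\<close> by \<open>X\<^sub>s\<close>.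
\<close>
lemma second_moment_identity:
  fixes A C P :: "real^'n^'n" and X :: "real \<Rightarrow> 'w \<Rightarrow> real^'n"
  assumes sol: "linear_sde_solution M F W A C x X" and P: "transpose P = P" and t: "0 \<le> t"
  shows "L2 M (X t)"
    "(\<integral>\<omega>. X t \<omega> \<bullet> (P *v X t \<omega>) \<partial>M) = x \<bullet> (P *v x)
      + (\<integral>p. truncate t X p \<bullet> (lyapunov_op A C P *v truncate t X p) \<partial>LM)"
proof -
  interpret LMP: pair_sigma_finite lborel M by (rule pair_sigma_finite_LM)
  define b where "b = (\<lambda>s \<omega>. A *v X s \<omega>)"
  have adm: "admissible M F X" and cont: "AE \<omega> in M. continuous_on {0..} (\<lambda>t. X t \<omega>)"
    and ito: "\<And>t. 0 \<le> t \<Longrightarrow> \<exists>I. has_ito_integral M F W (\<lambda>t \<omega>. C *v X t \<omega>) t I \<and>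
        (AE \<omega> in M. X t \<omega> = x + (LINT s:{0..t}|lborel. b s \<omega>) + I \<omega>)"
    using sol by (auto simp: linear_sde_solution_def ito_process_def b_def)
  define xt where "xt = truncate t X"
  define bt where "bt = (\<lambda>p. A *v xt p)"
  have Lx: "L2 LM xt" using admissible_L2[OF adm t] by (simp add: xt_def)
  have Lb: "L2 LM bt" unfolding bt_def by (rule L2_bounded_linear[OF bounded_linear_matrix Lx])
  have bt_eq: "bt (s, \<omega>) = indicator {0..t} s *\<^sub>R b s \<omega>" for s \<omega>
    by (simp add: bt_def xt_def truncate_def b_def indicator_def)
  have [measurable]: "bt \<in> borel_measurable LM" "xt \<in> borel_measurable LM"
    using Lb Lx by (auto simp: L2_def)
  \<comment> \<open>written with the globally measurable \<open>bt\<close>, so that \<open>Y\<close> is jointly measurable in time and randomness\<close>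
  define Y where "Y = (\<lambda>s \<omega>. x + (\<integral>r. (if 0 \<le> r \<and> r \<le> s then bt (r, \<omega>) else 0) \<partial>lborel))"
  have Y_eq: "Y s \<omega> = x + (LINT r:{0..s}|lborel. b r \<omega>)" if "s \<le> t" for s \<omega>
  proof -
    have "(if 0 \<le> r \<and> r \<le> s then bt (r, \<omega>) else 0) = indicator {0..s} r *\<^sub>R b r \<omega>" for r
      using that by (auto simp: bt_eq indicator_def)
    then show ?thesis by (simp add: Y_def set_lebesgue_integral_def)
  qed
  have Y_meas [measurable]: "(\<lambda>(s, \<omega>). Y s \<omega>) \<in> borel_measurable LM"
    unfolding Y_def by measurable
  have Ys_meas [measurable]: "Y s \<in> borel_measurable M" for s
    unfolding Y_def by measurable
  \<comment> \<open>a square-integrable majorant of the drift part, uniform in time\<close>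
  define D where "D = (\<lambda>\<omega>. \<integral>r. (norm (bt (r, \<omega>)))\<^sup>2 \<partial>lborel)"
  have bt2: "integrable LM (case_prod (\<lambda>r \<omega>. (norm (bt (r, \<omega>)))\<^sup>2))"
    using L2_integrable_norm2[OF Lb] by (simp add: case_prod_unfold)
  have D_int: "integrable M D" unfolding D_def by (rule LMP.integrable_snd[OF bt2])
  have Y_bound: "AE \<omega> in M. \<forall>s. 0 \<le> s \<longrightarrow> s \<le> t \<longrightarrow> (norm (Y s \<omega>))\<^sup>2 \<le> 2 * (norm x)\<^sup>2 + 2 * (t * D \<omega>)"
    using LMP.AE_integrable_snd[OF bt2] AE_space
  proof eventually_elim
    case (elim \<omega>)
    have L: "L2 lborel (\<lambda>r. bt (r, \<omega>))" using elim by (auto simp: L2_def)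
    show ?case
    proof (intro allI impI)
      fix s assume s: "0 \<le> s" "s \<le> t"
      have D0: "0 \<le> D \<omega>" by (simp add: D_def)
      have "(norm (\<integral>r. indicator {0..s} r *\<^sub>R bt (r, \<omega>) \<partial>lborel))\<^sup>2 \<le> s * D \<omega>"
        unfolding D_def by (rule norm_integral_interval_square_le[OF L s(1)])
      also have "\<dots> \<le> t * D \<omega>" using s D0 by (intro mult_right_mono) auto
      finally have "(norm (\<integral>r. indicator {0..s} r *\<^sub>R bt (r, \<omega>) \<partial>lborel))\<^sup>2 \<le> t * D \<omega>" .
      moreover have "Y s \<omega> = x + (\<integral>r. indicator {0..s} r *\<^sub>R bt (r, \<omega>) \<partial>lborel)"
        unfolding Y_def by (intro arg_cong2[where f="(+)"] refl Bochner_Integration.integral_cong) (auto simp: indicator_def)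
      ultimately show "(norm (Y s \<omega>))\<^sup>2 \<le> 2 * (norm x)\<^sup>2 + 2 * (t * D \<omega>)"
        using norm_add_square_le[of x "\<integral>r. indicator {0..s} r *\<^sub>R bt (r, \<omega>) \<partial>lborel"] by simp
    qed
  qed
  have LY: "L2 M (Y s)" if "0 \<le> s" "s \<le> t" for s
  proof (rule L2_dominated_AE)
    show "integrable M (\<lambda>\<omega>. 2 * (norm x)\<^sup>2 + 2 * (t * D \<omega>))" using D_int by simp
    show "AE \<omega> in M. (norm (Y s \<omega>))\<^sup>2 \<le> 2 * (norm x)\<^sup>2 + 2 * (t * D \<omega>)"
      using Y_bound by eventually_elim (use that in blast)
  qed fact
  obtain I where I: "has_ito_integral M F W (\<lambda>t \<omega>. C *v X t \<omega>) t I"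
    and XI: "AE \<omega> in M. X t \<omega> = x + (LINT s:{0..t}|lborel. b s \<omega>) + I \<omega>" using ito[OF t] by blast
  have LI: "L2 M I" by (rule ito_integral_L2[OF I t])
  have [measurable]: "I \<in> borel_measurable M" using LI by (simp add: L2_def)
  have X_meas: "X s \<in> borel_measurable (F s)" if "0 \<le> s" for s by (rule admissible_measurable_F[OF adm that])
  have LX_all: "L2F s (X s)" if s: "0 \<le> s" "s \<le> t" for s
  proof -
    obtain J where J: "has_ito_integral M F W (\<lambda>t \<omega>. C *v X t \<omega>) s J"
      and XJ: "AE \<omega> in M. X s \<omega> = x + (LINT s:{0..s}|lborel. b s \<omega>) + J \<omega>" using ito[OF s(1)] by blast
    have LYJ: "L2 M (\<lambda>\<omega>. Y s \<omega> + J \<omega>)" by (intro L2_add LY s ito_integral_L2[OF J s(1)])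
    have "AE \<omega> in M. (norm (X s \<omega>))\<^sup>2 \<le> (norm (Y s \<omega> + J \<omega>))\<^sup>2"
      using XJ by eventually_elim (use s in \<open>simp add: Y_eq\<close>)
    then have "L2 M (X s)"
      by (rule L2_dominated_AE[OF measurable_F_imp_M[OF s(1) X_meas[OF s(1)]] L2_integrable_norm2[OF LYJ]])
    then show ?thesis using X_meas[OF s(1)] by (simp add: L2F_def)
  qed
  show LX: "L2 M (X t)" using LX_all[OF t] by (simp add: L2F_def)
  define Z where "Z = (\<lambda>s \<omega>. Y s \<omega> + I \<omega>)"
  define zt where "zt = (\<lambda>(s, \<omega>). indicator {0..t} s *\<^sub>R (P *v Z s \<omega>))"
  have PM: "(\<lambda>v. P *v v) \<in> borel_measurable borel"
    by (intro borel_measurable_continuous_onI linear_continuous_on bounded_linear_matrix)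
  have "(\<lambda>p. Y (fst p) (snd p) + I (snd p)) \<in> borel_measurable LM"
    using Y_meas by (intro borel_measurable_add) (auto simp: case_prod_unfold)
  from measurable_compose[OF this PM]
  have [measurable]: "(\<lambda>p. P *v Z (fst p) (snd p)) \<in> borel_measurable LM" by (simp add: Z_def)
  have zt_meas [measurable]: "zt \<in> borel_measurable LM"
    unfolding zt_def case_prod_unfold by measurable
  have Lz: "L2 LM zt"
  proof (rule L2_dominated_AE)
    let ?k = "(onorm ((*v) P))\<^sup>2"
    define g where "g = (\<lambda>\<omega>. ?k * (2 * (2 * (norm x)\<^sup>2 + 2 * (t * D \<omega>)) + 2 * (norm (I \<omega>))\<^sup>2))"
    have g_int: "integrable M g" using D_int L2_integrable_norm2[OF LI] by (simp add: g_def)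
    note [measurable] = borel_measurable_integrable[OF g_int]
    have ti: "integrable lborel (indicat_real {0..t})" using t by (intro integrable_real_indicator) auto
    show "integrable LM (\<lambda>(s, \<omega>). indicat_real {0..t} s * g \<omega>)"
      by (rule integral_LM_product(1)[OF g_int ti])
    have "AE p in LM. (norm (zt p))\<^sup>2 \<le> indicat_real {0..t} (fst p) * g (snd p)"
    proof (rule LMP.AE_pair_measure)
      show "{p \<in> space LM. (norm (zt p))\<^sup>2 \<le> indicat_real {0..t} (fst p) * g (snd p)} \<in> sets LM"
        by measurable
      show "AE s in lborel. AE \<omega> in M. (norm (zt (s, \<omega>)))\<^sup>2 \<le> indicat_real {0..t} (fst (s, \<omega>)) * g (snd (s, \<omega>))"
      proof (rule AE_I2)
        fix s :: real
        show "AE \<omega> in M. (norm (zt (s, \<omega>)))\<^sup>2 \<le> indicat_real {0..t} (fst (s, \<omega>)) * g (snd (s, \<omega>))"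
          using Y_bound
        proof eventually_elim
          case (elim \<omega>)
          show ?case
          proof (cases "s \<in> {0..t}")
            case True
            have "norm (P *v Z s \<omega>) \<le> onorm ((*v) P) * norm (Z s \<omega>)" by (rule onorm[OF bounded_linear_matrix])
            then have "(norm (P *v Z s \<omega>))\<^sup>2 \<le> ?k * (norm (Z s \<omega>))\<^sup>2"
              unfolding power_mult_distrib[symmetric] by (intro power_mono) auto
            also have "\<dots> \<le> ?k * (2 * (norm (Y s \<omega>))\<^sup>2 + 2 * (norm (I \<omega>))\<^sup>2)"
              unfolding Z_def by (intro mult_left_mono norm_add_square_le) auto
            also have "\<dots> \<le> g \<omega>" using elim True unfolding g_def by (intro mult_left_mono) auto
            finally show ?thesis using True by (simp add: zt_def)
          qed (simp add: zt_def)
        qed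
      qed
    qed
    then show "AE p in LM. (norm (zt p))\<^sup>2 \<le> (case p of (s, \<omega>) \<Rightarrow> indicat_real {0..t} s * g \<omega>)"
      by (simp add: case_prod_unfold)
  qed fact
  have int_bz: "integrable LM (\<lambda>p. bt p \<bullet> zt p)" by (rule integrable_inner_L2[OF Lb Lz])
  have int_bx: "integrable LM (\<lambda>p. bt p \<bullet> (P *v xt p))"
    by (rule integrable_inner_L2[OF Lb L2_bounded_linear[OF bounded_linear_matrix Lx]])
  have path: "AE \<omega> in M. X t \<omega> \<bullet> (P *v X t \<omega>) = (x + I \<omega>) \<bullet> (P *v (x + I \<omega>)) + (\<integral>s. 2 * (bt (s, \<omega>) \<bullet> zt (s, \<omega>)) \<partial>lborel)"
    using cont XI
  proof eventually_elim
    case (elim \<omega>)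
    have "continuous_on {0..t} (\<lambda>s. X s \<omega>)" by (rule continuous_on_subset[OF elim(1)]) auto
    then have "continuous_on {0..t} (\<lambda>s. b s \<omega>)"
      unfolding b_def by (rule linear_continuous_on_compose[OF _ bounded_linear.linear[OF bounded_linear_matrix]])
    note q = quadratic_form_along_primitive[OF this t P, of "x + I \<omega>"]
    have "x + I \<omega> + (LINT r:{0..t}|lborel. b r \<omega>) = X t \<omega>" using elim(2) by simp
    note * = q[unfolded this]
    have "indicator {0..t} s *\<^sub>R (2 * (b s \<omega> \<bullet> (P *v (x + I \<omega> + (LINT r:{0..s}|lborel. b r \<omega>))))) =
        2 * (bt (s, \<omega>) \<bullet> zt (s, \<omega>))" for s
    proof (cases "s \<in> {0..t}")
      case True
      then have "Z s \<omega> = x + I \<omega> + (LINT r:{0..s}|lborel. b r \<omega>)" by (simp add: Z_def Y_eq)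
      then show ?thesis using True by (simp add: bt_eq zt_def)
    qed (simp add: bt_eq)
    then show ?case using * by (simp only:)
  qed
  have int_bz': "integrable LM (case_prod (\<lambda>s \<omega>. 2 * (bt (s, \<omega>) \<bullet> zt (s, \<omega>))))"
    using int_bz by (simp add: case_prod_unfold)
  have LPI: "L2 M (\<lambda>\<omega>. P *v I \<omega>)" by (rule L2_bounded_linear[OF bounded_linear_matrix LI])
  have start: "(\<integral>\<omega>. (x + I \<omega>) \<bullet> (P *v (x + I \<omega>)) \<partial>M) = x \<bullet> (P *v x) + (\<integral>p. (C *v xt p) \<bullet> (P *v (C *v xt p)) \<partial>LM)"
    and int_start: "integrable M (\<lambda>\<omega>. (x + I \<omega>) \<bullet> (P *v (x + I \<omega>)))"
  proof -
    have e: "(x + I \<omega>) \<bullet> (P *v (x + I \<omega>)) = x \<bullet> (P *v x) + 2 * ((P *v x) \<bullet> I \<omega>) + I \<omega> \<bullet> (P *v I \<omega>)" for \<omega>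
      using inner_matrix_vector(2)[of x P "I \<omega>"] P
      by (simp add: matrix_vector_right_distrib inner_add_left inner_add_right inner_commute[of "I \<omega>" "P *v x"])
    have i: "integrable M (\<lambda>\<omega>. (P *v x) \<bullet> I \<omega>)" "integrable M (\<lambda>\<omega>. I \<omega> \<bullet> (P *v I \<omega>))"
      using integrable_inner_L2[OF L2F_D(1)[OF L2F_const[of 0]] LI] integrable_inner_L2[OF LI LPI] by auto
    show "integrable M (\<lambda>\<omega>. (x + I \<omega>) \<bullet> (P *v (x + I \<omega>)))" unfolding e using i by simp
    have tr: "truncate t (\<lambda>t \<omega>. C *v X t \<omega>) p = C *v xt p" for p
      by (auto simp: truncate_def xt_def indicator_def split: prod.split)
    have "(\<integral>\<omega>. I \<omega> \<bullet> (P *v I \<omega>) \<partial>M) = (\<integral>p. (C *v xt p) \<bullet> (P *v (C *v xt p)) \<partial>LM)"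
      using ito_isometry[OF I t bounded_linear_matrix[of P]] by (simp add: tr)
    then show "(\<integral>\<omega>. (x + I \<omega>) \<bullet> (P *v (x + I \<omega>)) \<partial>M) = x \<bullet> (P *v x) + (\<integral>p. (C *v xt p) \<bullet> (P *v (C *v xt p)) \<partial>LM)"
      unfolding e using i ito_integral_mean_zero[OF I t, of "P *v x"] by (simp add: prob_space)
  qed
  \<comment> \<open>here \<open>I\<close>, the integral up to \<open>t\<close>, is exchanged for \<open>J\<close>, the integral up to \<open>s\<close>\<close>
  have slice: "(\<integral>\<omega>. bt (s, \<omega>) \<bullet> zt (s, \<omega>) \<partial>M) = (\<integral>\<omega>. bt (s, \<omega>) \<bullet> (P *v xt (s, \<omega>)) \<partial>M)" for s
  proof (cases "s \<in> {0..t}")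
    case True
    then have s: "0 \<le> s" "s \<le> t" by auto
    obtain J where J: "has_ito_integral M F W (\<lambda>t \<omega>. C *v X t \<omega>) s J"
      and XJ: "AE \<omega> in M. X s \<omega> = x + (LINT s:{0..s}|lborel. b s \<omega>) + J \<omega>" using ito[OF s(1)] by blast
    have LJ: "L2 M J" by (rule ito_integral_L2[OF J s(1)])
    define \<eta> where "\<eta> = (\<lambda>\<omega>. P *v b s \<omega>)"
    have \<eta>: "L2F s \<eta>" unfolding \<eta>_def b_def by (intro L2F_bounded_linear[OF bounded_linear_matrix] LX_all s)
    have adj: "b s \<omega> \<bullet> (P *v v) = \<eta> \<omega> \<bullet> v" for \<omega> v
      using inner_matrix_vector(2)[of "b s \<omega>" P v] P by (simp add: \<eta>_def)
    have i: "integrable M (\<lambda>\<omega>. \<eta> \<omega> \<bullet> Y s \<omega>)" "integrable M (\<lambda>\<omega>. \<eta> \<omega> \<bullet> I \<omega>)" "integrable M (\<lambda>\<omega>. \<eta> \<omega> \<bullet> J \<omega>)"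
      by (intro integrable_inner_L2 L2F_D(1)[OF \<eta>] LY s LI LJ)+
    have "(\<integral>\<omega>. bt (s, \<omega>) \<bullet> zt (s, \<omega>) \<partial>M) = (\<integral>\<omega>. \<eta> \<omega> \<bullet> Y s \<omega> + \<eta> \<omega> \<bullet> I \<omega> \<partial>M)"
      using True by (simp add: bt_eq zt_def adj Z_def inner_add_right)
    also have "\<dots> = (\<integral>\<omega>. \<eta> \<omega> \<bullet> Y s \<omega> + \<eta> \<omega> \<bullet> J \<omega> \<partial>M)"
      using i ito_integral_orthogonal_past[OF I J s \<eta>] by simp
    also have "\<dots> = (\<integral>\<omega>. bt (s, \<omega>) \<bullet> (P *v xt (s, \<omega>)) \<partial>M)"
    proof (rule integral_cong_AE)
      have [measurable]: "X s \<in> borel_measurable M" "\<eta> \<in> borel_measurable M" "J \<in> borel_measurable M" "b s \<in> borel_measurable M"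
        using LX_all[OF s] \<eta> LJ L2F_bounded_linear[OF bounded_linear_matrix[of A] LX_all[OF s]]
        by (auto simp: L2F_def L2_def b_def)
      show "(\<lambda>\<omega>. \<eta> \<omega> \<bullet> Y s \<omega> + \<eta> \<omega> \<bullet> J \<omega>) \<in> borel_measurable M" by measurable
      have "(\<lambda>\<omega>. \<eta> \<omega> \<bullet> X s \<omega>) \<in> borel_measurable M" by measurable
      then show "(\<lambda>\<omega>. bt (s, \<omega>) \<bullet> (P *v xt (s, \<omega>))) \<in> borel_measurable M"
        using True by (simp add: bt_eq xt_def truncate_def adj)
      show "AE \<omega> in M. \<eta> \<omega> \<bullet> Y s \<omega> + \<eta> \<omega> \<bullet> J \<omega> = bt (s, \<omega>) \<bullet> (P *v xt (s, \<omega>))"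
        using XJ by eventually_elim (use True in \<open>simp add: bt_eq xt_def truncate_def adj Y_eq inner_add_right\<close>)
    qed
    finally show ?thesis .
  qed (simp add: bt_eq)
  have cross: "(\<integral>p. bt p \<bullet> zt p \<partial>LM) = (\<integral>p. bt p \<bullet> (P *v xt p) \<partial>LM)"
    unfolding LMP.integral_fst'[OF int_bz, symmetric] LMP.integral_fst'[OF int_bx, symmetric]
    by (simp only: slice)
  have "(\<integral>\<omega>. X t \<omega> \<bullet> (P *v X t \<omega>) \<partial>M) =
      (\<integral>\<omega>. (x + I \<omega>) \<bullet> (P *v (x + I \<omega>)) + (\<integral>s. 2 * (bt (s, \<omega>) \<bullet> zt (s, \<omega>)) \<partial>lborel) \<partial>M)"
  proof (rule integral_cong_AE[OF _ _ path])
    show "(\<lambda>\<omega>. X t \<omega> \<bullet> (P *v X t \<omega>)) \<in> borel_measurable M"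
      using integrable_inner_L2[OF LX L2_bounded_linear[OF bounded_linear_matrix LX]] by blast
    show "(\<lambda>\<omega>. (x + I \<omega>) \<bullet> (P *v (x + I \<omega>)) + (\<integral>s. 2 * (bt (s, \<omega>) \<bullet> zt (s, \<omega>)) \<partial>lborel)) \<in> borel_measurable M"
      using int_start LMP.integrable_snd[OF int_bz'] by (intro borel_measurable_add) auto
  qed
  also have "\<dots> = (\<integral>\<omega>. (x + I \<omega>) \<bullet> (P *v (x + I \<omega>)) \<partial>M) + (\<integral>p. 2 * (bt p \<bullet> zt p) \<partial>LM)"
    using int_start LMP.integrable_snd[OF int_bz'] LMP.integral_snd[OF int_bz']
    by (subst Bochner_Integration.integral_add) (auto simp: case_prod_unfold)
  also have "\<dots> = x \<bullet> (P *v x) + ((\<integral>p. 2 * (bt p \<bullet> (P *v xt p)) \<partial>LM) + (\<integral>p. (C *v xt p) \<bullet> (P *v (C *v xt p)) \<partial>LM))"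
    unfolding start using cross by simp
  also have "(\<integral>p. 2 * (bt p \<bullet> (P *v xt p)) \<partial>LM) + (\<integral>p. (C *v xt p) \<bullet> (P *v (C *v xt p)) \<partial>LM) =
      (\<integral>p. 2 * (bt p \<bullet> (P *v xt p)) + (C *v xt p) \<bullet> (P *v (C *v xt p)) \<partial>LM)"
    using int_bx by (intro Bochner_Integration.integral_add[symmetric] integrable_inner_L2
        L2_bounded_linear[OF bounded_linear_matrix] Lx) auto
  also have "\<dots> = (\<integral>p. xt p \<bullet> (lyapunov_op A C P *v xt p) \<partial>LM)"
    by (simp add: lyapunov_op_quadratic_form[OF P] bt_def inner_commute)
  finally show "(\<integral>\<omega>. X t \<omega> \<bullet> (P *v X t \<omega>) \<partial>M) = x \<bullet> (P *v x)
      + (\<integral>p. truncate t X p \<bullet> (lyapunov_op A C P *v truncate t X p) \<partial>LM)" by (simp add: xt_def)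
qed

section \<open>Euler sums and a maximal inequality\<close>

definition grid :: "real \<Rightarrow> nat \<Rightarrow> real" where "grid \<delta> i = real i * \<delta>"

lemma grid_nonneg: "0 \<le> \<delta> \<Longrightarrow> 0 \<le> grid \<delta> i"
  and grid_mono: "0 \<le> \<delta> \<Longrightarrow> i \<le> j \<Longrightarrow> grid \<delta> i \<le> grid \<delta> j"
  by (auto simp: grid_def intro: mult_right_mono)

text \<open>
  The discrete analogue of \<open>\<integral> A g ds + \<integral> C g dW\<close>. The Euler scheme, its increments and its differences between two
  grids all have this form, so that a single estimate and a single maximal inequality cover them.
\<close>
definition euler_sum :: "real^'n^'n \<Rightarrow> real^'n^'n \<Rightarrow> real \<Rightarrow> (nat \<Rightarrow> 'w \<Rightarrow> real^'n) \<Rightarrow> nat \<Rightarrow> 'w \<Rightarrow> real^'n" where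
  "euler_sum A C \<delta> g n \<omega> = (\<Sum>i<n. \<delta> *\<^sub>R (A *v g i \<omega>) + dW (grid \<delta> i) (grid \<delta> (Suc i)) \<omega> *\<^sub>R (C *v g i \<omega>))"

lemma euler_sum_Suc:
  "euler_sum A C \<delta> g (Suc n) \<omega> = euler_sum A C \<delta> g n \<omega> +
    (\<delta> *\<^sub>R (A *v g n \<omega>) + dW (grid \<delta> n) (grid \<delta> (Suc n)) \<omega> *\<^sub>R (C *v g n \<omega>))"
  by (simp add: euler_sum_def)

lemma euler_sum_0 [simp]: "euler_sum A C \<delta> g 0 \<omega> = 0"
  by (simp add: euler_sum_def)

lemma euler_sum_diff:
  "euler_sum A C \<delta> f n \<omega> - euler_sum A C \<delta> g n \<omega> = euler_sum A C \<delta> (\<lambda>i \<omega>. f i \<omega> - g i \<omega>) n \<omega>"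
  by (simp add: euler_sum_def sum_subtractf[symmetric] matrix_vector_mult_diff_distrib algebra_simps)

lemma L2F_matrix: "L2F t f \<Longrightarrow> L2F t (\<lambda>\<omega>. (A :: real^'n^'m) *v f \<omega>)"
  by (rule L2F_bounded_linear[OF bounded_linear_matrix])

lemma L2F_euler_sum:
  assumes \<delta>: "0 \<le> \<delta>" and g: "\<And>i. i < n \<Longrightarrow> L2F (grid \<delta> i) (g i)"
  shows "L2F (grid \<delta> n) (euler_sum A C \<delta> g n)"
  using g
proof (induction n)
  case 0
  show ?case using L2F_const[of "grid \<delta> 0" "0 :: real^'n"] by (simp add: euler_sum_0[abs_def])
next
  case (Suc n)
  have s: "0 \<le> grid \<delta> n" "grid \<delta> n \<le> grid \<delta> (Suc n)" using \<delta> by (auto intro: grid_nonneg grid_mono)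
  have "L2F (grid \<delta> (Suc n)) (euler_sum A C \<delta> g n)"
    by (rule L2F_mono[OF Suc.IH s]) (use Suc.prems in auto)
  moreover have "L2F (grid \<delta> (Suc n)) (\<lambda>\<omega>. \<delta> *\<^sub>R (A *v g n \<omega>))"
    by (rule L2F_mono[OF _ s]) (intro L2F_scaleR L2F_matrix Suc.prems, simp)
  moreover have "L2F (grid \<delta> (Suc n)) (\<lambda>\<omega>. dW (grid \<delta> n) (grid \<delta> (Suc n)) \<omega> *\<^sub>R (C *v g n \<omega>))"
    by (rule dW_scaleR[OF s]) (intro L2F_matrix Suc.prems, simp)
  ultimately show ?case unfolding euler_sum_Suc[abs_def] by (intro L2F_add)
qed

definition euler_const :: "real^'n^'n \<Rightarrow> real^'n^'n \<Rightarrow> real \<Rightarrow> real" where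
  "euler_const A C T = 2 * T * (onorm ((*v) A))\<^sup>2 + 2 * (onorm ((*v) C))\<^sup>2"

lemma euler_const_nonneg: "0 \<le> T \<Longrightarrow> 0 \<le> euler_const A C T"
  by (simp add: euler_const_def)

lemma norm_matrix_square_le: "(norm (A *v v))\<^sup>2 \<le> (onorm ((*v) A))\<^sup>2 * (norm v)\<^sup>2" for A :: "real^'n^'m"
  unfolding power_mult_distrib[symmetric] by (intro power_mono onorm[OF bounded_linear_matrix]) simp

text \<open>
  The drift part is estimated by Cauchy-Schwarz, the noise part by orthogonality of its increments.
\<close>
lemma euler_sum_L2_bound:
  fixes g :: "nat \<Rightarrow> 'w \<Rightarrow> real^'n"
  assumes \<delta>: "0 \<le> \<delta>" and g: "\<And>i. i < n \<Longrightarrow> L2F (grid \<delta> i) (g i)" and T: "grid \<delta> n \<le> T"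
  shows "(\<integral>\<omega>. (norm (euler_sum A C \<delta> g n \<omega>))\<^sup>2 \<partial>M) \<le>
    euler_const A C T * \<delta> * (\<Sum>i<n. \<integral>\<omega>. (norm (g i \<omega>))\<^sup>2 \<partial>M)"
proof -
  define G where "G = (\<Sum>i<n. \<integral>\<omega>. (norm (g i \<omega>))\<^sup>2 \<partial>M)"
  let ?a = "(onorm ((*v) A))\<^sup>2" and ?c = "(onorm ((*v) C))\<^sup>2"
  have G0: "0 \<le> G" by (simp add: G_def sum_nonneg)
  have Lg: "L2 M (g i)" if "i < n" for i using g[OF that] L2F_D by blast
  define D where "D = (\<lambda>\<omega>. euler_sum A 0 \<delta> g n \<omega>)"
  define N where "N = (\<lambda>m \<omega>. euler_sum 0 C \<delta> g m \<omega>)"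
  have LN: "L2F (grid \<delta> m) (N m)" if "m \<le> n" for m
    unfolding N_def using that by (intro L2F_euler_sum \<delta> g) auto
  have LD: "L2 M D" unfolding D_def using L2F_D(1)[OF L2F_euler_sum[OF \<delta> g]] by simp
  have split: "euler_sum A C \<delta> g n \<omega> = D \<omega> + N n \<omega>" for \<omega>
    by (simp add: D_def N_def euler_sum_def sum.distrib)
  have Dsq: "(norm (D \<omega>))\<^sup>2 \<le> real n * \<delta>\<^sup>2 * ?a * (\<Sum>i<n. (norm (g i \<omega>))\<^sup>2)" for \<omega>
  proof -
    have "norm (D \<omega>) \<le> (\<Sum>i<n. norm (\<delta> *\<^sub>R (A *v g i \<omega>)))"
      unfolding D_def euler_sum_def by (simp only: matrix_vector_mult_0 scaleR_zero_right add_0_right) (rule norm_sum)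
    then have "(norm (D \<omega>))\<^sup>2 \<le> (\<Sum>i<n. norm (\<delta> *\<^sub>R (A *v g i \<omega>)))\<^sup>2" by (intro power_mono) auto
    also have "\<dots> \<le> (\<Sum>i<n. (norm (\<delta> *\<^sub>R (A *v g i \<omega>)))\<^sup>2) * real (card {..<n})"
      by (rule sum_squared_le_sum_of_squares)
    also have "\<dots> \<le> (\<Sum>i<n. \<delta>\<^sup>2 * (?a * (norm (g i \<omega>))\<^sup>2)) * real (card {..<n})"
      by (intro mult_right_mono sum_mono) (auto simp: power_mult_distrib norm_matrix_square_le intro!: mult_left_mono)
    finally show ?thesis by (simp add: sum_distrib_left mult_ac)
  qed
  have "(\<integral>\<omega>. (norm (D \<omega>))\<^sup>2 \<partial>M) \<le> (\<integral>\<omega>. real n * \<delta>\<^sup>2 * ?a * (\<Sum>i<n. (norm (g i \<omega>))\<^sup>2) \<partial>M)"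
    using LD Lg by (intro integral_mono Dsq) (auto simp: L2_def)
  also have "\<dots> = real n * \<delta>\<^sup>2 * ?a * G"
    using Lg by (simp add: L2_def G_def)
  also have "\<dots> = grid \<delta> n * (\<delta> * ?a * G)" by (simp add: grid_def power2_eq_square mult_ac)
  also have "\<dots> \<le> T * (\<delta> * ?a * G)" using T \<delta> G0 by (intro mult_right_mono) auto
  finally have D: "(\<integral>\<omega>. (norm (D \<omega>))\<^sup>2 \<partial>M) \<le> T * (\<delta> * ?a * G)" .
  have N: "(\<integral>\<omega>. (norm (N m \<omega>))\<^sup>2 \<partial>M) \<le> \<delta> * ?c * (\<Sum>i<m. \<integral>\<omega>. (norm (g i \<omega>))\<^sup>2 \<partial>M)" if "m \<le> n" for m
    using that
  proof (induction m)
    case (Suc m)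
    then have m: "m < n" by simp
    have s: "0 \<le> grid \<delta> m" "grid \<delta> m \<le> grid \<delta> (Suc m)" using \<delta> by (auto intro: grid_nonneg grid_mono)
    define v where "v = (\<lambda>\<omega>. dW (grid \<delta> m) (grid \<delta> (Suc m)) \<omega> *\<^sub>R (C *v g m \<omega>))"
    have LC: "L2F (grid \<delta> m) (\<lambda>\<omega>. C *v g m \<omega>)" by (intro L2F_matrix g m)
    have Lv: "L2 M v" unfolding v_def using dW_scaleR[OF s LC] L2F_D by blast
    have LNm: "L2F (grid \<delta> m) (N m)" using m by (intro LN) auto
    note i = integrable_inner_L2[OF L2F_D(1)[OF LNm] Lv] L2_integrable_norm2[OF Lv] L2_integrable_norm2[OF L2F_D(1)[OF LNm]]
    have "(\<integral>\<omega>. (norm (N (Suc m) \<omega>))\<^sup>2 \<partial>M) = (\<integral>\<omega>. (norm (N m \<omega>))\<^sup>2 + (norm (v \<omega>))\<^sup>2 + 2 * (N m \<omega> \<bullet> v \<omega>) \<partial>M)"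
    proof -
      have "N (Suc m) \<omega> = N m \<omega> + v \<omega>" for \<omega> by (simp add: N_def v_def euler_sum_Suc)
      then show ?thesis
        by (simp add: power2_norm_eq_inner inner_add_left inner_add_right inner_commute[of "v _" "N m _"] add_ac)
    qed
    also have "\<dots> = (\<integral>\<omega>. (norm (N m \<omega>))\<^sup>2 \<partial>M) + (\<integral>\<omega>. (norm (v \<omega>))\<^sup>2 \<partial>M) + 2 * (\<integral>\<omega>. N m \<omega> \<bullet> v \<omega> \<partial>M)"
      using i by simp
    also have "(\<integral>\<omega>. N m \<omega> \<bullet> v \<omega> \<partial>M) = 0" unfolding v_def by (rule dW_orthogonal[OF s LC LNm])
    also have "(\<integral>\<omega>. (norm (v \<omega>))\<^sup>2 \<partial>M) = \<delta> * (\<integral>\<omega>. (norm (C *v g m \<omega>))\<^sup>2 \<partial>M)"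
    proof -
      have "grid \<delta> (Suc m) - grid \<delta> m = \<delta>" by (simp add: grid_def algebra_simps)
      then show ?thesis using dW_isometry[OF s LC LC] by (simp only: v_def power2_norm_eq_inner)
    qed
    also have "\<dots> \<le> \<delta> * (?c * (\<integral>\<omega>. (norm (g m \<omega>))\<^sup>2 \<partial>M))"
      using \<delta> by (intro mult_left_mono integral_norm2_bounded_linear_le bounded_linear_matrix Lg m)
    finally show ?case using Suc by (simp add: algebra_simps)
  qed (simp add: N_def)
  have "(\<integral>\<omega>. (norm (euler_sum A C \<delta> g n \<omega>))\<^sup>2 \<partial>M) \<le> 2 * (\<integral>\<omega>. (norm (D \<omega>))\<^sup>2 \<partial>M) + 2 * (\<integral>\<omega>. (norm (N n \<omega>))\<^sup>2 \<partial>M)"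
    unfolding split by (rule integral_norm2_add_le[OF LD L2F_D(1)[OF LN]]) simp
  also have "\<dots> \<le> 2 * (T * (\<delta> * ?a * G)) + 2 * (\<delta> * ?c * G)" using D N[of n] by (simp add: G_def)
  also have "\<dots> = euler_const A C T * \<delta> * G" by (simp add: euler_const_def algebra_simps)
  finally show ?thesis by (simp add: G_def)
qed

lemma prob_norm_ge_le:
  assumes "L2 M f" "0 < \<theta>"
  shows "prob {\<omega> \<in> space M. \<theta> \<le> norm (f \<omega>)} \<le> (\<integral>\<omega>. (norm (f \<omega>))\<^sup>2 \<partial>M) / \<theta>\<^sup>2"
proof -
  have "{\<omega> \<in> space M. \<theta> \<le> norm (f \<omega>)} = {\<omega> \<in> space M. \<theta>\<^sup>2 \<le> (norm (f \<omega>))\<^sup>2}"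
    using assms(2) power_mono[of \<theta> _ 2] power2_le_imp_le[of \<theta>] by (metis (no_types, lifting) less_imp_le norm_ge_zero)
  also have "prob \<dots> \<le> (\<integral>\<omega>. (norm (f \<omega>))\<^sup>2 \<partial>M) / \<theta>\<^sup>2"
    using integral_Markov_inequality_measure[of M "\<lambda>\<omega>. (norm (f \<omega>))\<^sup>2" "{}" "\<theta>\<^sup>2"] assms
    by (simp add: L2_def)
  finally show ?thesis .
qed

text \<open>
  Kolmogorov's argument by stopping. The integrand \<open>h\<close> agrees with \<open>g\<close> until the sum first exceeds \<open>\<theta>\<close> and is \<open>0\<close>
  afterwards, so the sum for \<open>h\<close> freezes at a value above \<open>\<theta>\<close>, and Markov's inequality for the final value
  suffices.
\<close>
lemma euler_sum_maximal:
  fixes g :: "nat \<Rightarrow> 'w \<Rightarrow> real^'n"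
  assumes \<delta>: "0 \<le> \<delta>" and g: "\<And>i. i < n \<Longrightarrow> L2F (grid \<delta> i) (g i)" and T: "grid \<delta> n \<le> T" "0 \<le> T" and \<theta>: "0 < \<theta>"
  shows "prob {\<omega> \<in> space M. \<exists>j\<le>n. \<theta> \<le> norm (euler_sum A C \<delta> g j \<omega>)} \<le>
    euler_const A C T * \<delta> * (\<Sum>i<n. \<integral>\<omega>. (norm (g i \<omega>))\<^sup>2 \<partial>M) / \<theta>\<^sup>2"
proof -
  let ?S = "euler_sum A C \<delta> g"
  define h where "h = (\<lambda>i \<omega>. if \<forall>j\<in>{..i}. norm (?S j \<omega>) < \<theta> then g i \<omega> else 0)"
  have h: "L2F (grid \<delta> i) (h i)" if i: "i < n" for i
  proof -
    have t: "0 \<le> grid \<delta> i" using \<delta> by (rule grid_nonneg)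
    have S: "{\<omega> \<in> space (F (grid \<delta> i)). norm (?S j \<omega>) < \<theta>} \<in> sets (F (grid \<delta> i))" if "j \<le> i" for j
    proof -
      have "L2F (grid \<delta> j) (?S j)" by (rule L2F_euler_sum[OF \<delta> g]) (use i that in simp)
      from L2F_D(2)[OF L2F_mono[OF this grid_nonneg[OF \<delta>] grid_mono[OF \<delta> that]]]
      have [measurable]: "?S j \<in> borel_measurable (F (grid \<delta> i))" .
      show ?thesis by measurable
    qed
    have "{\<omega> \<in> space (F (grid \<delta> i)). \<forall>j\<in>{..i}. norm (?S j \<omega>) < \<theta>} \<in> sets (F (grid \<delta> i))"
      by (rule sets.sets_Collect_finite_All') (simp_all add: S)
    then have m: "h i \<in> borel_measurable (F (grid \<delta> i))"
      unfolding h_def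
      by (intro measurable_If[where f="g i" and g="\<lambda>_. 0"] L2F_D(2)[OF g[OF i]] borel_measurable_const)
    have "L2 M (h i)"
      by (rule L2_dominated[OF measurable_F_imp_M[OF t m] L2_integrable_norm2[OF L2F_D(1)[OF g[OF i]]]])
        (simp add: h_def)
    with m show ?thesis by (simp add: L2F_def)
  qed
  \<comment> \<open>either the threshold has been passed and the stopped sum stays above it, or both sums still agree\<close>
  have stop: "(\<theta> \<le> norm (euler_sum A C \<delta> h k \<omega>) \<and> (\<exists>j<k. \<theta> \<le> norm (?S j \<omega>))) \<or>
      (euler_sum A C \<delta> h k \<omega> = ?S k \<omega> \<and> (\<forall>j<k. norm (?S j \<omega>) < \<theta>))" for k \<omega>
  proof (induction k)
    case (Suc k)
    consider "\<exists>j<k. \<theta> \<le> norm (?S j \<omega>)" | "\<forall>j<k. norm (?S j \<omega>) < \<theta>" "\<theta> \<le> norm (?S k \<omega>)"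
      | "\<forall>j\<le>k. norm (?S j \<omega>) < \<theta>"
      by (metis le_neq_implies_less not_less)
    then show ?case
    proof cases
      case 1
      then have "\<not> (\<forall>j\<in>{..k}. norm (?S j \<omega>) < \<theta>)" by (meson atMost_iff less_imp_le not_less)
      then have "h k \<omega> = 0" unfolding h_def by (rule if_not_P)
      moreover have "\<theta> \<le> norm (euler_sum A C \<delta> h k \<omega>)" using Suc 1 by (auto simp: not_less)
      ultimately show ?thesis using 1 by (auto simp: euler_sum_Suc intro: less_SucI)
    next
      case 2
      then have "\<not> (\<forall>j\<in>{..k}. norm (?S j \<omega>) < \<theta>)" by (meson atMost_iff order_refl not_less)
      then have "h k \<omega> = 0" unfolding h_def by (rule if_not_P)
      moreover have "euler_sum A C \<delta> h k \<omega> = ?S k \<omega>" using Suc 2(1) by (meson not_less)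
      ultimately show ?thesis using 2 by (auto simp: euler_sum_Suc)
    next
      case 3
      then have "h k \<omega> = g k \<omega>" by (simp add: h_def)
      moreover have "euler_sum A C \<delta> h k \<omega> = ?S k \<omega>" using Suc 3 by (meson not_less less_imp_le)
      ultimately show ?thesis using 3 by (simp add: euler_sum_Suc less_Suc_eq_le)
    qed
  qed simp
  have Lh: "L2 M (euler_sum A C \<delta> h n)" using L2F_D(1)[OF L2F_euler_sum[OF \<delta> h]] by blast
  have sub: "{\<omega> \<in> space M. \<exists>j\<le>n. \<theta> \<le> norm (?S j \<omega>)} \<subseteq> {\<omega> \<in> space M. \<theta> \<le> norm (euler_sum A C \<delta> h n \<omega>)}"
  proof safe
    fix \<omega> j assume "j \<le> n" "\<theta> \<le> norm (?S j \<omega>)"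
    then show "\<theta> \<le> norm (euler_sum A C \<delta> h n \<omega>)"
      using stop[of n \<omega>] by (metis le_neq_implies_less not_less)
  qed
  have [measurable]: "euler_sum A C \<delta> h n \<in> borel_measurable M" using Lh by (simp add: L2_def)
  have "prob {\<omega> \<in> space M. \<exists>j\<le>n. \<theta> \<le> norm (?S j \<omega>)} \<le> prob {\<omega> \<in> space M. \<theta> \<le> norm (euler_sum A C \<delta> h n \<omega>)}"
    by (rule finite_measure_mono[OF sub]) measurable
  also have "\<dots> \<le> (\<integral>\<omega>. (norm (euler_sum A C \<delta> h n \<omega>))\<^sup>2 \<partial>M) / \<theta>\<^sup>2" by (rule prob_norm_ge_le[OF Lh \<theta>])
  also have "\<dots> \<le> euler_const A C T * \<delta> * (\<Sum>i<n. \<integral>\<omega>. (norm (h i \<omega>))\<^sup>2 \<partial>M) / \<theta>\<^sup>2"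
    by (intro divide_right_mono euler_sum_L2_bound \<delta> h T) auto
  also have "\<dots> \<le> euler_const A C T * \<delta> * (\<Sum>i<n. \<integral>\<omega>. (norm (g i \<omega>))\<^sup>2 \<partial>M) / \<theta>\<^sup>2"
  proof (intro divide_right_mono mult_left_mono sum_mono)
    fix i assume "i \<in> {..<n}"
    then have "L2 M (h i)" "L2 M (g i)" using h[of i] g[of i] L2F_D(1) by auto
    then show "(\<integral>\<omega>. (norm (h i \<omega>))\<^sup>2 \<partial>M) \<le> (\<integral>\<omega>. (norm (g i \<omega>))\<^sup>2 \<partial>M)"
      by (intro integral_mono L2_integrable_norm2) (auto simp: h_def)
  qed (use \<delta> euler_const_nonneg[OF T(2), of A C] in auto)
  finally show ?thesis .
qed

section \<open>The Euler scheme and its refinements\<close>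

primrec euler :: "real^'n^'n \<Rightarrow> real^'n^'n \<Rightarrow> real^'n \<Rightarrow> real \<Rightarrow> nat \<Rightarrow> 'w \<Rightarrow> real^'n" where
  "euler A C x \<delta> 0 = (\<lambda>\<omega>. x)"
| "euler A C x \<delta> (Suc n) = (\<lambda>\<omega>. euler A C x \<delta> n \<omega> +
    (\<delta> *\<^sub>R (A *v euler A C x \<delta> n \<omega>) + dW (grid \<delta> n) (grid \<delta> (Suc n)) \<omega> *\<^sub>R (C *v euler A C x \<delta> n \<omega>)))"

lemma euler_eq_sum: "euler A C x \<delta> n \<omega> = x + euler_sum A C \<delta> (euler A C x \<delta>) n \<omega>"
  by (induction n) (simp_all add: euler_sum_Suc)

lemma L2F_euler: "0 \<le> \<delta> \<Longrightarrow> L2F (grid \<delta> n) (euler A C x \<delta> n)"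
proof (induction n rule: less_induct)
  case (less n)
  have "L2F (grid \<delta> n) (\<lambda>\<omega>. x + euler_sum A C \<delta> (euler A C x \<delta>) n \<omega>)"
    using less by (intro L2F_add L2F_const L2F_euler_sum) auto
  moreover have "euler A C x \<delta> n = (\<lambda>\<omega>. x + euler_sum A C \<delta> (euler A C x \<delta>) n \<omega>)"
    by (rule ext) (rule euler_eq_sum)
  ultimately show ?case by (simp only:)
qed

definition euler_bound :: "real^'n^'n \<Rightarrow> real^'n^'n \<Rightarrow> real^'n \<Rightarrow> real \<Rightarrow> real" where
  "euler_bound A C x T = 2 * (norm x)\<^sup>2 * exp (2 * euler_const A C T * T)"

lemma power_growth_le_exp:
  fixes k :: real
  assumes "0 \<le> k" "0 \<le> \<delta>" "grid \<delta> n \<le> T"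
  shows "(1 + 2 * (k * \<delta>)) ^ n \<le> exp (2 * k * T)"
proof -
  have "(1 + 2 * (k * \<delta>)) ^ n \<le> exp (2 * (k * \<delta>)) ^ n"
    using assms by (intro power_mono exp_ge_add_one_self) auto
  also have "\<dots> = exp (2 * k * grid \<delta> n)" by (simp add: exp_of_nat_mult[symmetric] grid_def mult_ac)
  also have "\<dots> \<le> exp (2 * k * T)" using assms by (auto intro: mult_left_mono)
  finally show ?thesis .
qed

lemma euler_L2_bound:
  assumes \<delta>: "0 \<le> \<delta>" and T: "grid \<delta> n \<le> T"
  shows "(\<integral>\<omega>. (norm (euler A C x \<delta> n \<omega>))\<^sup>2 \<partial>M) \<le> euler_bound A C x T"
proof -
  let ?E = "euler A C x \<delta>" and ?K = "euler_const A C T"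
  have T0: "0 \<le> T" using T grid_nonneg[OF \<delta>] order_trans by blast
  define a where "a = (\<lambda>m. \<integral>\<omega>. (norm (euler_sum A C \<delta> ?E m \<omega>))\<^sup>2 \<partial>M)"
  define b where "b = (\<lambda>m. \<integral>\<omega>. (norm (?E m \<omega>))\<^sup>2 \<partial>M)"
  have ba: "b m \<le> 2 * a m + 2 * (norm x)\<^sup>2" for m
  proof -
    have "b m = (\<integral>\<omega>. (norm (euler_sum A C \<delta> ?E m \<omega> + x))\<^sup>2 \<partial>M)"
      unfolding b_def by (subst euler_eq_sum) (simp add: add.commute)
    also have "\<dots> \<le> 2 * a m + 2 * (\<integral>\<omega>. (norm x)\<^sup>2 \<partial>M)"
      unfolding a_def by (intro integral_norm2_add_le L2F_D(1)[OF L2F_euler_sum[OF \<delta>]] L2F_euler \<delta> L2F_D(1)[OF L2F_const[of 0]])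
    finally show ?thesis by (simp add: prob_space)
  qed
  have "a n \<le> 2 * (norm x)\<^sup>2 / 2 * ((1 + 2 * (?K * \<delta>)) ^ n - 1)"
  proof (rule discrete_gronwall[where p="\<lambda>i. i" and b=b and N=n])
    show "a m \<le> ?K * \<delta> * (\<Sum>i<m. b i)" if "m \<le> n" for m
      unfolding a_def b_def using grid_mono[OF \<delta> that] T by (intro euler_sum_L2_bound \<delta> L2F_euler) auto
  qed (use ba euler_const_nonneg[OF T0, of A C] \<delta> in \<open>auto intro: mult_nonneg_nonneg\<close>)
  then have "b n \<le> 2 * (norm x)\<^sup>2 * (1 + 2 * (?K * \<delta>)) ^ n" using ba[of n] by (simp add: algebra_simps)
  also have "\<dots> \<le> 2 * (norm x)\<^sup>2 * exp (2 * ?K * T)"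
    by (intro mult_left_mono power_growth_le_exp euler_const_nonneg T0 \<delta> T) auto
  finally show ?thesis by (simp add: b_def euler_bound_def)
qed

lemma euler_bound_nonneg: "0 \<le> euler_bound A C x T"
  by (simp add: euler_bound_def)

lemma euler_increment_L2:
  assumes \<delta>: "0 \<le> \<delta>" and T: "grid \<delta> n \<le> T" and mn: "m \<le> n"
  shows "(\<integral>\<omega>. (norm (euler A C x \<delta> n \<omega> - euler A C x \<delta> m \<omega>))\<^sup>2 \<partial>M) \<le>
    euler_const A C T * euler_bound A C x T * (real (n - m) * \<delta>)"
proof -
  let ?E = "euler A C x \<delta>" and ?K = "euler_const A C T"
  have T0: "0 \<le> T" using T grid_nonneg[OF \<delta>] order_trans by blast
  \<comment> \<open>the increment is the Euler sum of the scheme switched on at step \<open>m\<close>\<close>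
  define g where "g = (\<lambda>i \<omega>. if m \<le> i then ?E i \<omega> else 0)"
  have g: "L2F (grid \<delta> i) (g i)" for i
    using L2F_euler[OF \<delta>, of i A C x] L2F_const[of "grid \<delta> i" "0 :: real^'n"] by (cases "m \<le> i") (simp_all add: g_def)
  have "euler_sum A C \<delta> g k \<omega> = ?E k \<omega> - ?E m \<omega>" if "m \<le> k" for k \<omega>
    using that
  proof (induction k rule: dec_induct)
    case base
    have "euler_sum A C \<delta> g m \<omega> = 0" by (simp add: euler_sum_def g_def)
    then show ?case by simp
  qed (simp add: euler_sum_Suc g_def)
  then have "(\<integral>\<omega>. (norm (?E n \<omega> - ?E m \<omega>))\<^sup>2 \<partial>M) = (\<integral>\<omega>. (norm (euler_sum A C \<delta> g n \<omega>))\<^sup>2 \<partial>M)"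
    using mn by simp
  also have "\<dots> \<le> ?K * \<delta> * (\<Sum>i<n. \<integral>\<omega>. (norm (g i \<omega>))\<^sup>2 \<partial>M)" by (rule euler_sum_L2_bound[OF \<delta> g T])
  also have "\<dots> \<le> ?K * \<delta> * (\<Sum>i<n. if m \<le> i then euler_bound A C x T else 0)"
  proof (intro mult_left_mono sum_mono)
    fix i assume "i \<in> {..<n}"
    then have "grid \<delta> i \<le> T" using grid_mono[OF \<delta>, of i n] T by simp
    then show "(\<integral>\<omega>. (norm (g i \<omega>))\<^sup>2 \<partial>M) \<le> (if m \<le> i then euler_bound A C x T else 0)"
      using euler_L2_bound[OF \<delta>, of i T A C x] by (cases "m \<le> i") (simp_all add: g_def)
  qed (use \<delta> euler_const_nonneg[OF T0, of A C] in auto)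
  also have "(\<Sum>i<n. if m \<le> i then euler_bound A C x T else 0) = (\<Sum>i\<in>{m..<n}. euler_bound A C x T)"
    by (rule sum.mono_neutral_cong_right) auto
  finally show ?thesis by (simp add: mult_ac)
qed

lemma L2F_euler_lagged:
  assumes \<delta>: "0 \<le> \<delta>" shows "L2F (grid \<delta> i) (euler A C x (real r * \<delta>) (i div r))"
proof -
  have "0 \<le> real r * \<delta>" using \<delta> by simp
  have "grid (real r * \<delta>) (i div r) \<le> grid \<delta> i"
  proof -
    have "real (i div r) * real r \<le> real i"
      by (metis div_times_less_eq_dividend of_nat_le_iff of_nat_mult)
    then have "(real (i div r) * real r) * \<delta> \<le> real i * \<delta>" using \<delta> by (rule mult_right_mono)
    then show ?thesis by (simp add: grid_def mult_ac)
  qed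
  then show ?thesis
    by (rule L2F_mono[OF L2F_euler[OF \<open>0 \<le> real r * \<delta>\<close>] grid_nonneg[OF \<open>0 \<le> real r * \<delta>\<close>]])
qed

text \<open>
  The scheme with step \<open>r \<delta>\<close>, seen on the grid with step \<open>\<delta>\<close>, freezes the coefficients at the last coarse grid
  point. Hence the difference of two schemes is an Euler sum of lagged differences.
\<close>
lemma coarse_euler_eq_sum:
  assumes r: "0 < r"
  shows "euler A C x (real r * \<delta>) k \<omega> =
    x + euler_sum A C \<delta> (\<lambda>i. euler A C x (real r * \<delta>) (i div r)) (r * k) \<omega>"
proof (induction k)
  case (Suc k)
  let ?c = "euler A C x (real r * \<delta>)" and ?g = "\<lambda>i. euler A C x (real r * \<delta>) (i div r)"
  have step: "euler_sum A C \<delta> ?g (r * k + j) \<omega> = euler_sum A C \<delta> ?g (r * k) \<omega> +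
     ((real j * \<delta>) *\<^sub>R (A *v ?c k \<omega>) + dW (grid \<delta> (r * k)) (grid \<delta> (r * k + j)) \<omega> *\<^sub>R (C *v ?c k \<omega>))"
    if "j \<le> r" for j
    using that
  proof (induction j)
    case (Suc j)
    then have "(r * k + j) div r = k" by simp
    then show ?case using Suc by (simp add: euler_sum_Suc dW_def algebra_simps)
  qed (simp add: dW_def)
  have "grid \<delta> (r * k) = grid (real r * \<delta>) k" "grid \<delta> (r * k + r) = grid (real r * \<delta>) (Suc k)"
    by (simp_all add: grid_def algebra_simps)
  then show ?case using step[of r] Suc by (simp add: add.commute[of r])
qed simp

definition euler_rate :: "real^'n^'n \<Rightarrow> real^'n^'n \<Rightarrow> real^'n \<Rightarrow> real \<Rightarrow> real" where
  "euler_rate A C x T = 2 * euler_const A C T * euler_bound A C x T * exp (2 * euler_const A C T * T)"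

lemma euler_rate_nonneg: "0 \<le> T \<Longrightarrow> 0 \<le> euler_rate A C x T"
  by (simp add: euler_rate_def euler_const_nonneg euler_bound_nonneg)

text \<open>
  The difference \<open>d\<close> at a fine grid point is the difference at the last coarse grid point \<open>p i\<close>, which is an Euler
  sum of \<open>d\<close>, plus an increment of the fine scheme over less than one coarse step. Gronwall's inequality with lag
  \<open>p\<close> then gives the rate.
\<close>
lemma euler_refinement_L2:
  assumes \<delta>: "0 \<le> \<delta>" and r: "0 < r" and T: "grid \<delta> n \<le> T"
  shows "(\<integral>\<omega>. (norm (euler A C x \<delta> n \<omega> - euler A C x (real r * \<delta>) (n div r) \<omega>))\<^sup>2 \<partial>M) \<le>
    euler_rate A C x T * (real r * \<delta>)"
proof -
  let ?E = "euler A C x \<delta>" and ?c = "euler A C x (real r * \<delta>)" and ?K = "euler_const A C T" and ?B = "euler_bound A C x T"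
  have T0: "0 \<le> T" using T grid_nonneg[OF \<delta>] order_trans by blast
  define d where "d = (\<lambda>i \<omega>. ?E i \<omega> - ?c (i div r) \<omega>)"
  define a where "a = (\<lambda>m. \<integral>\<omega>. (norm (euler_sum A C \<delta> d m \<omega>))\<^sup>2 \<partial>M)"
  define b where "b = (\<lambda>m. \<integral>\<omega>. (norm (d m \<omega>))\<^sup>2 \<partial>M)"
  define \<kappa> where "\<kappa> = 2 * (?K * ?B * (real r * \<delta>))"
  define p where "p = (\<lambda>i. r * (i div r))"
  have \<kappa>: "0 \<le> \<kappa>" using \<delta> by (simp add: \<kappa>_def euler_const_nonneg[OF T0] euler_bound_nonneg)
  have d: "L2F (grid \<delta> i) (d i)" for i
    unfolding d_def by (intro L2F_diff L2F_euler L2F_euler_lagged \<delta>)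
  have dd: "d i \<omega> = euler_sum A C \<delta> d (p i) \<omega> + (?E i \<omega> - ?E (p i) \<omega>)" for i \<omega>
  proof -
    have "euler_sum A C \<delta> d (p i) \<omega> = ?E (p i) \<omega> - ?c (i div r) \<omega>"
      unfolding p_def coarse_euler_eq_sum[OF r, of A C x \<delta> "i div r"] euler_eq_sum[of A C x \<delta> "r * (i div r)"]
      by (simp only: d_def euler_sum_diff[symmetric] add_diff_cancel_left)
    then show ?thesis by (simp add: d_def)
  qed
  have ba: "b i \<le> 2 * a (p i) + \<kappa>" if "i \<le> n" for i
  proof -
    have gi: "grid \<delta> i \<le> T" using grid_mono[OF \<delta> that] T by simp
    have L: "L2 M (euler_sum A C \<delta> d (p i))" "L2 M (\<lambda>\<omega>. ?E i \<omega> - ?E (p i) \<omega>)"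
      by (intro L2_diff L2F_D(1)[OF L2F_euler_sum[OF \<delta> d]] L2F_D(1)[OF L2F_euler[OF \<delta>]])+
    have "b i \<le> 2 * a (p i) + 2 * (\<integral>\<omega>. (norm (?E i \<omega> - ?E (p i) \<omega>))\<^sup>2 \<partial>M)"
      unfolding b_def a_def dd[of i] by (rule integral_norm2_add_le[OF L])
    also have "(\<integral>\<omega>. (norm (?E i \<omega> - ?E (p i) \<omega>))\<^sup>2 \<partial>M) \<le> ?K * ?B * (real (i - p i) * \<delta>)"
      by (rule euler_increment_L2[OF \<delta> gi]) (simp add: p_def)
    also have "\<dots> \<le> ?K * ?B * (real r * \<delta>)"
    proof -
      have "i - p i = i mod r" by (simp add: p_def minus_mult_div_eq_mod)
      then have "i - p i \<le> r" using r by (simp add: less_imp_le)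
      then show ?thesis using \<delta> euler_const_nonneg[OF T0, of A C] euler_bound_nonneg[of A C x T]
        by (intro mult_left_mono mult_right_mono) auto
    qed
    finally show ?thesis by (simp add: \<kappa>_def)
  qed
  have p: "p i \<le> i" for i by (simp add: p_def)
  have "a (p n) \<le> \<kappa> / 2 * ((1 + 2 * (?K * \<delta>)) ^ p n - 1)"
  proof (rule discrete_gronwall[where p=p and b=b and N=n])
    show "a m \<le> ?K * \<delta> * (\<Sum>i<m. b i)" if "m \<le> n" for m
      unfolding a_def b_def using grid_mono[OF \<delta> that] T by (intro euler_sum_L2_bound \<delta> d) auto
    show "0 \<le> ?K * \<delta>" by (rule mult_nonneg_nonneg[OF euler_const_nonneg[OF T0] \<delta>])
    show "b i \<le> 2 * a (p i) + \<kappa>" if "i < n" for i by (rule ba) (use that in simp)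
    show "p n \<le> n" "\<And>i. p i \<le> i" by (rule p)+
  qed (rule \<kappa>)
  then have "b n \<le> \<kappa> * (1 + 2 * (?K * \<delta>)) ^ p n" using ba[of n] by (simp add: algebra_simps)
  also have "\<dots> \<le> \<kappa> * exp (2 * ?K * T)"
    using grid_mono[OF \<delta> p, of n] T
    by (intro mult_left_mono power_growth_le_exp euler_const_nonneg T0 \<delta> \<kappa>) auto
  finally show ?thesis by (simp add: b_def d_def \<kappa>_def euler_rate_def mult_ac)
qed

lemma euler_refinement_maximal:
  assumes \<delta>: "0 \<le> \<delta>" and r: "0 < r" and T: "grid \<delta> (r * n) \<le> T" and \<theta>: "0 < \<theta>"
  shows "prob {\<omega> \<in> space M. \<exists>k\<le>n. \<theta> \<le> norm (euler A C x \<delta> (r * k) \<omega> - euler A C x (real r * \<delta>) k \<omega>)} \<le>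
    euler_const A C T * T * euler_rate A C x T * (real r * \<delta>) / \<theta>\<^sup>2"
proof -
  let ?E = "euler A C x \<delta>" and ?c = "euler A C x (real r * \<delta>)" and ?K = "euler_const A C T" and ?G = "euler_rate A C x T"
  have T0: "0 \<le> T" using T grid_nonneg[OF \<delta>] order_trans by blast
  define d where "d = (\<lambda>i \<omega>. ?E i \<omega> - ?c (i div r) \<omega>)"
  have d: "L2F (grid \<delta> i) (d i)" for i
    unfolding d_def by (intro L2F_diff L2F_euler L2F_euler_lagged \<delta>)
  have dd: "?E (r * k) \<omega> - ?c k \<omega> = euler_sum A C \<delta> d (r * k) \<omega>" for k \<omega>
    unfolding coarse_euler_eq_sum[OF r, of A C x \<delta> k] euler_eq_sum[of A C x \<delta> "r * k"]
    by (simp only: d_def euler_sum_diff[symmetric] add_diff_cancel_left)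
  have [measurable]: "euler_sum A C \<delta> d j \<in> borel_measurable M" for j
    using L2F_D(1)[OF L2F_euler_sum[OF \<delta> d]] by (auto simp: L2_def)
  have "prob {\<omega> \<in> space M. \<exists>k\<le>n. \<theta> \<le> norm (?E (r * k) \<omega> - ?c k \<omega>)} \<le>
      prob {\<omega> \<in> space M. \<exists>j\<le>r * n. \<theta> \<le> norm (euler_sum A C \<delta> d j \<omega>)}"
  proof (rule finite_measure_mono)
    show "{\<omega> \<in> space M. \<exists>k\<le>n. \<theta> \<le> norm (?E (r * k) \<omega> - ?c k \<omega>)} \<subseteq>
        {\<omega> \<in> space M. \<exists>j\<le>r * n. \<theta> \<le> norm (euler_sum A C \<delta> d j \<omega>)}"
      unfolding dd using r by (auto intro: mult_le_mono2)
    show "{\<omega> \<in> space M. \<exists>j\<le>r * n. \<theta> \<le> norm (euler_sum A C \<delta> d j \<omega>)} \<in> sets M" by measurable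
  qed
  also have "\<dots> \<le> ?K * \<delta> * (\<Sum>i<r * n. \<integral>\<omega>. (norm (d i \<omega>))\<^sup>2 \<partial>M) / \<theta>\<^sup>2"
    by (rule euler_sum_maximal[OF \<delta> d T T0 \<theta>])
  also have "\<dots> \<le> ?K * \<delta> * (\<Sum>i<r * n. ?G * (real r * \<delta>)) / \<theta>\<^sup>2"
  proof (intro divide_right_mono mult_left_mono sum_mono)
    fix i assume "i \<in> {..<r * n}"
    then have "grid \<delta> i \<le> T" using grid_mono[OF \<delta>, of i "r * n"] T by simp
    then show "(\<integral>\<omega>. (norm (d i \<omega>))\<^sup>2 \<partial>M) \<le> ?G * (real r * \<delta>)"
      unfolding d_def by (rule euler_refinement_L2[OF \<delta> r])
  qed (use \<delta> euler_const_nonneg[OF T0, of A C] in auto)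
  also have "\<dots> = ?K * grid \<delta> (r * n) * (?G * (real r * \<delta>)) / \<theta>\<^sup>2" by (simp add: grid_def mult_ac)
  also have "\<dots> \<le> ?K * T * (?G * (real r * \<delta>)) / \<theta>\<^sup>2"
    using T \<delta> euler_const_nonneg[OF T0, of A C] euler_rate_nonneg[OF T0, of A C x]
    by (intro divide_right_mono mult_right_mono mult_left_mono) auto
  finally show ?thesis by (simp add: mult_ac)
qed

lemma euler_maximal:
  assumes \<delta>: "0 \<le> \<delta>" and T: "grid \<delta> n \<le> T" and \<theta>: "0 < \<theta>"
  shows "prob {\<omega> \<in> space M. \<exists>k\<le>n. \<theta> \<le> norm (euler A C x \<delta> k \<omega> - x)} \<le>
    euler_const A C T * T * euler_bound A C x T / \<theta>\<^sup>2"
proof -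
  let ?E = "euler A C x \<delta>" and ?K = "euler_const A C T" and ?B = "euler_bound A C x T"
  have T0: "0 \<le> T" using T grid_nonneg[OF \<delta>] order_trans by blast
  have "prob {\<omega> \<in> space M. \<exists>k\<le>n. \<theta> \<le> norm (?E k \<omega> - x)} =
      prob {\<omega> \<in> space M. \<exists>k\<le>n. \<theta> \<le> norm (euler_sum A C \<delta> ?E k \<omega>)}"
    by (subst euler_eq_sum) simp
  also have "\<dots> \<le> ?K * \<delta> * (\<Sum>i<n. \<integral>\<omega>. (norm (?E i \<omega>))\<^sup>2 \<partial>M) / \<theta>\<^sup>2"
    by (rule euler_sum_maximal[OF \<delta> L2F_euler[OF \<delta>] T T0 \<theta>])
  also have "\<dots> \<le> ?K * \<delta> * (\<Sum>i<n. ?B) / \<theta>\<^sup>2"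
  proof (intro divide_right_mono mult_left_mono sum_mono)
    fix i assume "i \<in> {..<n}"
    then have "grid \<delta> i \<le> T" using grid_mono[OF \<delta>, of i n] T by simp
    then show "(\<integral>\<omega>. (norm (?E i \<omega>))\<^sup>2 \<partial>M) \<le> ?B" by (rule euler_L2_bound[OF \<delta>])
  qed (use \<delta> euler_const_nonneg[OF T0, of A C] in auto)
  also have "\<dots> = ?K * grid \<delta> n * ?B / \<theta>\<^sup>2" by (simp add: grid_def mult_ac)
  also have "\<dots> \<le> ?K * T * ?B / \<theta>\<^sup>2"
    using T euler_const_nonneg[OF T0, of A C] euler_bound_nonneg[of A C x T]
    by (intro divide_right_mono mult_right_mono mult_left_mono) auto
  finally show ?thesis .
qed

text \<open>
  Second moments would give a bound that does not tend to zero with \<open>\<delta>\<close>; fourth moments gain a factor \<open>\<delta>\<close>.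
\<close>
lemma dW_maximal:
  assumes \<delta>: "0 \<le> \<delta>" and T: "grid \<delta> n \<le> T" and \<theta>: "0 < \<theta>"
  shows "prob {\<omega> \<in> space M. \<exists>k<n. \<theta> \<le> \<bar>dW (grid \<delta> k) (grid \<delta> (Suc k)) \<omega>\<bar>} \<le> 3 * T * \<delta> / \<theta> ^ 4"
proof -
  let ?d = "\<lambda>k. dW (grid \<delta> k) (grid \<delta> (Suc k))"
  have s: "0 \<le> grid \<delta> k" "grid \<delta> k \<le> grid \<delta> (Suc k)" for k using \<delta> by (auto intro: grid_nonneg grid_mono)
  have [measurable]: "?d k \<in> borel_measurable M" for k by (rule dW_measurable[OF s])
  have one: "prob {\<omega> \<in> space M. \<theta> \<le> \<bar>?d k \<omega>\<bar>} \<le> 3 * \<delta>\<^sup>2 / \<theta> ^ 4" for k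
  proof -
    have "{\<omega> \<in> space M. \<theta> \<le> \<bar>?d k \<omega>\<bar>} \<subseteq> {\<omega> \<in> space M. \<theta> ^ 4 \<le> ?d k \<omega> ^ 4}"
    proof safe
      fix \<omega> assume "\<theta> \<le> \<bar>?d k \<omega>\<bar>"
      then have "\<theta> ^ 4 \<le> \<bar>?d k \<omega>\<bar> ^ 4" using \<theta> by (intro power_mono) auto
      then show "\<theta> ^ 4 \<le> ?d k \<omega> ^ 4" by simp
    qed
    then have "prob {\<omega> \<in> space M. \<theta> \<le> \<bar>?d k \<omega>\<bar>} \<le> prob {\<omega> \<in> space M. \<theta> ^ 4 \<le> ?d k \<omega> ^ 4}"
      by (rule finite_measure_mono) measurable
    also have "\<dots> \<le> (\<integral>\<omega>. ?d k \<omega> ^ 4 \<partial>M) / \<theta> ^ 4"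
      using integral_Markov_inequality_measure[of M "\<lambda>\<omega>. ?d k \<omega> ^ 4" "{}" "\<theta> ^ 4"] dW_moments(1)[OF s, of k 4] \<theta>
      by simp
    also have "\<dots> = 3 * \<delta>\<^sup>2 / \<theta> ^ 4" using dW_moments(4)[OF s, of k] by (simp add: grid_def algebra_simps)
    finally show ?thesis .
  qed
  have "{\<omega> \<in> space M. \<exists>k<n. \<theta> \<le> \<bar>?d k \<omega>\<bar>} = (\<Union>k\<in>{..<n}. {\<omega> \<in> space M. \<theta> \<le> \<bar>?d k \<omega>\<bar>})" by auto
  also have "prob \<dots> \<le> (\<Sum>k<n. prob {\<omega> \<in> space M. \<theta> \<le> \<bar>?d k \<omega>\<bar>})"
    by (intro finite_measure_subadditive_finite) auto
  also have "\<dots> \<le> (\<Sum>k<n. 3 * \<delta>\<^sup>2 / \<theta> ^ 4)" by (intro sum_mono one)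
  also have "\<dots> = 3 * grid \<delta> n * \<delta> / \<theta> ^ 4" by (simp add: grid_def power2_eq_square)
  also have "\<dots> \<le> 3 * T * \<delta> / \<theta> ^ 4" using T \<delta> \<theta> by (intro divide_right_mono mult_right_mono mult_left_mono) auto
  finally show ?thesis .
qed

section \<open>Convergence of the Euler scheme\<close>

lemma grid_dyadic_floor_le: "0 \<le> t \<Longrightarrow> grid (1 / 2 ^ n) (nat \<lfloor>t * 2 ^ n\<rfloor>) \<le> t"
proof -
  assume "0 \<le> t"
  then have "real (nat \<lfloor>t * 2 ^ n\<rfloor>) \<le> t * 2 ^ n" by simp
  then show ?thesis by (simp add: grid_def field_simps)
qed

text \<open>
  The scheme with step \<open>1 / 2 ^ n\<close>, frozen between grid points: an adapted path with jumps.
\<close>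
definition euler_path :: "real^'n^'n \<Rightarrow> real^'n^'n \<Rightarrow> real^'n \<Rightarrow> nat \<Rightarrow> real \<Rightarrow> 'w \<Rightarrow> real^'n" where
  "euler_path A C x n t = euler A C x (1 / 2 ^ n) (nat \<lfloor>t * 2 ^ n\<rfloor>)"

lemma L2F_euler_path: "0 \<le> t \<Longrightarrow> L2F t (euler_path A C x n t)"
  unfolding euler_path_def by (rule L2F_mono[OF L2F_euler grid_nonneg grid_dyadic_floor_le]) auto

lemma euler_path_L2_Cauchy:
  assumes t: "0 \<le> t" "t \<le> T" and nm: "n \<le> m"
  shows "(\<integral>\<omega>. (norm (euler_path A C x m t \<omega> - euler_path A C x n t \<omega>))\<^sup>2 \<partial>M) \<le> euler_rate A C x T / 2 ^ n"
proof -
  have "real (2 ^ (m - n)) * (1 / 2 ^ m) = 1 / 2 ^ n"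
  proof -
    have "(2::real) ^ (m - n) * 2 ^ n = 2 ^ m" using nm by (simp add: power_add[symmetric])
    then show ?thesis by (simp only: of_nat_power of_nat_numeral) (simp add: field_simps)
  qed
  moreover have "grid (1 / 2 ^ m) (nat \<lfloor>t * 2 ^ m\<rfloor>) \<le> T" using grid_dyadic_floor_le[OF t(1)] t(2) order_trans by blast
  ultimately show ?thesis
    using euler_refinement_L2[of "1 / 2 ^ m" "2 ^ (m - n)" "nat \<lfloor>t * 2 ^ m\<rfloor>" T A C x] nat_floor_dyadic[OF t(1) nm]
    by (simp add: euler_path_def)
qed

text \<open>
  With \<open>p ^ 16 = 1 / 2\<close> the step size of level \<open>n\<close> is \<open>p ^ (16 * n)\<close>. This leaves enough room to ask that the
  refinement differences stay below \<open>p ^ n\<close>, the scheme within \<open>1 / p ^ n\<close> of its start, and the Brownian increments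
  below \<open>p ^ (2 * n)\<close>: the three maximal inequalities bound the probability of failure by multiples of \<open>p ^ (14 * n)\<close>,
  \<open>p ^ (2 * n)\<close> and \<open>p ^ (8 * n)\<close>, which are summable, and the Borel-Cantelli lemma applies. The last two bounds give steps
  of order \<open>p ^ (2 * n) / p ^ n = p ^ n\<close>.
\<close>
lemma euler_eventually_small_steps:
  fixes A C :: "real^'n^'n" and N :: nat
  obtains p d where "0 < p" "p < 1" "0 \<le> d"
    "AE \<omega> in M. eventually (\<lambda>n. 
      (\<forall>k\<le>N * 2 ^ n. norm (euler A C x (1 / 2 ^ Suc n) (2 * k) \<omega> - euler A C x (1 / 2 ^ n) k \<omega>) \<le> p ^ n) \<and>
      (\<forall>k<N * 2 ^ n. norm (euler A C x (1 / 2 ^ n) (Suc k) \<omega> - euler A C x (1 / 2 ^ n) k \<omega>) \<le> d * p ^ n)) sequentially"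
proof -
  define p :: real where "p = root 16 (1 / 2)"
  have p: "0 < p" "p < 1" "p ^ 16 = 1 / 2" by (auto simp: p_def)
  define T where "T = real N"
  have T: "0 \<le> T" by (simp add: T_def)
  let ?a = "onorm ((*v) A)" and ?c = "onorm ((*v) C)"
  let ?K = "euler_const A C T" and ?G = "euler_rate A C x T" and ?B = "euler_bound A C x T"
  let ?E = "\<lambda>n. euler A C x (1 / 2 ^ n)"
  let ?dW = "\<lambda>n k. dW (grid (1 / 2 ^ n) k) (grid (1 / 2 ^ n) (Suc k))"
  define d where "d = (?a + ?c) * (norm x + 1)"
  have ac: "0 \<le> ?a" "0 \<le> ?c" by (auto intro: onorm_pos_le bounded_linear_matrix)
  have d: "0 \<le> d" using ac by (simp add: d_def)
  define B1 where "B1 = (\<lambda>n. {\<omega> \<in> space M. \<exists>k\<le>N * 2 ^ n. p ^ n \<le> norm (?E (Suc n) (2 * k) \<omega> - ?E n k \<omega>)})"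
  define B2 where "B2 = (\<lambda>n. {\<omega> \<in> space M. \<exists>k\<le>N * 2 ^ n. 1 / p ^ n \<le> norm (?E n k \<omega> - x)})"
  define B3 where "B3 = (\<lambda>n. {\<omega> \<in> space M. \<exists>k<N * 2 ^ n. (p ^ n)\<^sup>2 \<le> \<bar>?dW n k \<omega>\<bar>})"
  have [measurable]: "?E n k \<in> borel_measurable M" for n k
    using L2F_D(1)[OF L2F_euler[of "1 / 2 ^ n"]] by (auto simp: L2_def)
  have [measurable]: "?dW n k \<in> borel_measurable M" for n k
    by (intro dW_measurable grid_nonneg grid_mono) auto
  have sets: "B1 n \<in> sets M" "B2 n \<in> sets M" "B3 n \<in> sets M" for n
    unfolding B1_def B2_def B3_def by measurable
  define kk where "kk = ?K * T * ?G + ?K * T * ?B + 3 * T"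
  have nonneg: "0 \<le> ?K * T * ?G" "0 \<le> ?K * T * ?B"
    using T by (auto intro!: mult_nonneg_nonneg euler_const_nonneg euler_rate_nonneg euler_bound_nonneg)
  have bound: "prob (B1 n \<union> B2 n \<union> B3 n) \<le> kk * p ^ n" for n
  proof -
    define e where "e = p ^ n"
    have e: "0 < e" "e \<le> 1" using p by (auto simp: e_def power_le_one)
    have e16: "1 / 2 ^ n = e ^ 16"
      by (simp add: e_def power_mult[symmetric] mult.commute[of n]) (simp add: power_mult p power_divide)
    have ek: "e ^ k \<le> e" if "k \<ge> 1" for k using power_decreasing[of 1 k e] e that by simp
    have gN: "grid (1 / 2 ^ n) (N * 2 ^ n) \<le> T" "grid (1 / 2 ^ Suc n) (2 * (N * 2 ^ n)) \<le> T"
      by (simp_all add: grid_def T_def)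
    have "prob (B1 n) \<le> ?K * T * ?G * (e ^ 16 / e\<^sup>2)"
      using euler_refinement_maximal[OF _ _ gN(2) e(1), of A C x]
      unfolding B1_def e16[symmetric] by (simp add: e_def)
    also have "e ^ 16 / e\<^sup>2 = e ^ 14" using e by (simp add: divide_eq_eq power_add[symmetric])
    also have "?K * T * ?G * e ^ 14 \<le> ?K * T * ?G * e" by (intro mult_left_mono ek nonneg) simp
    finally have 1: "prob (B1 n) \<le> ?K * T * ?G * e" .
    have "prob (B2 n) \<le> ?K * T * ?B * e\<^sup>2"
      using euler_maximal[OF _ gN(1), of "1 / e" A C x] e
      unfolding B2_def by (simp add: e_def power_divide)
    also have "\<dots> \<le> ?K * T * ?B * e" by (intro mult_left_mono ek nonneg) simp
    finally have 2: "prob (B2 n) \<le> ?K * T * ?B * e" .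
    have "prob (B3 n) \<le> 3 * T * (e ^ 16 / (e\<^sup>2) ^ 4)"
      using dW_maximal[OF _ gN(1), of "e\<^sup>2"] e p(1)
      unfolding B3_def e16[symmetric] by (simp add: e_def)
    also have "e ^ 16 / (e\<^sup>2) ^ 4 = e ^ 8" using e by (simp add: divide_eq_eq power_add[symmetric] power_mult[symmetric])
    also have "3 * T * e ^ 8 \<le> 3 * T * e" using T by (intro mult_left_mono ek) auto
    finally have 3: "prob (B3 n) \<le> 3 * T * e" .
    have "prob (B1 n \<union> B2 n \<union> B3 n) \<le> prob (B1 n) + prob (B2 n) + prob (B3 n)"
      using measure_Un_le[of "B1 n \<union> B2 n" M "B3 n"] measure_Un_le[of "B1 n" M "B2 n"] sets[of n]
      by auto
    also have "\<dots> \<le> kk * e" using 1 2 3 by (simp add: kk_def algebra_simps)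
    finally show ?thesis by (simp add: e_def)
  qed
  have "summable (\<lambda>n. prob (B1 n \<union> B2 n \<union> B3 n))"
  proof (rule summable_comparison_test')
    show "summable (\<lambda>n. kk * p ^ n)" using p by (intro summable_mult summable_geometric) auto
    show "norm (prob (B1 n \<union> B2 n \<union> B3 n)) \<le> kk * p ^ n" if "n \<ge> 0" for n using bound[of n] by simp
  qed
  then have "AE \<omega> in M. eventually (\<lambda>n. \<omega> \<in> space M - (B1 n \<union> B2 n \<union> B3 n)) sequentially"
    using sets by (intro borel_cantelli_AE1) (auto simp: less_top[symmetric])
  then have "AE \<omega> in M. eventually (\<lambda>n. 
      (\<forall>k\<le>N * 2 ^ n. norm (?E (Suc n) (2 * k) \<omega> - ?E n k \<omega>) \<le> p ^ n) \<and>
      (\<forall>k<N * 2 ^ n. norm (?E n (Suc k) \<omega> - ?E n k \<omega>) \<le> d * p ^ n)) sequentially"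
  proof (eventually_elim)
    case (elim \<omega>)
    show ?case
      using elim
    proof eventually_elim
      case (elim n)
      define e where "e = p ^ n"
      have e: "0 < e" "e \<le> 1" using p by (auto simp: e_def power_le_one)
      have e16: "1 / 2 ^ n = e ^ 16"
        by (simp add: e_def power_mult[symmetric] mult.commute[of n]) (simp add: power_mult p power_divide)
      have n1: "norm (?E (Suc n) (2 * k) \<omega> - ?E n k \<omega>) < e" if "k \<le> N * 2 ^ n" for k
      proof -
        have "\<not> e \<le> norm (?E (Suc n) (2 * k) \<omega> - ?E n k \<omega>)"
          using elim that unfolding B1_def e_def by blast
        then show ?thesis by (simp only: not_le)
      qed
      have n2: "norm (?E n k \<omega> - x) < 1 / e" if "k \<le> N * 2 ^ n" for k
      proof -
        have "\<not> 1 / e \<le> norm (?E n k \<omega> - x)"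
          using elim that unfolding B2_def e_def by blast
        then show ?thesis by (simp only: not_le)
      qed
      have n3: "\<bar>?dW n k \<omega>\<bar> < e\<^sup>2" if "k < N * 2 ^ n" for k
      proof -
        have "\<not> e\<^sup>2 \<le> \<bar>?dW n k \<omega>\<bar>"
          using elim that unfolding B3_def e_def by blast
        then show ?thesis by (simp only: not_le)
      qed
      have "norm (?E n (Suc k) \<omega> - ?E n k \<omega>) \<le> d * e" if k: "k < N * 2 ^ n" for k
      proof -
        let ?v = "?E n k \<omega>"
        have "norm ?v \<le> norm x + norm (?v - x)" using norm_triangle_ineq[of x "?v - x"] by simp
        also have "\<dots> \<le> norm x * (1 / e) + 1 / e"
        proof -
          have "1 \<le> 1 / e" using e by simp
          then have "norm x * 1 \<le> norm x * (1 / e)" by (intro mult_left_mono) auto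
          then show ?thesis using n2[of k] k by simp
        qed
        finally have v: "norm ?v \<le> (norm x + 1) / e" by (simp add: add_divide_distrib)
        have "norm (?E n (Suc k) \<omega> - ?v) \<le> norm ((1 / 2 ^ n) *\<^sub>R (A *v ?v)) + norm (?dW n k \<omega> *\<^sub>R (C *v ?v))"
          by (simp add: norm_triangle_ineq del: norm_scaleR)
        also have "\<dots> \<le> e\<^sup>2 * (?a * norm ?v) + e\<^sup>2 * (?c * norm ?v)"
        proof -
          have "e ^ 16 \<le> e\<^sup>2" using e by (intro power_decreasing) auto
          moreover have "norm (A *v ?v) \<le> ?a * norm ?v" "norm (C *v ?v) \<le> ?c * norm ?v"
            by (auto intro: onorm bounded_linear_matrix)
          ultimately have "e ^ 16 * norm (A *v ?v) \<le> e\<^sup>2 * (?a * norm ?v)"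
            "\<bar>?dW n k \<omega>\<bar> * norm (C *v ?v) \<le> e\<^sup>2 * (?c * norm ?v)"
            using n3[OF k] by (intro mult_mono; simp)+
          then show ?thesis using e by (simp add: e16)
        qed
        also have "\<dots> = (?a + ?c) * e\<^sup>2 * norm ?v" by (simp add: algebra_simps)
        also have "\<dots> \<le> (?a + ?c) * e\<^sup>2 * ((norm x + 1) / e)" using ac v by (intro mult_left_mono) auto
        also have "\<dots> = d * e" using e by (simp add: d_def power2_eq_square)
        finally show ?thesis .
      qed
      then show ?case using n1 by (auto simp: e_def less_imp_le)
    qed
  qed
  with that p d show thesis by blast
qed

lemma euler_path_converges_on:
  fixes A C :: "real^'n^'n" and N :: nat
  shows "AE \<omega> in M. (\<forall>t\<in>{0..<real N}. convergent (\<lambda>n. euler_path A C x n t \<omega>)) \<and>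
    continuous_on {0..<real N} (\<lambda>t. lim (\<lambda>n. euler_path A C x n t \<omega>))"
proof -
  obtain p d where p: "0 < p" "p < 1" "0 \<le> d" and ae: "AE \<omega> in M. eventually (\<lambda>n. 
      (\<forall>k\<le>N * 2 ^ n. norm (euler A C x (1 / 2 ^ Suc n) (2 * k) \<omega> - euler A C x (1 / 2 ^ n) k \<omega>) \<le> p ^ n) \<and>
      (\<forall>k<N * 2 ^ n. norm (euler A C x (1 / 2 ^ n) (Suc k) \<omega> - euler A C x (1 / 2 ^ n) k \<omega>) \<le> d * p ^ n)) sequentially"
    using euler_eventually_small_steps[where A=A and C=C and x=x and N=N] by blast
  from ae show ?thesis
  proof eventually_elim
    case (elim \<omega>)
    let ?E = "\<lambda>n k. euler A C x (1 / 2 ^ n) k \<omega>"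
    let ?X = "\<lambda>n t. euler_path A C x n t \<omega>"
    from elim obtain n0 where
      fine: "\<And>n k. n \<ge> n0 \<Longrightarrow> k \<le> N * 2 ^ n \<Longrightarrow> norm (?E (Suc n) (2 * k) - ?E n k) \<le> p ^ n"
      and step: "\<And>n k. n \<ge> n0 \<Longrightarrow> k < N * 2 ^ n \<Longrightarrow> norm (?E n (Suc k) - ?E n k) \<le> d * p ^ n"
      unfolding eventually_sequentially by blast
    have idx: "nat \<lfloor>t * 2 ^ n\<rfloor> < N * 2 ^ n" if "t \<in> {0..<real N}" for t n
    proof -
      have "t * 2 ^ n < real N * 2 ^ n" using that by simp
      then have "\<lfloor>t * 2 ^ n\<rfloor> < int (N * 2 ^ n)" by (simp add: floor_less_iff)
      then show ?thesis using that by (simp add: nat_less_iff)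
    qed
    have conv_step: "norm (?X (Suc n) t - ?X n t) \<le> (d + 1) * p ^ n" if n: "n \<ge> n0" and t: "t \<in> {0..<real N}" for n t
    proof -
      define i where "i = nat \<lfloor>t * 2 ^ Suc n\<rfloor>"
      define k where "k = nat \<lfloor>t * 2 ^ n\<rfloor>"
      have k: "k = i div 2" using nat_floor_dyadic[of t n "Suc n"] t by (simp add: i_def k_def)
      have "norm (?E (Suc n) (2 * k) - ?E n k) \<le> p ^ n" using idx[OF t, of n] by (intro fine n) (simp add: k_def)
      moreover have "norm (?E (Suc n) i - ?E (Suc n) (2 * k)) \<le> d * p ^ n"
      proof (cases "even i")
        case True
        then have "i = 2 * k" by (simp add: k)
        then show ?thesis using p by simp
      next
        case False
        then have i: "i = Suc (2 * k)" by (simp add: k)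
        have "norm (?E (Suc n) (Suc (2 * k)) - ?E (Suc n) (2 * k)) \<le> d * p ^ Suc n"
          using idx[OF t, of "Suc n"] n i by (intro step) (auto simp: i_def)
        also have "\<dots> \<le> d * p ^ n" using p by (intro mult_left_mono power_decreasing) auto
        finally show ?thesis unfolding i .
      qed
      ultimately have "norm ((?E (Suc n) i - ?E (Suc n) (2 * k)) + (?E (Suc n) (2 * k) - ?E n k)) \<le> d * p ^ n + p ^ n"
        by (intro norm_triangle_le) auto
      then show ?thesis unfolding euler_path_def i_def[symmetric] k_def[symmetric] by (simp add: algebra_simps)
    qed
    \<comment> \<open>points closer than one step lie in the same cell or in adjacent ones\<close>
    have osc: "norm (?X n t - ?X n s) \<le> (d + 1) * p ^ n"
      if n: "n \<ge> n0" and s: "s \<in> {0..<real N}" and t: "t \<in> {0..<real N}" and st: "\<bar>t - s\<bar> < 1 / 2 ^ n" for n s t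
    proof -
      have le: "norm (?X n t - ?X n s) \<le> d * p ^ n" if "s \<le> t" "s \<in> {0..<real N}" "t \<in> {0..<real N}" "t - s < 1 / 2 ^ n" for s t
      proof -
        have "s * 2 ^ n \<le> t * 2 ^ n" "t * 2 ^ n < s * 2 ^ n + 1"
          using that by (auto simp: field_simps)
        then have "\<lfloor>t * 2 ^ n\<rfloor> = \<lfloor>s * 2 ^ n\<rfloor> \<or> \<lfloor>t * 2 ^ n\<rfloor> = \<lfloor>s * 2 ^ n\<rfloor> + 1" by linarith
        then have "nat \<lfloor>t * 2 ^ n\<rfloor> = nat \<lfloor>s * 2 ^ n\<rfloor> \<or> nat \<lfloor>t * 2 ^ n\<rfloor> = Suc (nat \<lfloor>s * 2 ^ n\<rfloor>)"
          using that by (auto simp: nat_add_distrib)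
        then show ?thesis
        proof
          assume "nat \<lfloor>t * 2 ^ n\<rfloor> = nat \<lfloor>s * 2 ^ n\<rfloor>"
          then show ?thesis using p by (simp add: euler_path_def)
        next
          assume "nat \<lfloor>t * 2 ^ n\<rfloor> = Suc (nat \<lfloor>s * 2 ^ n\<rfloor>)"
          then show ?thesis unfolding euler_path_def
            using step[OF n idx[of s n]] that by (simp only:)
        qed
      qed
      have "norm (?X n t - ?X n s) \<le> d * p ^ n"
        using le[of s t] le[of t s] s t st by (cases "s \<le> t") (auto simp: norm_minus_commute)
      also have "\<dots> \<le> (d + 1) * p ^ n" using p by (intro mult_right_mono) auto
      finally show ?thesis .
    qed
    show ?case
      using continuous_on_lim_of_geometric[where f="?X" and S="{0..<real N}" and d="d + 1", OF p(1,2) _ conv_step osc] p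
      by auto
  qed
qed

text \<open>
  As \<open>lim\<close> is a measurable function of the sequence even where it diverges, this process is adapted to the given filtration.
\<close>
definition euler_limit :: "real^'n^'n \<Rightarrow> real^'n^'n \<Rightarrow> real^'n \<Rightarrow> real \<Rightarrow> 'w \<Rightarrow> real^'n" where
  "euler_limit A C x t \<omega> = lim (\<lambda>n. euler_path A C x n t \<omega>)"

lemma euler_limit_continuous:
  "AE \<omega> in M. (\<forall>t\<ge>0. (\<lambda>n. euler_path A C x n t \<omega>) \<longlonglongrightarrow> euler_limit A C x t \<omega>) \<and>
    continuous_on {0..} (\<lambda>t. euler_limit A C x t \<omega>)"
proof -
  have "AE \<omega> in M. \<forall>N::nat. (\<forall>t\<in>{0..<real N}. convergent (\<lambda>n. euler_path A C x n t \<omega>)) \<and>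
    continuous_on {0..<real N} (\<lambda>t. lim (\<lambda>n. euler_path A C x n t \<omega>))"
    unfolding AE_all_countable using euler_path_converges_on by blast
  then show ?thesis
  proof eventually_elim
    case (elim \<omega>)
    have ex: "\<exists>N::nat. t < real N" for t :: real by (rule reals_Archimedean2)
    have "(\<lambda>n. euler_path A C x n t \<omega>) \<longlonglongrightarrow> euler_limit A C x t \<omega>" if "t \<ge> 0" for t
    proof -
      obtain N :: nat where "t < real N" using ex by blast
      then have "convergent (\<lambda>n. euler_path A C x n t \<omega>)" using elim that by auto
      then show ?thesis unfolding euler_limit_def by (simp add: convergent_LIMSEQ_iff)
    qed
    moreover have "continuous_on {0..} (\<lambda>t. euler_limit A C x t \<omega>)"
      unfolding continuous_on_eq_continuous_within
    proof
      fix t :: real assume t: "t \<in> {0..}"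
      obtain N :: nat where N: "t < real N" using ex by blast
      have "continuous (at t within {0..<real N}) (\<lambda>t. euler_limit A C x t \<omega>)"
        using elim t N unfolding continuous_on_eq_continuous_within euler_limit_def by auto
      moreover have "at t within {0..<real N} = at t within {0..}"
        by (rule at_within_nhd[of t "{..<real N}"]) (use N in auto)
      ultimately show "continuous (at t within {0..}) (\<lambda>t. euler_limit A C x t \<omega>)" by simp
    qed
    ultimately show ?case by blast
  qed
qed

lemma euler_limit_measurable_F:
  assumes "0 \<le> t" shows "euler_limit A C x t \<in> borel_measurable (F t)"
proof -
  have [measurable]: "euler_path A C x n t \<in> borel_measurable (F t)" for n
    using L2F_euler_path[OF assms] L2F_D by blast
  show ?thesis unfolding euler_limit_def[abs_def] by measurable
qed

text \<open>
  Fatou's lemma carries the Cauchy estimate over to the almost sure limit.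
\<close>
lemma euler_limit_L2:
  assumes t: "0 \<le> t" "t \<le> T"
  shows "L2F t (euler_limit A C x t)"
    "(\<integral>\<omega>. (norm (euler_path A C x n t \<omega> - euler_limit A C x t \<omega>))\<^sup>2 \<partial>M) \<le> euler_rate A C x T / 2 ^ n"
proof -
  let ?X = "\<lambda>n. euler_path A C x n t" and ?L = "euler_limit A C x t" and ?G = "euler_rate A C x T"
  have T0: "0 \<le> T" using t by simp
  have LX: "L2 M (?X m)" for m using L2F_euler_path[OF t(1)] L2F_D by blast
  have [measurable]: "?X m \<in> borel_measurable M" for m using LX by (auto simp: L2_def)
  have mL [measurable]: "?L \<in> borel_measurable M" by (rule measurable_F_imp_M[OF t(1) euler_limit_measurable_F[OF t(1)]])
  have fatou: "(\<integral>\<^sup>+\<omega>. ennreal ((norm (?X n \<omega> - ?L \<omega>))\<^sup>2) \<partial>M) \<le> ennreal (?G / 2 ^ n)" for n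
  proof -
    have "(\<integral>\<^sup>+\<omega>. ennreal ((norm (?X n \<omega> - ?L \<omega>))\<^sup>2) \<partial>M) =
        (\<integral>\<^sup>+\<omega>. liminf (\<lambda>m. ennreal ((norm (?X m \<omega> - ?X n \<omega>))\<^sup>2)) \<partial>M)"
    proof (rule nn_integral_cong_AE)
      show "AE \<omega> in M. ennreal ((norm (?X n \<omega> - ?L \<omega>))\<^sup>2) = liminf (\<lambda>m. ennreal ((norm (?X m \<omega> - ?X n \<omega>))\<^sup>2))"
        using euler_limit_continuous[of A C x]
      proof eventually_elim
        case (elim \<omega>)
        then have "(\<lambda>m. ?X m \<omega>) \<longlonglongrightarrow> ?L \<omega>" using t by blast
        then have "(\<lambda>m. ennreal ((norm (?X m \<omega> - ?X n \<omega>))\<^sup>2)) \<longlonglongrightarrow> ennreal ((norm (?L \<omega> - ?X n \<omega>))\<^sup>2)"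
          by (intro tendsto_ennrealI tendsto_intros)
        from lim_imp_Liminf[OF sequentially_bot this] show ?case by (simp only: norm_minus_commute)
      qed
    qed
    also have "\<dots> \<le> liminf (\<lambda>m. \<integral>\<^sup>+\<omega>. ennreal ((norm (?X m \<omega> - ?X n \<omega>))\<^sup>2) \<partial>M)"
      by (rule nn_integral_liminf) measurable
    also have "\<dots> \<le> liminf (\<lambda>m. ennreal (?G / 2 ^ n))"
    proof (rule Liminf_mono)
      show "\<forall>\<^sub>F m in sequentially. (\<integral>\<^sup>+\<omega>. ennreal ((norm (?X m \<omega> - ?X n \<omega>))\<^sup>2) \<partial>M) \<le> ennreal (?G / 2 ^ n)"
        using eventually_ge_at_top[of n]
      proof eventually_elim
        case (elim m)
        show ?case unfolding nn_integral_L2[OF L2_diff[OF LX LX]]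
          by (intro ennreal_leI euler_path_L2_Cauchy t elim)
      qed
    qed
    finally show ?thesis by (simp add: Liminf_const[OF sequentially_bot])
  qed
  have "L2 M (\<lambda>\<omega>. ?X n \<omega> - ?L \<omega>)" for n
    using fatou[of n] by (subst L2_iff_nn_integral) (auto intro: le_less_trans)
  note LD = this
  from L2_diff[OF LX LD, of 0 0] have "L2 M ?L" by simp
  then show "L2F t ?L" using euler_limit_measurable_F[OF t(1)] by (simp add: L2F_def)
  show "(\<integral>\<omega>. (norm (?X n \<omega> - ?L \<omega>))\<^sup>2 \<partial>M) \<le> ?G / 2 ^ n"
    using fatou[of n] euler_rate_nonneg[OF T0, of A C x] unfolding nn_integral_L2[OF LD] by simp
qed

text \<open>
  Up to time \<open>T\<close> the path is a finite sum of products of an indicator of time and a value at a grid time before \<open>T\<close>.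
\<close>
lemma euler_path_progressive: "progressively_measurable F (euler_path A C x n)"
  unfolding progressively_measurable_def
proof (intro allI impI)
  fix T :: real assume T: "0 \<le> T"
  define K where "K = nat \<lfloor>T * 2 ^ n\<rfloor>"
  have m: "euler A C x (1 / 2 ^ n) i \<in> borel_measurable (F T)" if "i \<in> {..K}" for i
  proof -
    have "grid (1 / 2 ^ n) i \<le> grid (1 / 2 ^ n) K" using that by (intro grid_mono) auto
    also have "\<dots> \<le> T" unfolding K_def by (rule grid_dyadic_floor_le[OF T])
    finally have "grid (1 / 2 ^ n) i \<le> T" .
    then show ?thesis
      using L2F_D(2)[OF L2F_mono[OF L2F_euler[of "1 / 2 ^ n" i A C x] grid_nonneg[of "1 / 2 ^ n" i]]] by simp
  qed
  let ?S = "restrict_space borel {0..T} \<Otimes>\<^sub>M F T"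
  have fst: "fst \<in> borel_measurable ?S"
    by (rule measurable_compose[OF measurable_fst measurable_restrict_space1[OF measurable_ident_sets[OF refl]]])
  let ?f = "\<lambda>p. \<Sum>i\<in>{..K}. indicat_real {grid (1 / 2 ^ n) i..<grid (1 / 2 ^ n) (Suc i)} (fst p) *\<^sub>R
      euler A C x (1 / 2 ^ n) i (snd p)"
  have mf: "?f \<in> borel_measurable ?S"
  proof (intro borel_measurable_sum borel_measurable_scaleR)
    fix i assume i: "i \<in> {..K}"
    show "(\<lambda>p. indicat_real {grid (1 / 2 ^ n) i..<grid (1 / 2 ^ n) (Suc i)} (fst p)) \<in> borel_measurable ?S"
      by (rule measurable_compose[OF fst]) simp
    show "(\<lambda>p. euler A C x (1 / 2 ^ n) i (snd p)) \<in> borel_measurable ?S"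
      by (rule measurable_compose[OF measurable_snd m[OF i]])
  qed
  have eq: "(\<lambda>(t, \<omega>). euler_path A C x n t \<omega>) p = ?f p" if "p \<in> space ?S" for p
  proof -
    obtain t \<omega> where p: "p = (t, \<omega>)" by (cases p)
    have t: "0 \<le> t" "t \<le> T" using that by (auto simp: p space_pair_measure space_restrict_space)
    define i0 where "i0 = nat \<lfloor>t * 2 ^ n\<rfloor>"
    have "i0 \<le> K" unfolding i0_def K_def using t by (intro nat_mono floor_mono mult_right_mono) auto
    moreover have "indicat_real {grid (1 / 2 ^ n) i..<grid (1 / 2 ^ n) (Suc i)} t = (if i = i0 then 1 else 0)" for i
    proof -
      have "grid (1 / 2 ^ n) i \<le> t \<and> t < grid (1 / 2 ^ n) (Suc i) \<longleftrightarrow> real i \<le> t * 2 ^ n \<and> t * 2 ^ n < real i + 1"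
        by (simp add: grid_def field_simps)
      also have "\<dots> \<longleftrightarrow> \<lfloor>t * 2 ^ n\<rfloor> = int i" by (auto simp: floor_eq_iff)
      also have "\<dots> \<longleftrightarrow> i = i0" using t(1) by (auto simp: i0_def)
      finally show ?thesis by (simp add: indicator_def)
    qed
    ultimately show ?thesis
      by (simp add: p euler_path_def i0_def[symmetric] if_distrib[of "\<lambda>c. c *\<^sub>R _"] sum.delta cong: if_cong)
  qed
  show "(\<lambda>(t, \<omega>). euler_path A C x n t \<omega>) \<in> borel_measurable ?S"
    by (rule measurable_cong[OF eq, THEN iffD2, OF _ mf])
qed

lemma euler_limit_progressive: "progressively_measurable F (euler_limit A C x)"
  unfolding progressively_measurable_def
proof (intro allI impI)
  fix T :: real assume T: "0 \<le> T"
  have "(\<lambda>p. (\<lambda>(t, \<omega>). euler_path A C x n t \<omega>) p) \<in> borel_measurable (restrict_space borel {0..T} \<Otimes>\<^sub>M F T)" for n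
    using euler_path_progressive[of A C x n] T by (auto simp: progressively_measurable_def)
  from borel_measurable_lim_metric[OF this]
  show "(\<lambda>(t, \<omega>). euler_limit A C x t \<omega>) \<in> borel_measurable (restrict_space borel {0..T} \<Otimes>\<^sub>M F T)"
    by (simp add: euler_limit_def case_prod_unfold)
qed

lemma mean_square_on_le:
  fixes \<phi> :: "real \<Rightarrow> 'w \<Rightarrow> 'b::euclidean_space"
  assumes m: "truncate T \<phi> \<in> borel_measurable LM" and T: "0 \<le> T"
    and le: "AE t in lborel. t \<in> {0..T} \<longrightarrow> (\<integral>\<^sup>+\<omega>. ennreal ((norm (\<phi> t \<omega>))\<^sup>2) \<partial>M) \<le> ennreal c"
  shows "mean_square_on M {0..T} \<phi> \<le> ennreal c * ennreal T"
proof -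
  note [measurable] = m
  have "mean_square_on M {0..T} \<phi> = (\<integral>\<^sup>+t. \<integral>\<^sup>+\<omega>. ennreal ((norm (truncate T \<phi> (t, \<omega>)))\<^sup>2) \<partial>M \<partial>lborel)"
    unfolding mean_square_on_LM[OF m] by (rule nn_integral_fst[symmetric]) measurable
  also have "\<dots> \<le> (\<integral>\<^sup>+t. ennreal c * indicator {0..T} t \<partial>lborel)"
  proof (rule nn_integral_mono_AE)
    show "AE t in lborel. (\<integral>\<^sup>+\<omega>. ennreal ((norm (truncate T \<phi> (t, \<omega>)))\<^sup>2) \<partial>M) \<le> ennreal c * indicator {0..T} t"
      using le
    proof eventually_elim
      case (elim t)
      then show ?case by (cases "t \<in> {0..T}") (simp_all add: truncate_def)
    qed
  qed
  also have "\<dots> = ennreal c * ennreal T" using T by (simp add: nn_integral_cmult)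
  finally show ?thesis .
qed

lemma euler_limit_admissible: "admissible M F (euler_limit A C x)"
  unfolding admissible_def
proof (intro conjI allI impI)
  show p: "progressively_measurable F (euler_limit A C x)" by (rule euler_limit_progressive)
  fix T :: real assume T: "0 \<le> T"
  let ?c = "2 * (euler_rate A C x T / 2 ^ 0) + 2 * euler_bound A C x T"
  have "mean_square_on M {0..T} (euler_limit A C x) \<le> ennreal ?c * ennreal T"
  proof (rule mean_square_on_le[OF progressive_truncate_measurable[OF p T] T], rule AE_I2, rule impI)
    fix t assume t: "t \<in> {0..T}"
    let ?X = "euler_path A C x 0 t" and ?L = "euler_limit A C x t"
    have L: "L2 M ?L" "L2 M ?X" using euler_limit_L2(1)[of t T A C x] L2F_euler_path[of t A C x 0] t L2F_D(1) by auto
    have "(\<integral>\<omega>. (norm (?L \<omega>))\<^sup>2 \<partial>M) = (\<integral>\<omega>. (norm ((?L \<omega> - ?X \<omega>) + ?X \<omega>))\<^sup>2 \<partial>M)" by simp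
    also have "\<dots> \<le> 2 * (\<integral>\<omega>. (norm (?L \<omega> - ?X \<omega>))\<^sup>2 \<partial>M) + 2 * (\<integral>\<omega>. (norm (?X \<omega>))\<^sup>2 \<partial>M)"
      by (rule integral_norm2_add_le[OF L2_diff[OF L] L(2)])
    also have "\<dots> \<le> ?c"
    proof (intro add_mono mult_left_mono)
      show "(\<integral>\<omega>. (norm (?L \<omega> - ?X \<omega>))\<^sup>2 \<partial>M) \<le> euler_rate A C x T / 2 ^ 0"
        using euler_limit_L2(2)[of t T A C x 0] t by (simp add: norm_minus_commute)
      show "(\<integral>\<omega>. (norm (?X \<omega>))\<^sup>2 \<partial>M) \<le> euler_bound A C x T"
        unfolding euler_path_def using grid_dyadic_floor_le[of t 0] t by (intro euler_L2_bound) auto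
    qed auto
    finally show "(\<integral>\<^sup>+\<omega>. ennreal ((norm (?L \<omega>))\<^sup>2) \<partial>M) \<le> ennreal ?c"
      unfolding nn_integral_L2[OF L(1)] by (rule ennreal_leI)
  qed
  then show "mean_square_on M {0..T} (euler_limit A C x) < \<infinity>"
    by (rule le_less_trans) (simp add: ennreal_mult_less_top)
qed

section \<open>The Euler limit solves the equation\<close>

lemma norm_integral_interval_L2:
  fixes u :: "real \<times> 'w \<Rightarrow> 'b::euclidean_space"
  assumes u: "L2 LM u" and t: "0 \<le> t"
  shows "L2 M (\<lambda>\<omega>. \<integral>s. indicator {0..t} s *\<^sub>R u (s, \<omega>) \<partial>lborel)"
    "(\<integral>\<omega>. (norm (\<integral>s. indicator {0..t} s *\<^sub>R u (s, \<omega>) \<partial>lborel))\<^sup>2 \<partial>M) \<le> t * (\<integral>p. (norm (u p))\<^sup>2 \<partial>LM)"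
proof -
  interpret LMP: pair_sigma_finite lborel M by (rule pair_sigma_finite_LM)
  have [measurable]: "u \<in> borel_measurable LM" using u by (simp add: L2_def)
  define Z where "Z = (\<lambda>\<omega>. \<integral>s. indicator {0..t} s *\<^sub>R u (s, \<omega>) \<partial>lborel)"
  define D where "D = (\<lambda>\<omega>. \<integral>r. (norm (u (r, \<omega>)))\<^sup>2 \<partial>lborel)"
  have u2: "integrable LM (case_prod (\<lambda>r \<omega>. (norm (u (r, \<omega>)))\<^sup>2))"
    using L2_integrable_norm2[OF u] by (simp add: case_prod_unfold)
  have D_int: "integrable M (\<lambda>\<omega>. t * D \<omega>)" unfolding D_def using LMP.integrable_snd[OF u2] by simp
  have meas: "Z \<in> borel_measurable M" unfolding Z_def by measurable
  have bound: "AE \<omega> in M. (norm (Z \<omega>))\<^sup>2 \<le> t * D \<omega>"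
    using LMP.AE_integrable_snd[OF u2] AE_space
  proof eventually_elim
    case (elim \<omega>)
    have "L2 lborel (\<lambda>r. u (r, \<omega>))" using elim by (auto simp: L2_def)
    then show ?case unfolding Z_def D_def by (rule norm_integral_interval_square_le[OF _ t])
  qed
  have L: "L2 M Z" by (rule L2_dominated_AE[OF meas D_int bound])
  then show "L2 M (\<lambda>\<omega>. \<integral>s. indicator {0..t} s *\<^sub>R u (s, \<omega>) \<partial>lborel)" by (simp only: Z_def)
  have "(\<integral>\<omega>. (norm (Z \<omega>))\<^sup>2 \<partial>M) \<le> (\<integral>\<omega>. t * D \<omega> \<partial>M)"
    by (rule integral_mono_AE[OF L2_integrable_norm2[OF L] D_int bound])
  also have "\<dots> = t * (\<integral>p. (norm (u p))\<^sup>2 \<partial>LM)"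
    using LMP.integral_snd[OF u2] by (simp add: D_def case_prod_unfold)
  finally show "(\<integral>\<omega>. (norm (\<integral>s. indicator {0..t} s *\<^sub>R u (s, \<omega>) \<partial>lborel))\<^sup>2 \<partial>M) \<le> t * (\<integral>p. (norm (u p))\<^sup>2 \<partial>LM)"
    by (simp only: Z_def)
qed

text \<open>
  The frozen scheme as a simple process on \<open>[0, t]\<close>: the grid is clipped at \<open>t\<close>, which need not be a grid point.
  Its intervals are open on the left whereas the scheme jumps at their left ends, so the two processes agree off
  the grid. The integral equation holds up to the contribution of the last, partial step, which the scheme at
  time \<open>t\<close> has not made yet.
\<close>
lemma clipped_euler_process:
  fixes A C :: "real^'n^'n" and x :: "real^'n" and j :: nat
  assumes t: "0 \<le> t"
  defines "k \<equiv> Suc (nat \<lfloor>t * 2 ^ j\<rfloor>)" and "\<tau> \<equiv> \<lambda>i. min (grid (1 / 2 ^ j) i) t" and "E \<equiv> euler A C x (1 / 2 ^ j)"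
  defines "\<psi> \<equiv> \<lambda>s \<omega>. \<Sum>i<k. indicator {\<tau> i<..\<tau> (Suc i)} s *\<^sub>R E i \<omega>"
  shows "simple_ito_integral M F W (\<lambda>s \<omega>. C *v \<psi> s \<omega>) t (\<lambda>\<omega>. \<Sum>i<k. dW (\<tau> i) (\<tau> (Suc i)) \<omega> *\<^sub>R (C *v E i \<omega>))"
    "\<And>s \<omega>. s \<in> {0..t} - range (grid (1 / 2 ^ j)) \<Longrightarrow> \<psi> s \<omega> = euler_path A C x j s \<omega>"
    "\<And>\<omega>. x + (LINT s:{0..t}|lborel. A *v \<psi> s \<omega>) + (\<Sum>i<k. dW (\<tau> i) (\<tau> (Suc i)) \<omega> *\<^sub>R (C *v E i \<omega>)) =
      euler_path A C x j t \<omega> + ((t - \<tau> (k - 1)) *\<^sub>R (A *v E (k - 1) \<omega>) + dW (\<tau> (k - 1)) t \<omega> *\<^sub>R (C *v E (k - 1) \<omega>))"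
    "\<And>\<omega>. set_integrable lborel {0..t} (\<lambda>s. A *v \<psi> s \<omega>)"
proof -
  let ?g = "grid (1 / 2 ^ j)"
  define q where "q = nat \<lfloor>t * 2 ^ j\<rfloor>"
  have kq: "k = Suc q" by (simp add: k_def q_def)
  have q: "real q \<le> t * 2 ^ j" "t * 2 ^ j < real q + 1" using t by (auto simp: q_def)
  have gq: "?g i \<le> t" if "i \<le> q" for i
  proof -
    have "real i \<le> t * 2 ^ j" using q(1) that by (meson of_nat_mono order_trans)
    then show ?thesis by (simp add: grid_def field_simps)
  qed
  have gk: "t < ?g (Suc q)" using q(2) by (simp add: grid_def field_simps)
  have \<tau>: "\<tau> i = ?g i" if "i \<le> q" for i using gq[OF that] by (simp add: \<tau>_def)
  have \<tau>k: "\<tau> (Suc q) = t" using gk by (simp add: \<tau>_def)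
  have \<tau>mono: "\<tau> i \<le> \<tau> (Suc i)" for i
    unfolding \<tau>_def by (intro min.mono grid_mono) auto
  have \<tau>0: "0 \<le> \<tau> i" for i using t by (simp add: \<tau>_def grid_nonneg)
  have \<tau>t: "\<tau> i \<le> t" for i by (simp add: \<tau>_def)
  have LE: "L2F (?g i) (E i)" for i unfolding E_def by (rule L2F_euler) simp
  show "simple_ito_integral M F W (\<lambda>s \<omega>. C *v \<psi> s \<omega>) t (\<lambda>\<omega>. \<Sum>i<k. dW (\<tau> i) (\<tau> (Suc i)) \<omega> *\<^sub>R (C *v E i \<omega>))"
    unfolding simple_ito_integral_def
  proof (intro exI conjI allI impI)
    show "\<tau> 0 = 0" using \<tau>[of 0] by (simp add: grid_def)
    show "\<tau> k = t" using \<tau>k by (simp add: kq)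
    show "\<tau> i \<le> \<tau> (Suc i)" for i by (rule \<tau>mono)
    fix i assume "i < k"
    then have i: "i \<le> q" by (simp add: kq)
    have "L2F (\<tau> i) (\<lambda>\<omega>. C *v E i \<omega>)" unfolding \<tau>[OF i] by (rule L2F_matrix[OF LE])
    then show "(\<lambda>\<omega>. C *v E i \<omega>) \<in> borel_measurable (F (\<tau> i))" "integrable M (\<lambda>\<omega>. (norm (C *v E i \<omega>))\<^sup>2)"
      by (auto simp: L2F_def L2_def)
  next
    have "linear ((*v) C)" by simp
    then show "(\<lambda>s \<omega>. C *v \<psi> s \<omega>) = (\<lambda>s \<omega>. \<Sum>i<k. indicator {\<tau> i<..\<tau> (Suc i)} s *\<^sub>R (C *v E i \<omega>))"
      unfolding \<psi>_def by (simp add: linear_sum linear_scale)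
    show "(\<lambda>\<omega>. \<Sum>i<k. dW (\<tau> i) (\<tau> (Suc i)) \<omega> *\<^sub>R (C *v E i \<omega>)) =
        (\<lambda>\<omega>. \<Sum>i<k. (W (\<tau> (Suc i)) \<omega> - W (\<tau> i) \<omega>) *\<^sub>R (C *v E i \<omega>))" by (simp add: dW_def)
  qed
  show "\<psi> s \<omega> = euler_path A C x j s \<omega>" if s: "s \<in> {0..t} - range ?g" for s \<omega>
  proof -
    define m where "m = nat \<lfloor>s * 2 ^ j\<rfloor>"
    have m: "real m \<le> s * 2 ^ j" "s * 2 ^ j < real m + 1" using s by (auto simp: m_def)
    have "s * 2 ^ j \<le> t * 2 ^ j" using s by simp
    then have mq: "m < k" unfolding m_def kq q_def by (simp add: less_Suc_eq_le nat_mono floor_mono)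
    have "indicat_real {\<tau> i<..\<tau> (Suc i)} s = (if i = m then 1 else 0)" for i
    proof -
      have ne: "s \<noteq> ?g i" for i using s by auto
      have "s \<in> {\<tau> i<..\<tau> (Suc i)} \<longleftrightarrow> ?g i < s \<and> s < ?g (Suc i)"
        using s ne[of "Suc i"] by (auto simp: \<tau>_def min_def)
      also have "\<dots> \<longleftrightarrow> real i < s * 2 ^ j \<and> s * 2 ^ j < real i + 1"
        by (simp add: grid_def field_simps)
      also have "\<dots> \<longleftrightarrow> i = m"
      proof
        assume "real i < s * 2 ^ j \<and> s * 2 ^ j < real i + 1"
        then have "real i < real m + 1" "real m < real i + 1" using m by linarith+
        then show "i = m" by linarith
      next
        assume i: "i = m"
        have "real m \<noteq> s * 2 ^ j" using ne[of m] by (auto simp: grid_def field_simps)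
        then show "real i < s * 2 ^ j \<and> s * 2 ^ j < real i + 1" using m i by auto
      qed
      finally show ?thesis by (simp add: indicator_def)
    qed
    then have "\<psi> s \<omega> = (\<Sum>i<k. if i = m then E i \<omega> else 0)"
      unfolding \<psi>_def by (intro sum.cong refl) simp
    also have "\<dots> = E m \<omega>" using mq by (simp add: sum.delta)
    finally show ?thesis by (simp add: euler_path_def m_def E_def)
  qed
  have ind: "integrable lborel (indicat_real {\<tau> i<..\<tau> (Suc i)})" for i by (rule integrable_indicator_Ioc)
  have form: "indicat_real {0..t} s *\<^sub>R (A *v \<psi> s \<omega>) = (\<Sum>i<k. indicat_real {\<tau> i<..\<tau> (Suc i)} s *\<^sub>R (A *v E i \<omega>))" for s \<omega>
  proof -
    have "linear ((*v) A)" by simp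
    then have "A *v \<psi> s \<omega> = (\<Sum>i<k. indicat_real {\<tau> i<..\<tau> (Suc i)} s *\<^sub>R (A *v E i \<omega>))"
      unfolding \<psi>_def by (simp add: linear_sum linear_scale)
    moreover have "indicat_real {0..t} s * indicat_real {\<tau> i<..\<tau> (Suc i)} s = indicat_real {\<tau> i<..\<tau> (Suc i)} s" for i
      using \<tau>0[of i] \<tau>t[of "Suc i"] by (auto simp: indicator_def)
    ultimately show ?thesis by (simp only: scaleR_sum_right scaleR_scaleR)
  qed
  show "set_integrable lborel {0..t} (\<lambda>s. A *v \<psi> s \<omega>)" for \<omega>
    unfolding set_integrable_def form by (intro Bochner_Integration.integrable_sum integrable_scaleR_left ind)
  have "(LINT s:{0..t}|lborel. A *v \<psi> s \<omega>) = (\<Sum>i<k. (\<tau> (Suc i) - \<tau> i) *\<^sub>R (A *v E i \<omega>))" for \<omega>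
  proof -
    have "(LINT s:{0..t}|lborel. A *v \<psi> s \<omega>) = (\<Sum>i<k. \<integral>s. indicat_real {\<tau> i<..\<tau> (Suc i)} s *\<^sub>R (A *v E i \<omega>) \<partial>lborel)"
      unfolding set_lebesgue_integral_def form
      by (intro Bochner_Integration.integral_sum integrable_scaleR_left ind)
    then show ?thesis using ind \<tau>mono by simp
  qed
  then have eq: "(LINT s:{0..t}|lborel. A *v \<psi> s \<omega>) + (\<Sum>i<k. dW (\<tau> i) (\<tau> (Suc i)) \<omega> *\<^sub>R (C *v E i \<omega>)) =
     (\<Sum>i<k. (\<tau> (Suc i) - \<tau> i) *\<^sub>R (A *v E i \<omega>) + dW (\<tau> i) (\<tau> (Suc i)) \<omega> *\<^sub>R (C *v E i \<omega>))" for \<omega>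
    by (simp add: sum.distrib)
  have "(\<Sum>i<q. (\<tau> (Suc i) - \<tau> i) *\<^sub>R (A *v E i \<omega>) + dW (\<tau> i) (\<tau> (Suc i)) \<omega> *\<^sub>R (C *v E i \<omega>)) =
      euler_sum A C (1 / 2 ^ j) E q \<omega>" for \<omega>
    unfolding euler_sum_def
  proof (rule sum.cong[OF refl])
    fix i assume i: "i \<in> {..<q}"
    have "?g (Suc i) - ?g i = 1 / 2 ^ j" by (simp add: grid_def diff_divide_distrib[symmetric])
    then show "(\<tau> (Suc i) - \<tau> i) *\<^sub>R (A *v E i \<omega>) + dW (\<tau> i) (\<tau> (Suc i)) \<omega> *\<^sub>R (C *v E i \<omega>) =
        (1 / 2 ^ j) *\<^sub>R (A *v E i \<omega>) + dW (?g i) (?g (Suc i)) \<omega> *\<^sub>R (C *v E i \<omega>)"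
      using i by (simp add: \<tau>)
  qed
  moreover have "x + euler_sum A C (1 / 2 ^ j) E q \<omega> = euler_path A C x j t \<omega>" for \<omega>
    unfolding euler_path_def E_def q_def[symmetric] by (rule euler_eq_sum[symmetric])
  ultimately show eq_thm: "x + (LINT s:{0..t}|lborel. A *v \<psi> s \<omega>) + (\<Sum>i<k. dW (\<tau> i) (\<tau> (Suc i)) \<omega> *\<^sub>R (C *v E i \<omega>)) =
      euler_path A C x j t \<omega> + ((t - \<tau> (k - 1)) *\<^sub>R (A *v E (k - 1) \<omega>) + dW (\<tau> (k - 1)) t \<omega> *\<^sub>R (C *v E (k - 1) \<omega>))" for \<omega>
    unfolding add.assoc eq unfolding kq by (simp add: \<tau>k add.assoc[symmetric])
qed

text \<open>
  The contribution of a partial step of length \<open>t - grid \<delta> q \<le> \<delta>\<close>.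
\<close>
lemma euler_remainder_L2:
  fixes A C :: "real^'n^'n"
  assumes \<delta>: "0 < \<delta>" "\<delta> \<le> 1" and t: "grid \<delta> q \<le> t" "t \<le> grid \<delta> (Suc q)"
  shows "L2 M (\<lambda>\<omega>. (t - grid \<delta> q) *\<^sub>R (A *v euler A C x \<delta> q \<omega>) + dW (grid \<delta> q) t \<omega> *\<^sub>R (C *v euler A C x \<delta> q \<omega>))"
    "(\<integral>\<omega>. (norm ((t - grid \<delta> q) *\<^sub>R (A *v euler A C x \<delta> q \<omega>) + dW (grid \<delta> q) t \<omega> *\<^sub>R (C *v euler A C x \<delta> q \<omega>)))\<^sup>2 \<partial>M)
      \<le> euler_const A C 1 * euler_bound A C x t * \<delta>"
proof -
  let ?E = "euler A C x \<delta> q" and ?s = "grid \<delta> q" and ?B = "euler_bound A C x t"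
  let ?a = "(onorm ((*v) A))\<^sup>2" and ?c = "(onorm ((*v) C))\<^sup>2"
  have s: "0 \<le> ?s" using \<delta> by (intro grid_nonneg) simp
  have LE: "L2F ?s ?E" using \<delta> by (intro L2F_euler) simp
  have h: "0 \<le> t - ?s" "t - ?s \<le> \<delta>" using t by (auto simp: grid_def algebra_simps)
  have LA: "L2 M (\<lambda>\<omega>. (t - ?s) *\<^sub>R (A *v ?E \<omega>))" by (intro L2_scaleR L2F_D(1)[OF L2F_matrix[OF LE]])
  have LC: "L2 M (\<lambda>\<omega>. dW ?s t \<omega> *\<^sub>R (C *v ?E \<omega>))" by (rule L2F_D(1)[OF dW_scaleR[OF s t(1) L2F_matrix[OF LE]]])
  show "L2 M (\<lambda>\<omega>. (t - ?s) *\<^sub>R (A *v ?E \<omega>) + dW ?s t \<omega> *\<^sub>R (C *v ?E \<omega>))" by (rule L2_add[OF LA LC])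
  have B: "(\<integral>\<omega>. (norm (?E \<omega>))\<^sup>2 \<partial>M) \<le> ?B" using \<delta> t by (intro euler_L2_bound) auto
  have EA: "(\<integral>\<omega>. (norm (A *v ?E \<omega>))\<^sup>2 \<partial>M) \<le> ?a * ?B" and EC: "(\<integral>\<omega>. (norm (C *v ?E \<omega>))\<^sup>2 \<partial>M) \<le> ?c * ?B"
  proof -
    have "(\<integral>\<omega>. (norm (D *v ?E \<omega>))\<^sup>2 \<partial>M) \<le> (onorm ((*v) D))\<^sup>2 * ?B" for D :: "real^'n^'n"
      by (rule order_trans[OF integral_norm2_bounded_linear_le[OF bounded_linear_matrix L2F_D(1)[OF LE]]])
        (intro mult_left_mono B, simp)
    then show "(\<integral>\<omega>. (norm (A *v ?E \<omega>))\<^sup>2 \<partial>M) \<le> ?a * ?B" "(\<integral>\<omega>. (norm (C *v ?E \<omega>))\<^sup>2 \<partial>M) \<le> ?c * ?B" by blast+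
  qed
  have "(\<integral>\<omega>. (norm ((t - ?s) *\<^sub>R (A *v ?E \<omega>)))\<^sup>2 \<partial>M) = (t - ?s)\<^sup>2 * (\<integral>\<omega>. (norm (A *v ?E \<omega>))\<^sup>2 \<partial>M)"
    by (simp add: power_mult_distrib)
  also have "\<dots> \<le> \<delta> * (?a * ?B)"
  proof (intro mult_mono EA)
    have "(t - ?s)\<^sup>2 \<le> \<delta> * 1" unfolding power2_eq_square using h \<delta> by (intro mult_mono) auto
    then show "(t - ?s)\<^sup>2 \<le> \<delta>" by simp
  qed (use \<delta> in auto)
  finally have 1: "(\<integral>\<omega>. (norm ((t - ?s) *\<^sub>R (A *v ?E \<omega>)))\<^sup>2 \<partial>M) \<le> \<delta> * (?a * ?B)" .
  have "(\<integral>\<omega>. (norm (dW ?s t \<omega> *\<^sub>R (C *v ?E \<omega>)))\<^sup>2 \<partial>M) = (t - ?s) * (\<integral>\<omega>. (norm (C *v ?E \<omega>))\<^sup>2 \<partial>M)"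
    using dW_isometry[OF s t(1) L2F_matrix[OF LE] L2F_matrix[OF LE]] by (simp only: power2_norm_eq_inner)
  also have "\<dots> \<le> \<delta> * (?c * ?B)" using h \<delta> by (intro mult_mono EC) auto
  finally have 2: "(\<integral>\<omega>. (norm (dW ?s t \<omega> *\<^sub>R (C *v ?E \<omega>)))\<^sup>2 \<partial>M) \<le> \<delta> * (?c * ?B)" .
  have "(\<integral>\<omega>. (norm ((t - ?s) *\<^sub>R (A *v ?E \<omega>) + dW ?s t \<omega> *\<^sub>R (C *v ?E \<omega>)))\<^sup>2 \<partial>M) \<le> 2 * (\<delta> * (?a * ?B)) + 2 * (\<delta> * (?c * ?B))"
    using integral_norm2_add_le[OF LA LC] 1 2 by linarith
  also have "\<dots> = euler_const A C 1 * ?B * \<delta>" by (simp add: euler_const_def algebra_simps)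
  finally show "(\<integral>\<omega>. (norm ((t - ?s) *\<^sub>R (A *v ?E \<omega>) + dW ?s t \<omega> *\<^sub>R (C *v ?E \<omega>)))\<^sup>2 \<partial>M) \<le> euler_const A C 1 * ?B * \<delta>" .
qed

lemma euler_simple_approximation:
  fixes A C :: "real^'n^'n" and x :: "real^'n"
  assumes t: "0 \<le> t"
  obtains \<psi> :: "real \<Rightarrow> 'w \<Rightarrow> real^'n" and J \<rho> :: "'w \<Rightarrow> real^'n" where
    "simple_ito_integral M F W (\<lambda>s \<omega>. C *v \<psi> s \<omega>) t J"
    "\<And>s \<omega>. s \<in> {0..t} - range (grid (1 / 2 ^ j)) \<Longrightarrow> \<psi> s \<omega> = euler_path A C x j s \<omega>"
    "\<And>\<omega>. x + (LINT s:{0..t}|lborel. A *v \<psi> s \<omega>) + J \<omega> = euler_path A C x j t \<omega> + \<rho> \<omega>"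
    "\<And>\<omega>. set_integrable lborel {0..t} (\<lambda>s. A *v \<psi> s \<omega>)"
    "truncate t \<psi> \<in> borel_measurable LM"
    "L2 M \<rho>" "(\<integral>\<omega>. (norm (\<rho> \<omega>))\<^sup>2 \<partial>M) \<le> euler_const A C 1 * euler_bound A C x t / 2 ^ j"
proof -
  define q where "q = nat \<lfloor>t * 2 ^ j\<rfloor>"
  let ?g = "grid (1 / 2 ^ j)" and ?E = "euler A C x (1 / 2 ^ j)"
  define \<tau> where "\<tau> = (\<lambda>i. min (?g i) t)"
  define \<psi> where "\<psi> = (\<lambda>s \<omega>. \<Sum>i<Suc q. indicator {\<tau> i<..\<tau> (Suc i)} s *\<^sub>R ?E i \<omega>)"
  define J where "J = (\<lambda>\<omega>. \<Sum>i<Suc q. dW (\<tau> i) (\<tau> (Suc i)) \<omega> *\<^sub>R (C *v ?E i \<omega>))"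
  define \<rho> where "\<rho> = (\<lambda>\<omega>. (t - ?g q) *\<^sub>R (A *v ?E q \<omega>) + dW (?g q) t \<omega> *\<^sub>R (C *v ?E q \<omega>))"
  note ce = clipped_euler_process[OF t, where A=A and C=C and x=x and j=j]
  have c1: "simple_ito_integral M F W (\<lambda>s \<omega>. C *v \<psi> s \<omega>) t J"
    unfolding \<psi>_def J_def \<tau>_def q_def by (rule ce(1))
  have c2: "\<psi> s \<omega> = euler_path A C x j s \<omega>" if "s \<in> {0..t} - range ?g" for s \<omega>
    unfolding \<psi>_def \<tau>_def q_def by (rule ce(2)[OF that])
  have c3: "x + (LINT s:{0..t}|lborel. A *v \<psi> s \<omega>) + J \<omega> =
      euler_path A C x j t \<omega> + ((t - \<tau> (Suc q - 1)) *\<^sub>R (A *v ?E (Suc q - 1) \<omega>) + dW (\<tau> (Suc q - 1)) t \<omega> *\<^sub>R (C *v ?E (Suc q - 1) \<omega>))" for \<omega>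
    unfolding \<psi>_def J_def \<tau>_def q_def by (rule ce(3))
  have c4: "set_integrable lborel {0..t} (\<lambda>s. A *v \<psi> s \<omega>)" for \<omega>
    unfolding \<psi>_def \<tau>_def q_def by (rule ce(4))
  have gq: "?g q \<le> t" unfolding q_def by (rule grid_dyadic_floor_le[OF t])
  have gq': "t \<le> ?g (Suc q)"
  proof -
    have "t * 2 ^ j < real q + 1" using t by (auto simp: q_def)
    then show ?thesis by (simp add: grid_def field_simps)
  qed
  have \<tau>q: "\<tau> q = ?g q" using gq by (simp add: \<tau>_def)
  have meas: "truncate t \<psi> \<in> borel_measurable LM"
  proof -
    have [measurable]: "?E i \<in> borel_measurable M" for i
      using L2F_D(1)[OF L2F_euler[of "1 / 2 ^ j" i A C x]] by (auto simp: L2_def)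
    show ?thesis unfolding truncate_def \<psi>_def by measurable
  qed
  have pos: "0 < 1 / (2::real) ^ j" "1 / (2::real) ^ j \<le> 1" by (auto simp: divide_le_eq)
  note rem = euler_remainder_L2[OF pos gq gq', of A C x, folded \<rho>_def]
  have "(\<integral>\<omega>. (norm (\<rho> \<omega>))\<^sup>2 \<partial>M) \<le> euler_const A C 1 * euler_bound A C x t / 2 ^ j"
    using rem(2) by (simp add: \<rho>_def)
  moreover have "L2 M \<rho>" using rem(1) by (simp add: \<rho>_def)
  moreover have "x + (LINT s:{0..t}|lborel. A *v \<psi> s \<omega>) + J \<omega> = euler_path A C x j t \<omega> + \<rho> \<omega>" for \<omega>
    using c3[of \<omega>] unfolding diff_Suc_1 \<tau>q by (simp only: \<rho>_def)
  ultimately show thesis using that[of \<psi> J \<rho>] c1 c2 c4 meas by blast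
qed

text \<open>
  The simple processes built from the schemes converge to the noise coefficient, and their elementary integrals
  equal the displayed random variable up to three errors of order \<open>1 / 2 ^ j\<close> in mean square: the distance of the
  scheme from its limit at time \<open>t\<close>, the partial step, and the integrated distance in the drift.
\<close>
lemma euler_limit_ito_integral:
  fixes A C :: "real^'n^'n" and x :: "real^'n"
  assumes t: "0 \<le> t"
  shows "has_ito_integral M F W (\<lambda>s \<omega>. C *v euler_limit A C x s \<omega>) t
    (\<lambda>\<omega>. euler_limit A C x t \<omega> - x - (LINT s:{0..t}|lborel. A *v euler_limit A C x s \<omega>))"
proof -
  let ?X = "euler_limit A C x" and ?G = "euler_rate A C x t" and ?P = "\<lambda>j. euler_path A C x j"
  have G: "0 \<le> ?G" by (rule euler_rate_nonneg[OF t])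
  have adm: "admissible M F ?X" by (rule euler_limit_admissible)
  have admC: "admissible M F (\<lambda>s \<omega>. C *v ?X s \<omega>)" by (rule admissible_matrix_mult[OF filtration_subalgebra adm])
  have LX: "L2 LM (truncate t ?X)" by (rule admissible_L2[OF adm t])
  define I where "I = (\<lambda>\<omega>. ?X t \<omega> - x - (LINT s:{0..t}|lborel. A *v ?X s \<omega>))"
  have L_drift: "L2 M (\<lambda>\<omega>. LINT s:{0..t}|lborel. A *v ?X s \<omega>)"
  proof -
    have eq: "indicat_real {0..t} s *\<^sub>R (A *v truncate t ?X (s, \<omega>)) = indicat_real {0..t} s *\<^sub>R (A *v ?X s \<omega>)" for s \<omega>
      by (simp add: truncate_def indicator_def)
    show ?thesis
      using norm_integral_interval_L2(1)[OF L2_bounded_linear[OF bounded_linear_matrix[of A] LX] t]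
      by (simp only: set_lebesgue_integral_def eq)
  qed
  have LXt: "L2 M (?X t)" using euler_limit_L2(1)[OF t order_refl] L2F_D by blast
  have LPt: "L2 M (?P j t)" for j using L2F_euler_path[OF t] L2F_D by blast
  have LI: "L2 M I" unfolding I_def by (intro L2_diff LXt L_drift L2F_D(1)[OF L2F_const[of 0]])
  have "\<forall>j. \<exists>\<psi> J \<rho>. simple_ito_integral M F W (\<lambda>s \<omega>. C *v \<psi> s \<omega>) t J \<and>
    (\<forall>s\<in>{0..t} - range (grid (1 / 2 ^ j)). \<forall>\<omega>. \<psi> s \<omega> = ?P j s \<omega>) \<and>
    (\<forall>\<omega>. x + (LINT s:{0..t}|lborel. A *v \<psi> s \<omega>) + J \<omega> = ?P j t \<omega> + \<rho> \<omega>) \<and>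
    (\<forall>\<omega>. set_integrable lborel {0..t} (\<lambda>s. A *v \<psi> s \<omega>)) \<and>
    truncate t \<psi> \<in> borel_measurable LM \<and> L2 M \<rho> \<and>
    (\<integral>\<omega>. (norm (\<rho> \<omega>))\<^sup>2 \<partial>M) \<le> euler_const A C 1 * euler_bound A C x t / 2 ^ j"
    (is "\<forall>j. \<exists>\<psi> J \<rho>. ?Q j \<psi> J \<rho>")
  proof
    fix j
    obtain \<psi> J \<rho> where a: "simple_ito_integral M F W (\<lambda>s \<omega>. C *v \<psi> s \<omega>) t J"
      "\<And>s \<omega>. s \<in> {0..t} - range (grid (1 / 2 ^ j)) \<Longrightarrow> \<psi> s \<omega> = ?P j s \<omega>"
      "\<And>\<omega>. x + (LINT s:{0..t}|lborel. A *v \<psi> s \<omega>) + J \<omega> = ?P j t \<omega> + \<rho> \<omega>"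
      "\<And>\<omega>. set_integrable lborel {0..t} (\<lambda>s. A *v \<psi> s \<omega>)"
      "truncate t \<psi> \<in> borel_measurable LM" "L2 M \<rho>"
      "(\<integral>\<omega>. (norm (\<rho> \<omega>))\<^sup>2 \<partial>M) \<le> euler_const A C 1 * euler_bound A C x t / 2 ^ j"
      by (rule euler_simple_approximation[OF t, where A=A and C=C and x=x and j=j]) (rule that)
    show "\<exists>\<psi> J \<rho>. ?Q j \<psi> J \<rho>"
      by (intro exI[of _ \<psi>] exI[of _ J] exI[of _ \<rho>] conjI allI ballI a)
  qed
  from choice[OF this] obtain \<psi> where "\<forall>j. \<exists>J \<rho>. ?Q j (\<psi> j) J \<rho>" ..
  from choice[OF this] obtain J where "\<forall>j. \<exists>\<rho>. ?Q j (\<psi> j) (J j) \<rho>" ..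
  from choice[OF this] obtain \<rho> where Q': "\<forall>j. ?Q j (\<psi> j) (J j) (\<rho> j)" ..
  note Q = spec[OF Q']
  define D where "D = (\<lambda>j. truncate t (\<lambda>s \<omega>. \<psi> j s \<omega> - ?X s \<omega>))"
  have D_eq: "D j p = truncate t (\<psi> j) p - truncate t ?X p" for j p
    by (simp add: D_def truncate_def case_prod_unfold scaleR_diff_right)
  have D_meas: "D j \<in> borel_measurable LM" for j
    unfolding D_eq[abs_def] using Q[of j] L2_measurable[OF LX] by (intro borel_measurable_diff) auto
  have nullset: "AE s in lborel. s \<notin> range (grid (1 / 2 ^ j))" for j
    by (intro AE_not_in countable_imp_null_set_lborel countable_image) auto
  have D_ms: "(\<integral>\<^sup>+p. ennreal ((norm (D j p))\<^sup>2) \<partial>LM) \<le> ennreal (?G / 2 ^ j * t)" for j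
  proof -
    have "mean_square_on M {0..t} (\<lambda>s \<omega>. \<psi> j s \<omega> - ?X s \<omega>) \<le> ennreal (?G / 2 ^ j) * ennreal t"
    proof (rule mean_square_on_le[OF _ t])
      show "truncate t (\<lambda>s \<omega>. \<psi> j s \<omega> - ?X s \<omega>) \<in> borel_measurable LM" using D_meas by (simp add: D_def)
      show "AE s in lborel. s \<in> {0..t} \<longrightarrow> (\<integral>\<^sup>+\<omega>. ennreal ((norm (\<psi> j s \<omega> - ?X s \<omega>))\<^sup>2) \<partial>M) \<le> ennreal (?G / 2 ^ j)"
        using nullset[of j]
      proof eventually_elim
        case (elim s)
        show ?case
        proof
          assume s: "s \<in> {0..t}"
          then have s': "0 \<le> s" "s \<le> t" by auto
          have "\<psi> j s \<omega> = ?P j s \<omega>" for \<omega> using Q[of j] elim s by blast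
          then have "(\<integral>\<^sup>+\<omega>. ennreal ((norm (\<psi> j s \<omega> - ?X s \<omega>))\<^sup>2) \<partial>M) = (\<integral>\<^sup>+\<omega>. ennreal ((norm (?P j s \<omega> - ?X s \<omega>))\<^sup>2) \<partial>M)"
            by simp
          also have "\<dots> = ennreal (\<integral>\<omega>. (norm (?P j s \<omega> - ?X s \<omega>))\<^sup>2 \<partial>M)"
            by (intro nn_integral_L2 L2_diff L2F_D(1)[OF L2F_euler_path[OF s'(1)]] L2F_D(1)[OF euler_limit_L2(1)[OF s']])
          also have "\<dots> \<le> ennreal (?G / 2 ^ j)" by (intro ennreal_leI euler_limit_L2(2) s')
          finally show "(\<integral>\<^sup>+\<omega>. ennreal ((norm (\<psi> j s \<omega> - ?X s \<omega>))\<^sup>2) \<partial>M) \<le> ennreal (?G / 2 ^ j)" .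
        qed
      qed
    qed
    also have "\<dots> = ennreal (?G / 2 ^ j * t)"
      by (rule ennreal_mult[symmetric]) (use G t in auto)
    finally show ?thesis using mean_square_on_LM[OF D_meas[of j, unfolded D_def]] by (simp only: D_def)
  qed
  have LD: "L2 LM (D j)" for j
    unfolding L2_iff_nn_integral[OF D_meas] using D_ms[of j] by (rule le_less_trans) simp
  have D2: "(\<integral>p. (norm (D j p))\<^sup>2 \<partial>LM) \<le> ?G / 2 ^ j * t" for j
    using D_ms[of j] G t unfolding nn_integral_L2[OF LD] by simp
  define a where "a = (onorm ((*v) A))\<^sup>2"
  define c where "c = (onorm ((*v) C))\<^sup>2"
  define Z where "Z = (\<lambda>j \<omega>. \<integral>s. indicator {0..t} s *\<^sub>R (A *v D j (s, \<omega>)) \<partial>lborel)"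
  have LAD: "L2 LM (\<lambda>p. A *v D j p)" for j by (rule L2_bounded_linear[OF bounded_linear_matrix LD])
  have LZ: "L2 M (Z j)" for j unfolding Z_def by (rule norm_integral_interval_L2(1)[OF LAD t])
  have Z2: "(\<integral>\<omega>. (norm (Z j \<omega>))\<^sup>2 \<partial>M) \<le> t * (a * (?G / 2 ^ j * t))" for j
  proof -
    have "(\<integral>\<omega>. (norm (Z j \<omega>))\<^sup>2 \<partial>M) \<le> t * (\<integral>p. (norm (A *v D j p))\<^sup>2 \<partial>LM)"
      unfolding Z_def by (rule norm_integral_interval_L2(2)[OF LAD t])
    also have "\<dots> \<le> t * (a * (\<integral>p. (norm (D j p))\<^sup>2 \<partial>LM))"
      unfolding a_def by (intro mult_left_mono integral_norm2_bounded_linear_le bounded_linear_matrix LD t)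
    also have "\<dots> \<le> t * (a * (?G / 2 ^ j * t))" using t D2 by (intro mult_left_mono) (auto simp: a_def)
    finally show ?thesis .
  qed
  have LJ: "L2 M (J j)" for j
    using elementary_L2(2)[OF simple_ito_integral_elementary(1)] Q[of j] by blast
  have JI: "AE \<omega> in M. J j \<omega> - I \<omega> = (?P j t \<omega> - ?X t \<omega>) + (\<rho> j \<omega> - Z j \<omega>)" for j
    using euler_limit_continuous[of A C x]
  proof eventually_elim
    case (elim \<omega>)
    have "continuous_on {0..t} (\<lambda>s. ?X s \<omega>)" by (rule continuous_on_subset[OF conjunct2[OF elim]]) auto
    then have "continuous_on {0..t} (\<lambda>s. A *v ?X s \<omega>)"
      by (rule linear_continuous_on_compose[OF _ bounded_linear.linear[OF bounded_linear_matrix]])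
    then have si: "set_integrable lborel {0..t} (\<lambda>s. A *v ?X s \<omega>)" by (rule borel_integrable_atLeastAtMost')
    have "Z j \<omega> = (LINT s:{0..t}|lborel. A *v \<psi> j s \<omega> - A *v ?X s \<omega>)"
      unfolding Z_def set_lebesgue_integral_def
      by (intro Bochner_Integration.integral_cong refl)
        (simp add: D_def truncate_def indicator_def matrix_vector_mult_diff_distrib)
    also have "\<dots> = (LINT s:{0..t}|lborel. A *v \<psi> j s \<omega>) - (LINT s:{0..t}|lborel. A *v ?X s \<omega>)"
      using Q[of j] by (intro set_integral_diff(2) si) blast
    finally have "Z j \<omega> = \<dots>" .
    moreover have "x + (LINT s:{0..t}|lborel. A *v \<psi> j s \<omega>) + J j \<omega> = ?P j t \<omega> + \<rho> j \<omega>" using Q[of j] by blast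
    ultimately show ?case by (simp add: I_def algebra_simps)
  qed
  define K where "K = 2 * ?G + 4 * (euler_const A C 1 * euler_bound A C x t) + 4 * (t * (a * (?G * t)))"
  have JI2: "(\<integral>\<omega>. (norm (J j \<omega> - I \<omega>))\<^sup>2 \<partial>M) \<le> K / 2 ^ j" for j
  proof -
    have L\<rho>: "L2 M (\<rho> j)" using Q[of j] by blast
    have "(\<integral>\<omega>. (norm (J j \<omega> - I \<omega>))\<^sup>2 \<partial>M) = (\<integral>\<omega>. (norm ((?P j t \<omega> - ?X t \<omega>) + (\<rho> j \<omega> - Z j \<omega>)))\<^sup>2 \<partial>M)"
    proof (rule integral_cong_AE)
      show "(\<lambda>\<omega>. (norm (J j \<omega> - I \<omega>))\<^sup>2) \<in> borel_measurable M"
        by (rule borel_measurable_integrable[OF L2_integrable_norm2[OF L2_diff[OF LJ LI]]])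
      show "(\<lambda>\<omega>. (norm ((?P j t \<omega> - ?X t \<omega>) + (\<rho> j \<omega> - Z j \<omega>)))\<^sup>2) \<in> borel_measurable M"
        by (rule borel_measurable_integrable[OF L2_integrable_norm2[OF L2_add[OF L2_diff[OF LPt LXt] L2_diff[OF L\<rho> LZ]]]])
      show "AE \<omega> in M. (norm (J j \<omega> - I \<omega>))\<^sup>2 = (norm ((?P j t \<omega> - ?X t \<omega>) + (\<rho> j \<omega> - Z j \<omega>)))\<^sup>2"
        using JI[of j] by eventually_elim simp
    qed
    also have "\<dots> \<le> 2 * (\<integral>\<omega>. (norm (?P j t \<omega> - ?X t \<omega>))\<^sup>2 \<partial>M) + 2 * (\<integral>\<omega>. (norm (\<rho> j \<omega> - Z j \<omega>))\<^sup>2 \<partial>M)"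
      by (rule integral_norm2_add_le[OF L2_diff[OF LPt LXt] L2_diff[OF L\<rho> LZ]])
    also have "(\<integral>\<omega>. (norm (\<rho> j \<omega> - Z j \<omega>))\<^sup>2 \<partial>M) \<le> 2 * (\<integral>\<omega>. (norm (\<rho> j \<omega>))\<^sup>2 \<partial>M) + 2 * (\<integral>\<omega>. (norm (Z j \<omega>))\<^sup>2 \<partial>M)"
      using integral_norm2_add_le[OF L\<rho> L2_minus[OF LZ[of j]]] by simp
    finally have "(\<integral>\<omega>. (norm (J j \<omega> - I \<omega>))\<^sup>2 \<partial>M) \<le> 2 * (\<integral>\<omega>. (norm (?P j t \<omega> - ?X t \<omega>))\<^sup>2 \<partial>M) +
        2 * (2 * (\<integral>\<omega>. (norm (\<rho> j \<omega>))\<^sup>2 \<partial>M) + 2 * (\<integral>\<omega>. (norm (Z j \<omega>))\<^sup>2 \<partial>M))" by simp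
    also have "\<dots> \<le> 2 * (?G / 2 ^ j) + 2 * (2 * (euler_const A C 1 * euler_bound A C x t / 2 ^ j) + 2 * (t * (a * (?G / 2 ^ j * t))))"
      using Q[of j] by (intro add_mono mult_left_mono Z2 euler_limit_L2(2) t order_refl) auto
    also have "\<dots> = K / 2 ^ j" by (simp add: K_def add_divide_distrib)
    finally show ?thesis .
  qed
  have pow: "(\<lambda>j. ennreal (b / 2 ^ j)) \<longlonglongrightarrow> 0" for b :: real
  proof -
    have "(\<lambda>j. b * (1 / 2) ^ j) \<longlonglongrightarrow> b * 0" by (intro tendsto_intros LIMSEQ_realpow_zero) auto
    then have "(\<lambda>j. b / 2 ^ j) \<longlonglongrightarrow> 0" by (simp add: power_divide)
    from tendsto_ennrealI[OF this] show ?thesis by simp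
  qed
  have C_ms: "mean_square_on M {0..t} (\<lambda>s \<omega>. C *v \<psi> j s \<omega> - C *v ?X s \<omega>) \<le> ennreal (c * (?G * t) / 2 ^ j)" for j
  proof -
    have tr: "truncate t (\<lambda>s \<omega>. C *v \<psi> j s \<omega> - C *v ?X s \<omega>) p = C *v D j p" for p
      by (simp add: D_def truncate_def case_prod_unfold matrix_vector_mult_diff_distrib matrix_vector_mult_scaleR)
    have LCD: "L2 LM (\<lambda>p. C *v D j p)" by (rule L2_bounded_linear[OF bounded_linear_matrix LD])
    have m: "truncate t (\<lambda>s \<omega>. C *v \<psi> j s \<omega> - C *v ?X s \<omega>) \<in> borel_measurable LM"
      using L2_measurable[OF LCD] by (simp add: tr[abs_def, symmetric])
    have "mean_square_on M {0..t} (\<lambda>s \<omega>. C *v \<psi> j s \<omega> - C *v ?X s \<omega>) = ennreal (\<integral>p. (norm (C *v D j p))\<^sup>2 \<partial>LM)"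
      unfolding mean_square_on_LM[OF m] tr by (rule nn_integral_L2[OF LCD])
    also have "\<dots> \<le> ennreal (c * (?G / 2 ^ j * t))"
    proof (rule ennreal_leI)
      have "(\<integral>p. (norm (C *v D j p))\<^sup>2 \<partial>LM) \<le> c * (\<integral>p. (norm (D j p))\<^sup>2 \<partial>LM)"
        unfolding c_def by (rule integral_norm2_bounded_linear_le[OF bounded_linear_matrix LD])
      also have "\<dots> \<le> c * (?G / 2 ^ j * t)" using D2 by (intro mult_left_mono) (auto simp: c_def)
      finally show "(\<integral>p. (norm (C *v D j p))\<^sup>2 \<partial>LM) \<le> c * (?G / 2 ^ j * t)" .
    qed
    finally show ?thesis by (simp add: mult_ac)
  qed
  have squeeze: "f \<longlonglongrightarrow> 0" if "\<And>j. f j \<le> ennreal (b / 2 ^ j)" for f :: "nat \<Rightarrow> ennreal" and b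
    by (rule tendsto_sandwich[OF _ _ tendsto_const pow[of b]]) (use that in auto)
  show ?thesis
    unfolding has_ito_integral_def I_def[symmetric]
  proof (intro conjI exI allI)
    show "admissible M F (\<lambda>s \<omega>. C *v ?X s \<omega>)" by (rule admC)
    show "I \<in> borel_measurable M" by (rule L2_measurable[OF LI])
    show "simple_ito_integral M F W (\<lambda>s \<omega>. C *v \<psi> j s \<omega>) t (J j)" for j using Q[of j] by blast
    show "(\<lambda>j. mean_square_on M {0..t} (\<lambda>s \<omega>. C *v \<psi> j s \<omega> - C *v ?X s \<omega>)) \<longlonglongrightarrow> 0"
      by (rule squeeze[OF C_ms])
    show "(\<lambda>j. \<integral>\<^sup>+\<omega>. ennreal ((norm (J j \<omega> - I \<omega>))\<^sup>2) \<partial>M) \<longlonglongrightarrow> 0"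
    proof (rule squeeze)
      show "(\<integral>\<^sup>+\<omega>. ennreal ((norm (J j \<omega> - I \<omega>))\<^sup>2) \<partial>M) \<le> ennreal (K / 2 ^ j)" for j
        unfolding nn_integral_L2[OF L2_diff[OF LJ LI]] by (rule ennreal_leI[OF JI2])
    qed
  qed
qed

theorem linear_sde_solution_exists: "linear_sde_solution M F W A C x (euler_limit A C x)"
  unfolding linear_sde_solution_def ito_process_def
proof (intro conjI allI impI)
  show "admissible M F (euler_limit A C x)" by (rule euler_limit_admissible)
  show "AE \<omega> in M. continuous_on {0..} (\<lambda>t. euler_limit A C x t \<omega>)"
    using euler_limit_continuous[of A C x] by eventually_elim blast
  fix t :: real assume "0 \<le> t"
  from euler_limit_ito_integral[OF this, where A=A and C=C and x=x]
  show "\<exists>I. has_ito_integral M F W (\<lambda>t \<omega>. C *v euler_limit A C x t \<omega>) t I \<and>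
      (AE \<omega> in M. euler_limit A C x t \<omega> = x + (LINT s:{0..t}|lborel. A *v euler_limit A C x s \<omega>) + I \<omega>)"
    by - (rule exI, rule conjI, assumption, intro AE_I2, simp)
qed

section \<open>Stability and Lyapunov inequalities\<close>

text \<open>
  If \<open>E|X\<^sub>t|\<^sup>2\<close> were bounded below by \<open>e\<close>, its integral over \<open>[0, T]\<close> would be at least \<open>e T\<close>.
\<close>
lemma mean_square_small_time:
  fixes X :: "real \<Rightarrow> 'w \<Rightarrow> 'b::euclidean_space"
  assumes L: "\<And>t. 0 \<le> t \<Longrightarrow> L2 M (X t)" and adm: "admissible M F X"
    and fin: "mean_square_on M {0..} X < \<infinity>" and e: "0 < e"
  obtains t where "0 \<le> t" "(\<integral>\<omega>. (norm (X t \<omega>))\<^sup>2 \<partial>M) < e"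
proof -
  have "\<exists>t\<ge>0. (\<integral>\<omega>. (norm (X t \<omega>))\<^sup>2 \<partial>M) < e"
  proof (rule ccontr)
    assume neg: "\<not> ?thesis"
    have low: "ennreal (e * T) \<le> mean_square_on M {0..} X" if T: "0 \<le> T" for T
    proof -
      have m [measurable]: "truncate T X \<in> borel_measurable LM"
        using adm T by (intro progressive_truncate_measurable) (auto simp: admissible_def)
      have "ennreal (e * T) = (\<integral>\<^sup>+t. ennreal e * indicator {0..T} t \<partial>lborel)"
        using e T by (simp add: nn_integral_cmult ennreal_mult)
      also have "\<dots> \<le> (\<integral>\<^sup>+t. \<integral>\<^sup>+\<omega>. ennreal ((norm (truncate T X (t, \<omega>)))\<^sup>2) \<partial>M \<partial>lborel)"
      proof (rule nn_integral_mono)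
        fix t :: real
        show "ennreal e * indicator {0..T} t \<le> (\<integral>\<^sup>+\<omega>. ennreal ((norm (truncate T X (t, \<omega>)))\<^sup>2) \<partial>M)"
        proof (cases "t \<in> {0..T}")
          case True
          then have "e \<le> (\<integral>\<omega>. (norm (X t \<omega>))\<^sup>2 \<partial>M)" using neg by (auto simp: not_less)
          then show ?thesis using True nn_integral_L2[OF L[of t]] by (simp add: truncate_def)
        qed simp
      qed
      also have "\<dots> = mean_square_on M {0..T} X"
        unfolding mean_square_on_LM[OF m] by (rule nn_integral_fst) measurable
      also have "\<dots> \<le> mean_square_on M {0..} X"
        unfolding mean_square_on_def by (intro nn_integral_mono) (auto simp: indicator_def)
      finally show ?thesis .
    qed
    obtain r where r: "mean_square_on M {0..} X = ennreal r" "0 \<le> r"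
      using fin by (cases "mean_square_on M {0..} X") auto
    have "ennreal (r + 1) \<le> ennreal r" using low[of "(r + 1) / e"] e r by simp
    then show False using r(2) by simp
  qed
  with that show thesis by blast
qed

lemma linear_sde_admissible:
  "linear_sde_solution M F W A C x X \<Longrightarrow> admissible M F X"
  by (simp add: linear_sde_solution_def ito_process_def)

lemma quadratic_form_abs_le: "\<bar>v \<bullet> (P *v v)\<bar> \<le> onorm ((*v) P) * (norm v)\<^sup>2" for P :: "real^'n^'n"
proof -
  have "\<bar>v \<bullet> (P *v v)\<bar> \<le> norm v * norm (P *v v)" by (rule Cauchy_Schwarz_ineq2)
  also have "\<dots> \<le> norm v * (onorm ((*v) P) * norm v)"
    by (intro mult_left_mono onorm bounded_linear_matrix) simp
  finally show ?thesis by (simp add: power2_eq_square mult_ac)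
qed

text \<open>
  Along the solution \<open>E[X\<^sub>t \<bullet> P X\<^sub>t]\<close> never exceeds \<open>x \<bullet> P x\<close>, and it comes arbitrarily close to \<open>0\<close>.
\<close>
lemma lyapunov_form_nonneg_of_stable:
  fixes A K P :: "real^'n^'n"
  assumes sol: "linear_sde_solution M F W A K x X" and fin: "mean_square_on M {0..} X < \<infinity>"
    and P: "transpose P = P" and sub: "\<And>v. v \<bullet> (lyapunov_op A K P *v v) \<le> 0"
  shows "0 \<le> x \<bullet> (P *v x)"
proof (rule ccontr)
  assume neg: "\<not> ?thesis"
  define c where "c = onorm ((*v) P) + 1"
  have c: "c > 0" using onorm_pos_le[OF bounded_linear_matrix[of P]] by (simp add: c_def)
  have L: "L2 M (X t)" if "0 \<le> t" for t by (rule second_moment_identity(1)[OF sol P that])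
  obtain t where t: "0 \<le> t" "(\<integral>\<omega>. (norm (X t \<omega>))\<^sup>2 \<partial>M) < - (x \<bullet> (P *v x)) / c"
    using mean_square_small_time[OF L linear_sde_admissible[OF sol] fin, of "- (x \<bullet> (P *v x)) / c"] neg c
    by (auto simp: divide_neg_pos)
  have LP: "L2 M (\<lambda>\<omega>. P *v X t \<omega>)" by (rule L2_bounded_linear[OF bounded_linear_matrix L[OF t(1)]])
  have "(\<integral>p. truncate t X p \<bullet> (lyapunov_op A K P *v truncate t X p) \<partial>LM) \<le> 0"
    using integral_nonneg_AE[where M=LM and f="\<lambda>p. - (truncate t X p \<bullet> (lyapunov_op A K P *v truncate t X p))"] sub
    by simp
  then have "(\<integral>\<omega>. X t \<omega> \<bullet> (P *v X t \<omega>) \<partial>M) \<le> x \<bullet> (P *v x)"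
    using second_moment_identity(2)[OF sol P t(1)] by simp
  moreover have "- (c * (\<integral>\<omega>. (norm (X t \<omega>))\<^sup>2 \<partial>M)) \<le> (\<integral>\<omega>. X t \<omega> \<bullet> (P *v X t \<omega>) \<partial>M)"
  proof -
    have "(\<integral>\<omega>. - (c * (norm (X t \<omega>))\<^sup>2) \<partial>M) \<le> (\<integral>\<omega>. X t \<omega> \<bullet> (P *v X t \<omega>) \<partial>M)"
    proof (rule integral_mono)
      show "integrable M (\<lambda>\<omega>. - (c * (norm (X t \<omega>))\<^sup>2))" using L2_integrable_norm2[OF L[OF t(1)]] by simp
      show "integrable M (\<lambda>\<omega>. X t \<omega> \<bullet> (P *v X t \<omega>))" by (rule integrable_inner_L2[OF L[OF t(1)] LP])
      show "- (c * (norm (X t \<omega>))\<^sup>2) \<le> X t \<omega> \<bullet> (P *v X t \<omega>)" for \<omega>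
        using quadratic_form_abs_le[of "X t \<omega>" P] zero_le_power2[of "norm (X t \<omega>)"]
        unfolding c_def distrib_right by linarith
    qed
    then show ?thesis by simp
  qed
  moreover have "c * (\<integral>\<omega>. (norm (X t \<omega>))\<^sup>2 \<partial>M) < - (x \<bullet> (P *v x))"
    using t(2) c by (simp add: field_simps)
  ultimately show False by simp
qed

text \<open>
  Injectivity comes from applying \<open>lyapunov_form_nonneg_of_stable\<close> to both \<open>P\<close> and \<open>- P\<close>.
\<close>
lemma lyapunov_solution_of_stable:
  fixes A K :: "real^'n^'n"
  assumes stable: "L2_stable M (\<lambda>x X. linear_sde_solution M F W A K x X)"
  obtains P where "transpose P = P" "\<And>x. x \<noteq> 0 \<Longrightarrow> 0 < x \<bullet> (P *v x)"
    "\<And>x. x \<bullet> (lyapunov_op A K P *v x) = - (x \<bullet> x)"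
proof -
  have nonneg: "0 \<le> x \<bullet> (P *v x)" if "transpose P = P" "\<And>v. v \<bullet> (lyapunov_op A K P *v v) \<le> 0" for P x
  proof -
    obtain X where "linear_sde_solution M F W A K x X" "mean_square_on M {0..} X < \<infinity>"
      using stable unfolding L2_stable_def by blast
    then show ?thesis by (rule lyapunov_form_nonneg_of_stable[OF _ _ that])
  qed
  have lin: "linear (lyapunov_op A K)" by (rule linear_lyapunov_op)
  have inj: "P = 0" if P: "transpose P = P" and z: "lyapunov_op A K P = 0" for P
  proof -
    have tm: "transpose (- P) = - P" using P by (simp add: transpose_def vec_eq_iff)
    have zm: "lyapunov_op A K (- P) = 0" using linear_neg[OF lin, of P] z by simp
    have "0 \<le> x \<bullet> (P *v x)" for x by (rule nonneg[OF P]) (simp add: z)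
    moreover have "0 \<le> x \<bullet> (- P *v x)" for x by (rule nonneg[OF tm]) (simp add: zm)
    ultimately have "x \<bullet> (P *v x) = 0" for x
      by (metis inner_minus_right matrix_vector_mult_minus neg_0_le_iff_le order_antisym)
    then have "P *v x = 0" for x
      by (intro symmetric_kernel[OF P]) auto
    then show ?thesis by (simp add: matrix_eq_0_iff)
  qed
  have "transpose (- mat 1 :: real^'n^'n) = - mat 1" by (simp add: transpose_def mat_def vec_eq_iff)
  from lyapunov_op_surjective_if_injective[OF inj this] obtain P
    where P: "transpose P = P" "lyapunov_op A K P = - mat 1" by blast
  have eq: "x \<bullet> (lyapunov_op A K P *v x) = - (x \<bullet> x)" for x
    by (simp add: P matrix_vector_mult_minus)
  have psd: "0 \<le> x \<bullet> (P *v x)" for x by (rule nonneg[OF P(1)]) (simp add: eq)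
  have "0 < x \<bullet> (P *v x)" if "x \<noteq> 0" for x
  proof (rule ccontr)
    assume "\<not> ?thesis"
    then have "x \<bullet> (P *v x) = 0" using psd[of x] by simp
    then have "P *v x = 0" by (rule symmetric_kernel[OF P(1) psd])
    then have "x \<bullet> (lyapunov_op A K P *v x) = (K *v x) \<bullet> (P *v (K *v x))"
      by (simp add: lyapunov_op_quadratic_form[OF P(1)])
    then show False using eq[of x] psd[of "K *v x"] that by (metis inner_gt_zero_iff neg_less_0_iff_less not_less)
  qed
  with that P(1) eq show thesis by blast
qed

text \<open>
  Compactness gives \<open>\<Lambda>(P) \<le> - e\<close> for some \<open>e > 0\<close>, and the second moment identity bounds \<open>e E \<integral> |X|\<^sup>2\<close> by \<open>x \<bullet> P x\<close>
  over every finite horizon, hence over \<open>[0, \<infinity>)\<close> by monotone convergence.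
\<close>
lemma stable_of_lyapunov:
  fixes A K P :: "real^'n^'n"
  assumes P: "transpose P = P" and psd: "\<And>x. x \<noteq> 0 \<Longrightarrow> 0 < x \<bullet> (P *v x)"
    and neg: "\<And>x. x \<noteq> 0 \<Longrightarrow> x \<bullet> (lyapunov_op A K P *v x) < 0"
  shows "L2_stable M (\<lambda>x X. linear_sde_solution M F W A K x X)"
  unfolding L2_stable_def
proof (intro allI conjI impI)
  fix x :: "real^'n"
  show "\<exists>X. linear_sde_solution M F W A K x X" using linear_sde_solution_exists by blast
  fix X assume sol: "linear_sde_solution M F W A K x X"
  let ?L = "lyapunov_op A K P"
  obtain e where e: "e > 0" "\<And>v. v \<bullet> (?L *v v) \<le> - (e * (norm v)\<^sup>2)"
  proof -
    have "continuous_on (sphere (0::real^'n) 1) (\<lambda>v. v \<bullet> (?L *v v))"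
      by (rule continuous_on_inner[OF continuous_on_id linear_continuous_on[OF bounded_linear_matrix]])
    moreover have "compact (sphere (0::real^'n) 1)" "sphere (0::real^'n) 1 \<noteq> {}" by auto
    ultimately obtain w where w: "w \<in> sphere (0::real^'n) 1"
      "\<And>v. v \<in> sphere 0 1 \<Longrightarrow> v \<bullet> (?L *v v) \<le> w \<bullet> (?L *v w)"
      using continuous_attains_sup[of "sphere (0::real^'n) 1" "\<lambda>v. v \<bullet> (?L *v v)"] by blast
    define e where "e = - (w \<bullet> (?L *v w))"
    have "w \<noteq> 0" using w(1) by auto
    then have "e > 0" using neg by (simp add: e_def)
    moreover have "v \<bullet> (?L *v v) \<le> - (e * (norm v)\<^sup>2)" for v
    proof (cases "v = 0")
      case False
      define u where "u = (1 / norm v) *\<^sub>R v"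
      have "u \<in> sphere 0 1" using False by (simp add: u_def)
      from w(2)[OF this] have "u \<bullet> (?L *v u) \<le> - e" by (simp add: e_def)
      moreover have "v \<bullet> (?L *v v) = (norm v)\<^sup>2 * (u \<bullet> (?L *v u))"
        using False by (simp add: u_def matrix_vector_mult_scaleR power2_eq_square)
      ultimately show ?thesis using mult_left_mono[of "u \<bullet> (?L *v u)" "- e" "(norm v)\<^sup>2"] by (simp add: mult.commute)
    qed simp
    ultimately show thesis by (rule that)
  qed
  have adm: "admissible M F X" by (rule linear_sde_admissible[OF sol])
  define c where "c = x \<bullet> (P *v x) / e"
  have bound: "mean_square_on M {0..T} X \<le> ennreal c" if T: "0 \<le> T" for T
  proof -
    have LX: "L2 LM (truncate T X)" by (rule admissible_L2[OF adm T])
    have LXT: "L2 M (X T)" by (rule second_moment_identity(1)[OF sol P T])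
    have "0 \<le> v \<bullet> (P *v v)" for v using psd[of v] by (cases "v = 0") auto
    then have "0 \<le> (\<integral>\<omega>. X T \<omega> \<bullet> (P *v X T \<omega>) \<partial>M)" by (intro integral_nonneg_AE AE_I2)
    also have "\<dots> = x \<bullet> (P *v x) + (\<integral>p. truncate T X p \<bullet> (?L *v truncate T X p) \<partial>LM)"
      by (rule second_moment_identity(2)[OF sol P T])
    also have "(\<integral>p. truncate T X p \<bullet> (?L *v truncate T X p) \<partial>LM) \<le> (\<integral>p. - (e * (norm (truncate T X p))\<^sup>2) \<partial>LM)"
      by (intro integral_mono e(2) integrable_inner_L2 LX L2_bounded_linear[OF bounded_linear_matrix LX])
        (use L2_integrable_norm2[OF LX] in simp)
    finally have "e * (\<integral>p. (norm (truncate T X p))\<^sup>2 \<partial>LM) \<le> x \<bullet> (P *v x)" by simp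
    then have "(\<integral>p. (norm (truncate T X p))\<^sup>2 \<partial>LM) \<le> c" using e(1) by (simp add: c_def field_simps)
    then show ?thesis
      unfolding mean_square_on_LM[OF L2_measurable[OF LX]] nn_integral_L2[OF LX] by (rule ennreal_leI)
  qed
  have "mean_square_on M {0..} X \<le> ennreal c"
  proof -
    define g where "g = (\<lambda>n::nat. \<lambda>\<omega>. \<integral>\<^sup>+t\<in>{0..real n}. ennreal ((norm (X t \<omega>))\<^sup>2) \<partial>lborel)"
    have tr: "truncate (real n) X \<in> borel_measurable LM" for n
      using L2_measurable[OF admissible_L2[OF adm]] by simp
    have slice: "(\<lambda>t. ennreal ((norm (X t \<omega>))\<^sup>2) * indicator {0..real n} t) \<in> borel_measurable lborel"
      if "\<omega> \<in> space M" for \<omega> n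
    proof -
      have "(\<lambda>t. truncate (real n) X (t, \<omega>)) \<in> borel_measurable lborel"
        by (rule measurable_compose[OF _ tr]) (use that in simp)
      then have "(\<lambda>t. ennreal ((norm (truncate (real n) X (t, \<omega>)))\<^sup>2)) \<in> borel_measurable lborel" by measurable
      moreover have "ennreal ((norm (truncate (real n) X (t, \<omega>)))\<^sup>2) = ennreal ((norm (X t \<omega>))\<^sup>2) * indicator {0..real n} t" for t
        by (simp add: truncate_def indicator_def)
      ultimately show ?thesis by simp
    qed
    have g_meas: "g n \<in> borel_measurable M" for n
    proof -
      note [measurable] = tr[of n]
      have "(\<lambda>\<omega>. \<integral>\<^sup>+t. ennreal ((norm (truncate (real n) X (t, \<omega>)))\<^sup>2) \<partial>lborel) \<in> borel_measurable M"
        by measurable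
      moreover have "ennreal ((norm (truncate (real n) X (t, \<omega>)))\<^sup>2) = ennreal ((norm (X t \<omega>))\<^sup>2) * indicator {0..real n} t" for t \<omega>
        by (simp add: truncate_def indicator_def)
      ultimately show ?thesis by (simp add: g_def)
    qed
    have g_mono: "incseq g"
      unfolding g_def by (intro incseq_SucI le_funI nn_integral_mono) (auto simp: indicator_def)
    have sup: "(\<integral>\<^sup>+t\<in>{0..}. ennreal ((norm (X t \<omega>))\<^sup>2) \<partial>lborel) = (SUP n. g n \<omega>)" if \<omega>: "\<omega> \<in> space M" for \<omega>
    proof -
      have "(\<integral>\<^sup>+t\<in>{0..}. ennreal ((norm (X t \<omega>))\<^sup>2) \<partial>lborel) =
          (\<integral>\<^sup>+t. (SUP n::nat. ennreal ((norm (X t \<omega>))\<^sup>2) * indicator {0..real n} t) \<partial>lborel)"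
      proof (rule nn_integral_cong)
        fix t :: real
        show "ennreal ((norm (X t \<omega>))\<^sup>2) * indicator {0..} t = (SUP n::nat. ennreal ((norm (X t \<omega>))\<^sup>2) * indicator {0..real n} t)"
        proof (rule antisym)
          obtain n :: nat where n: "t \<le> real n" using real_arch_simple by blast
          have "ennreal ((norm (X t \<omega>))\<^sup>2) * indicator {0..} t = ennreal ((norm (X t \<omega>))\<^sup>2) * indicator {0..real n} t"
            using n by (simp add: indicator_def)
          then show "ennreal ((norm (X t \<omega>))\<^sup>2) * indicator {0..} t \<le> (SUP n::nat. ennreal ((norm (X t \<omega>))\<^sup>2) * indicator {0..real n} t)"
            by (intro order_trans[OF eq_refl SUP_upper[of n]]) auto
        qed (auto intro!: SUP_least simp: indicator_def)
      qed
      also have "\<dots> = (SUP n::nat. \<integral>\<^sup>+t. ennreal ((norm (X t \<omega>))\<^sup>2) * indicator {0..real n} t \<partial>lborel)"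
      proof (rule nn_integral_monotone_convergence_SUP)
        show "incseq (\<lambda>n t. ennreal ((norm (X t \<omega>))\<^sup>2) * indicator {0..real n} t)"
          by (intro incseq_SucI le_funI) (auto simp: indicator_def)
      qed (rule slice[OF \<omega>])
      finally show ?thesis by (simp add: g_def)
    qed
    have "mean_square_on M {0..} X = (\<integral>\<^sup>+\<omega>. (SUP n. g n \<omega>) \<partial>M)"
      unfolding mean_square_on_def by (rule nn_integral_cong) (rule sup)
    also have "\<dots> = (SUP n. \<integral>\<^sup>+\<omega>. g n \<omega> \<partial>M)"
      by (rule nn_integral_monotone_convergence_SUP[OF g_mono g_meas])
    also have "\<dots> \<le> ennreal c"
    proof (rule SUP_least)
      fix n :: nat
      show "(\<integral>\<^sup>+\<omega>. g n \<omega> \<partial>M) \<le> ennreal c" using bound[of "real n"] by (simp add: mean_square_on_def g_def)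
    qed
    finally show ?thesis .
  qed
  then show "mean_square_on M {0..} X < \<infinity>" by (rule le_less_trans) simp
qed

end

section \<open>The eigenvalue criterion\<close>

theorem theorem4p6:
  fixes A C :: "real^'n^'n" and B :: "real^'m^'n"
    and M :: "'w measure" and F :: "real \<Rightarrow> 'w measure" and W :: "real \<Rightarrow> 'w \<Rightarrow> real"
  assumes "brownian_motion M F W"
  shows "stabilizable M F W A B C \<longleftrightarrow>
    (\<forall>\<mu>\<le>0. \<forall>H :: real^'n^'n. positive_semidefinite H \<longrightarrow>
       lyapunov_op (- A) C H = \<mu> *\<^sub>R H \<longrightarrow> transpose B ** H = 0 \<longrightarrow> H = 0)"
proof -
  interpret brownian_motion M F W by fact
  have closed: "stabilizable M F W A B C \<longleftrightarrow>
      (\<exists>(\<Phi> :: real^'n^'m) (K :: real^'n^'n). L2_stable M (\<lambda>x X. linear_sde_solution M F W (A + B ** \<Phi> + C ** K) K x X))"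
    unfolding stabilizable_def backward_structured_solution_closed_loop[OF assms] ..
  show ?thesis
  proof
    assume "stabilizable M F W A B C"
    then obtain \<Phi> K where stable: "L2_stable M (\<lambda>x X. linear_sde_solution M F W (A + B ** \<Phi> + C ** K) K x X)"
      unfolding closed by blast
    obtain P where P: "transpose P = P" "\<And>x. x \<noteq> 0 \<Longrightarrow> 0 < x \<bullet> (P *v x)"
      "\<And>x. x \<bullet> (lyapunov_op (A + B ** \<Phi> + C ** K) K P *v x) = - (x \<bullet> x)"
      by (rule lyapunov_solution_of_stable[OF stable]) (rule that)
    show "\<forall>\<mu>\<le>0. \<forall>H :: real^'n^'n. positive_semidefinite H \<longrightarrow>
       lyapunov_op (- A) C H = \<mu> *\<^sub>R H \<longrightarrow> transpose B ** H = 0 \<longrightarrow> H = 0"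
    proof (intro allI impI)
      fix \<mu> :: real and H :: "real^'n^'n"
      assume "\<mu> \<le> 0" "positive_semidefinite H" "lyapunov_op (- A) C H = \<mu> *\<^sub>R H" "transpose B ** H = 0"
      then show "H = 0" by (intro eigenvector_zero_if_lyapunov[OF P])
    qed
  next
    assume no_eig: "\<forall>\<mu>\<le>0. \<forall>H :: real^'n^'n. positive_semidefinite H \<longrightarrow>
       lyapunov_op (- A) C H = \<mu> *\<^sub>R H \<longrightarrow> transpose B ** H = 0 \<longrightarrow> H = 0"
    have "\<exists>Q k. transpose Q = Q \<and> (\<forall>x. x \<noteq> 0 \<longrightarrow> 0 < x \<bullet> (Q *v x)) \<and>
      (\<forall>y. y \<noteq> 0 \<longrightarrow> 0 < y \<bullet> ((C ** Q ** transpose C - A ** Q - Q ** transpose A + k *\<^sub>R (B ** transpose B)) *v y))"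
    proof (rule ccontr)
      assume nofeas: "\<not> ?thesis"
      obtain H where H: "positive_semidefinite H" "H \<noteq> 0" "\<And>x. x \<bullet> (lyapunov_op (- A) C H *v x) \<le> 0"
        "transpose B ** H = 0"
      proof (rule feasible_or_subharmonic[of C A B])
        fix Q k
        assume q: "transpose Q = Q" "\<And>x. x \<noteq> 0 \<Longrightarrow> 0 < x \<bullet> (Q *v x)"
          "\<And>y. y \<noteq> 0 \<Longrightarrow> 0 < y \<bullet> ((C ** Q ** transpose C - A ** Q - Q ** transpose A + k *\<^sub>R (B ** transpose B)) *v y)"
        show False
          by (rule notE[OF nofeas]) (intro exI[of _ Q] exI[of _ k] conjI allI impI q)
      next
        fix H :: "real^'n^'n"
        assume "positive_semidefinite H" "H \<noteq> 0" "\<And>x. x \<bullet> (lyapunov_op (- A) C H *v x) \<le> 0" "transpose B ** H = 0"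
        then show thesis by (rule that)
      qed
      note inv = lyapunov_op_kernel_invariant[OF H(1) H(3)]
      obtain N \<mu> where N: "positive_semidefinite N" "trace N = 1" "\<And>v. H *v v = 0 \<Longrightarrow> N *v v = 0"
        "lyapunov_op (- A) C N = \<mu> *\<^sub>R N"
        by (rule psd_eigenvector_exists[OF H(1,2) inv]) (assumption, assumption, rule that)
      have N0: "N \<noteq> 0" using N(2) by (auto simp: trace_def)
      have "\<mu> \<le> 0" by (rule psd_eigenvalue_nonpos[OF H(1-3) N(1) N0 N(3,4)])
      moreover have "transpose B ** N = 0"
      proof -
        have symH: "transpose H = H" and symN: "transpose N = N"
          using H(1) N(1) by (auto simp: positive_semidefinite_def)
        have "H ** B = transpose (transpose B ** H)" by (simp add: matrix_transpose_mul symH)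
        then have "H ** B = 0" using H(4) by (simp add: transpose_zero)
        then have "H *v (B *v y) = 0" for y by (metis matrix_vector_mul_assoc matrix_vector_mult_0)
        then have "N ** B *v y = 0" for y using N(3) by (simp add: matrix_vector_mul_assoc[symmetric])
        then have "N ** B = 0" by (simp add: matrix_eq_0_iff)
        moreover have "transpose B ** N = transpose (N ** B)" by (simp add: matrix_transpose_mul symN)
        ultimately show ?thesis by (simp add: transpose_zero)
      qed
      ultimately show False using no_eig N(1,4) N0 by blast
    qed
    then obtain Q k where "transpose Q = Q \<and> (\<forall>x. x \<noteq> 0 \<longrightarrow> 0 < x \<bullet> (Q *v x)) \<and>
      (\<forall>y. y \<noteq> 0 \<longrightarrow> 0 < y \<bullet> ((C ** Q ** transpose C - A ** Q - Q ** transpose A + k *\<^sub>R (B ** transpose B)) *v y))"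
      by (elim exE)
    then have Q: "transpose Q = Q" "\<And>x. x \<noteq> 0 \<Longrightarrow> 0 < x \<bullet> (Q *v x)"
      "\<And>y. y \<noteq> 0 \<Longrightarrow> 0 < y \<bullet> ((C ** Q ** transpose C - A ** Q - Q ** transpose A + k *\<^sub>R (B ** transpose B)) *v y)"
      by simp_all
    obtain P :: "real^'n^'n" and \<Phi> :: "real^'n^'m" and K :: "real^'n^'n"
      where P: "transpose P = P" "\<And>x. x \<noteq> 0 \<Longrightarrow> 0 < x \<bullet> (P *v x)"
        "\<And>x. x \<noteq> 0 \<Longrightarrow> x \<bullet> (lyapunov_op (A + B ** \<Phi> + C ** K) K P *v x) < 0"
      by (rule feedback_of_feasible[OF Q]) (assumption, assumption, rule that)
    have "L2_stable M (\<lambda>x X. linear_sde_solution M F W (A + B ** \<Phi> + C ** K) K x X)"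
      by (rule stable_of_lyapunov[OF P])
    then show "stabilizable M F W A B C" unfolding closed by blast
  qed
qed

end
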